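(* Let $s \ge 2$ be an integer. There is a constant $C$ such that for every integer $k \ge s + C$, $$\min (S_k)' \le \frac{1}{\binom{k-11}{s-1}}.$$
   Context: For integers $s \ge 2$, $n \ge 1$ and $p\in[0,1]$, the random $s$-uniform hypergraph $G^s(n,p)$ is the random $s$-uniform hypergraph on vertex set $\{1,\dots,n\}$ in which each of the $\binom{n}{s}$ possible $s$-element edges is present independently with probability $p$. First-order properties of $s$-uniform hypergraphs are those expressible by first-order formulae built from the $s$-ary predicate symbol $N$ (meaning "these $s$ vertices form an edge"), equality, logical connectives, variables and quantifiers $\forall,\exists$ over vertices; the quantifier depth of a formula is the maximum number of nested quantifiers. For a first-order property $L$, its spectrum $S(L)$ is the set of all $\alpha \in (0, s-1)$ for which it is not the case that $\lim_{n\to\infty}\Pr[G^s(n,n^{-\alpha}) \models L]$ exists and equals $0$ or $1$. $S_k$ is the union of $S(L)$ over all first-order properties $L$ expressible by a formula of quantifier depth at most $k$ (equivalently, the set of $\alpha\in(0,s-1)$ for which $G^s(n,n^{-\alpha})$ fails the zero-one $k$-law). $(S_k)'$ denotes the set of limit points of $S_k$. *)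

theory Defs
  imports "HOL-Probability.Probability"
begin

text \<open>
  Hypergraphs are pairs of a vertex set and a set of edges. Formulae use named variables;
  \<open>Edge xs\<close> is the atom \<open>N(x\<^sub>1, \<dots>, x\<^sub>s)\<close>, whose arity \<open>s\<close> is enforced by \<open>has_arity\<close>.
\<close>

type_synonym hypergraph = "nat set \<times> nat set set"

datatype fo_formula =
    Edge "nat list"
  | Equal nat nat
  | Neg fo_formula
  | Conj fo_formula fo_formula
  | Disj fo_formula fo_formula
  | Impl fo_formula fo_formula
  | Equiv fo_formula fo_formula
  | Forall nat fo_formula
  | Exists nat fo_formula

fun has_arity :: "nat \<Rightarrow> fo_formula \<Rightarrow> bool" where
  "has_arity s (Edge xs) \<longleftrightarrow> length xs = s"
| "has_arity s (Equal x y) \<longleftrightarrow> True"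
| "has_arity s (Neg \<phi>) \<longleftrightarrow> has_arity s \<phi>"
| "has_arity s (Conj \<phi> \<psi>) \<longleftrightarrow> has_arity s \<phi> \<and> has_arity s \<psi>"
| "has_arity s (Disj \<phi> \<psi>) \<longleftrightarrow> has_arity s \<phi> \<and> has_arity s \<psi>"
| "has_arity s (Impl \<phi> \<psi>) \<longleftrightarrow> has_arity s \<phi> \<and> has_arity s \<psi>"
| "has_arity s (Equiv \<phi> \<psi>) \<longleftrightarrow> has_arity s \<phi> \<and> has_arity s \<psi>"
| "has_arity s (Forall x \<phi>) \<longleftrightarrow> has_arity s \<phi>"
| "has_arity s (Exists x \<phi>) \<longleftrightarrow> has_arity s \<phi>"

fun free_vars :: "fo_formula \<Rightarrow> nat set" where
  "free_vars (Edge xs) = set xs"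
| "free_vars (Equal x y) = {x, y}"
| "free_vars (Neg \<phi>) = free_vars \<phi>"
| "free_vars (Conj \<phi> \<psi>) = free_vars \<phi> \<union> free_vars \<psi>"
| "free_vars (Disj \<phi> \<psi>) = free_vars \<phi> \<union> free_vars \<psi>"
| "free_vars (Impl \<phi> \<psi>) = free_vars \<phi> \<union> free_vars \<psi>"
| "free_vars (Equiv \<phi> \<psi>) = free_vars \<phi> \<union> free_vars \<psi>"
| "free_vars (Forall x \<phi>) = free_vars \<phi> - {x}"
| "free_vars (Exists x \<phi>) = free_vars \<phi> - {x}"

fun quantifier_depth :: "fo_formula \<Rightarrow> nat" where
  "quantifier_depth (Edge xs) = 0"
| "quantifier_depth (Equal x y) = 0"
| "quantifier_depth (Neg \<phi>) = quantifier_depth \<phi>"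
| "quantifier_depth (Conj \<phi> \<psi>) = max (quantifier_depth \<phi>) (quantifier_depth \<psi>)"
| "quantifier_depth (Disj \<phi> \<psi>) = max (quantifier_depth \<phi>) (quantifier_depth \<psi>)"
| "quantifier_depth (Impl \<phi> \<psi>) = max (quantifier_depth \<phi>) (quantifier_depth \<psi>)"
| "quantifier_depth (Equiv \<phi> \<psi>) = max (quantifier_depth \<phi>) (quantifier_depth \<psi>)"
| "quantifier_depth (Forall x \<phi>) = Suc (quantifier_depth \<phi>)"
| "quantifier_depth (Exists x \<phi>) = Suc (quantifier_depth \<phi>)"

text \<open>
  In an \<open>s\<close>-uniform hypergraph, an atom with \<open>s\<close> arguments can only hold if these are pairwise
  distinct, since otherwise the set of their values has fewer than \<open>s\<close> elements.
\<close>

fun sat :: "hypergraph \<Rightarrow> (nat \<Rightarrow> nat) \<Rightarrow> fo_formula \<Rightarrow> bool" where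
  "sat H v (Edge xs) \<longleftrightarrow> v ` set xs \<in> snd H"
| "sat H v (Equal x y) \<longleftrightarrow> v x = v y"
| "sat H v (Neg \<phi>) \<longleftrightarrow> \<not> sat H v \<phi>"
| "sat H v (Conj \<phi> \<psi>) \<longleftrightarrow> sat H v \<phi> \<and> sat H v \<psi>"
| "sat H v (Disj \<phi> \<psi>) \<longleftrightarrow> sat H v \<phi> \<or> sat H v \<psi>"
| "sat H v (Impl \<phi> \<psi>) \<longleftrightarrow> (sat H v \<phi> \<longrightarrow> sat H v \<psi>)"
| "sat H v (Equiv \<phi> \<psi>) \<longleftrightarrow> (sat H v \<phi> \<longleftrightarrow> sat H v \<psi>)"
| "sat H v (Forall x \<phi>) \<longleftrightarrow> (\<forall>a\<in>fst H. sat H (v(x := a)) \<phi>)"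
| "sat H v (Exists x \<phi>) \<longleftrightarrow> (\<exists>a\<in>fst H. sat H (v(x := a)) \<phi>)"

definition models :: "hypergraph \<Rightarrow> fo_formula \<Rightarrow> bool" where
  "models H \<phi> \<longleftrightarrow> (\<forall>v. range v \<subseteq> fst H \<longrightarrow> sat H v \<phi>)"

definition fo_properties :: "nat \<Rightarrow> nat \<Rightarrow> hypergraph set set" where
  "fo_properties s k =
     {{H. models H \<phi>} | \<phi>. has_arity s \<phi> \<and> free_vars \<phi> = {} \<and> quantifier_depth \<phi> \<le> k}"

definition possible_edges :: "nat \<Rightarrow> nat \<Rightarrow> nat set set" where
  "possible_edges s n = {e. e \<subseteq> {1..n} \<and> card e = s}"

definition random_hypergraph :: "nat \<Rightarrow> nat \<Rightarrow> real \<Rightarrow> hypergraph pmf" where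
  "random_hypergraph s n p =
     map_pmf (\<lambda>present. ({1..n}, {e \<in> possible_edges s n. present e}))
       (Pi_pmf (possible_edges s n) False (\<lambda>_. bernoulli_pmf p))"

definition spectrum :: "nat \<Rightarrow> hypergraph set \<Rightarrow> real set" where
  "spectrum s L =
     {\<alpha> \<in> {0<..<real s - 1}.
        \<not> ((\<lambda>n. measure_pmf.prob (random_hypergraph s n (real n powr - \<alpha>)) L) \<longlonglongrightarrow> 0 \<or>
           (\<lambda>n. measure_pmf.prob (random_hypergraph s n (real n powr - \<alpha>)) L) \<longlonglongrightarrow> 1)}"

definition spectrum_upto :: "nat \<Rightarrow> nat \<Rightarrow> real set" where
  "spectrum_upto s k = (\<Union>L\<in>fo_properties s k. spectrum s L)"

definition limit_points :: "real set \<Rightarrow> real set" where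
  "limit_points A = {x. x islimpt A}"

end

theory Submission
  imports Defs "HOL-Real_Asymp.Real_Asymp"
begin

text \<open>
  Put \<open>m = k - 11\<close> and \<open>M = (m choose (s - 1))\<close>, and say that \<open>u\<close> is joined to a vertex
  set \<open>B\<close> if all sets \<open>{u} \<union> S\<close> with \<open>S \<subseteq> B\<close> and \<open>|S| = s - 1\<close> are edges. If \<open>\<alpha> M = 1 + \<epsilon>\<close>,
  attaching a new vertex to a given \<open>m\<close>-set multiplies the expected number of copies of a
  configuration by about \<open>n powr (- \<epsilon>)\<close>, while every free vertex contributes a factor \<open>n\<close>.

  For distinct vertices \<open>a\<^sub>0\<close>, ..., \<open>a\<^sub>m\<close> let the cluster \<open>N\<^sub>i\<close> consist of the vertices joined to
  all \<open>a\<^sub>j\<close> with \<open>j \<noteq> i\<close>. Say that \<open>p\<close> covers a set \<open>Y\<close> if for every \<open>y \<in> Y\<close> some \<open>u\<close> is joined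
  to \<open>{y, p, a\<^sub>3, ..., a\<^sub>m}\<close>. If \<open>d \<epsilon> < 1 < (d + 1) \<epsilon>\<close>, then asymptotically almost surely every set
  of at most \<open>d\<close> vertices can be covered, whereas covering \<open>d + 1\<close> vertices has negative exponent.
  Hence the sentence ``there are \<open>a\<^sub>0\<close>, ..., \<open>a\<^sub>m\<close> and \<open>b \<in> N\<^sub>0\<close> such that no \<open>N\<^sub>i \<union> {b}\<close> can be
  covered'' forces \<open>|N\<^sub>0| \<ge> d + 1\<close> and \<open>|N\<^sub>i| \<ge> d\<close>: it asserts the existence of a configuration with
  \<open>m + 1\<close> free vertices and \<open>(m + 1) d + 1\<close> attached ones, and conversely such a configuration at
  its threshold leaves no room for a cover. Its threshold is \<open>\<epsilon> = (m + 1) / ((m + 1) d + 1)\<close>. There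
  the first moment (copies come in pairs) bounds the probability by \<open>1 / 2\<close> from above, and the
  second moment bounds it away from \<open>0\<close>. The sentence does not depend on \<open>d\<close>, so letting \<open>d\<close> tend to
  infinity exhibits \<open>1 / M\<close> as a limit point.
\<close>

section \<open>Random subsets\<close>

definition random_subset :: "'a set \<Rightarrow> real \<Rightarrow> 'a set pmf" where
  "random_subset I p = map_pmf (\<lambda>f. {x \<in> I. f x}) (Pi_pmf I False (\<lambda>_. bernoulli_pmf p))"

lemma set_pmf_random_subset: "A \<in> set_pmf (random_subset I p) \<Longrightarrow> A \<subseteq> I"
  by (auto simp: random_subset_def)

lemma finite_set_pmf_random_subset: "finite I \<Longrightarrow> finite (set_pmf (random_subset I p))"
  by (rule finite_subset[of _ "Pow I"]) (auto dest: set_pmf_random_subset)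

lemma integrable_random_subset:
  fixes h :: "'a set \<Rightarrow> real"
  shows "finite I \<Longrightarrow> integrable (random_subset I p) h"
  by (simp add: integrable_measure_pmf_finite finite_set_pmf_random_subset)

lemma random_subset_Un:
  assumes "finite I" "finite J" "I \<inter> J = {}"
  shows "random_subset (I \<union> J) p =
    map_pmf (\<lambda>(A, B). A \<union> B) (pair_pmf (random_subset I p) (random_subset J p))"
  using assms(3) unfolding random_subset_def Pi_pmf_union[OF assms] map_pair[symmetric] pmf.map_comp
  by (intro map_pmf_cong) auto

lemma random_subset_Int:
  assumes "finite I"
  shows "random_subset (I \<inter> K) p = map_pmf (\<lambda>A. A \<inter> K) (random_subset I p)"
  unfolding random_subset_def Pi_pmf_subset[OF assms Int_lower1] pmf.map_comp
  by (intro map_pmf_cong) auto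

lemma random_subset_resample:
  assumes "finite I"
  shows "map_pmf (\<lambda>(B, A). B \<inter> K \<union> (A - K)) (pair_pmf (random_subset I p) (random_subset I p)) =
    random_subset I p"
proof -
  have "random_subset I p = random_subset ((I \<inter> K) \<union> (I \<inter> - K)) p"
    by (simp flip: Int_Un_distrib)
  also have "\<dots> = map_pmf (\<lambda>(A, B). A \<union> B)
      (pair_pmf (random_subset (I \<inter> K) p) (random_subset (I \<inter> - K) p))"
    using assms by (intro random_subset_Un) auto
  finally show ?thesis
    unfolding random_subset_Int[OF assms] map_pair[symmetric] pmf.map_comp
    by (simp add: case_prod_beta' Diff_eq o_def)
qed

lemma prob_random_subset_resample:
  assumes "finite I"
  shows "measure_pmf.prob (random_subset I p) {A. P A} =
    measure_pmf.expectation (random_subset I p)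
      (\<lambda>B. measure_pmf.prob (random_subset I p) {A. P (B \<inter> K \<union> (A - K))})"
    (is "?l = measure_pmf.expectation ?R ?h")
proof -
  have "ennreal ?l = emeasure (map_pmf (\<lambda>(B, A). B \<inter> K \<union> (A - K)) (pair_pmf ?R ?R)) {A. P A}"
    unfolding random_subset_resample[OF assms] by (simp add: measure_pmf.emeasure_eq_measure)
  also have "\<dots> = (\<integral>\<^sup>+B. ennreal (?h B) \<partial>?R)"
    by (simp add: pair_pmf_def map_bind_pmf map_pmf_def[symmetric] pmf.map_comp vimage_def
        measure_pmf.emeasure_eq_measure[symmetric] o_def bind_return_pmf')
  also have "\<dots> = ennreal (measure_pmf.expectation ?R ?h)"
    by (intro nn_integral_eq_integral integrable_random_subset assms) auto
  finally show ?thesis by (simp add: integral_nonneg_AE)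
qed

lemma prob_random_subset_two_stage:
  assumes I: "finite I" and "c \<ge> 0"
    and cond: "\<And>B. G B \<Longrightarrow> measure_pmf.prob (random_subset I p) {A. P (B \<inter> K \<union> (A - K))} \<le> c"
  shows "measure_pmf.prob (random_subset I p) {A. P A} \<le>
    measure_pmf.prob (random_subset I p) {B. \<not> G B} + c"
proof -
  let ?R = "random_subset I p"
  have "measure_pmf.prob ?R {A. P A} =
      measure_pmf.expectation ?R (\<lambda>B. measure_pmf.prob ?R {A. P (B \<inter> K \<union> (A - K))})"
    by (rule prob_random_subset_resample[OF I])
  also have "\<dots> \<le> measure_pmf.expectation ?R (\<lambda>B. indicator {B. \<not> G B} B + c)"
  proof (intro integral_mono integrable_random_subset I)
    fix B
    show "measure_pmf.prob ?R {A. P (B \<inter> K \<union> (A - K))} \<le> indicator {B. \<not> G B} B + c"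
      using cond[of B] \<open>c \<ge> 0\<close>
      by (cases "G B") (auto intro: order_trans[OF measure_pmf.prob_le_1])
  qed
  also have "\<dots> = measure_pmf.prob ?R {B. \<not> G B} + c"
    by (subst Bochner_Integration.integral_add) (auto intro: integrable_random_subset I)
  finally show ?thesis .
qed

definition determined_by :: "('a set \<Rightarrow> bool) \<Rightarrow> 'a set \<Rightarrow> bool" where
  "determined_by P K \<longleftrightarrow> (\<forall>A. P (A \<inter> K) = P A)"

lemma determined_by_subset: "determined_by ((\<subseteq>) F) F"
  by (auto simp: determined_by_def)

lemma determined_by_Not: "determined_by P K \<Longrightarrow> determined_by (\<lambda>A. \<not> P A) K"
  by (simp add: determined_by_def)

lemma determined_by_mono:
  assumes "determined_by P K" "K \<subseteq> L"
  shows "determined_by P L"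
proof -
  have "P (A \<inter> L) = P (A \<inter> L \<inter> K)" for A
    using assms(1) unfolding determined_by_def by blast
  moreover have "A \<inter> L \<inter> K = A \<inter> K" for A using assms(2) by blast
  ultimately show ?thesis using assms(1) by (simp add: determined_by_def)
qed

lemma determined_by_Ball:
  assumes "\<And>j. j \<in> J \<Longrightarrow> determined_by (P j) (K j)"
  shows "determined_by (\<lambda>A. \<forall>j\<in>J. P j A) (\<Union>j\<in>J. K j)"
proof -
  have "determined_by (P j) (\<Union>j\<in>J. K j)" if "j \<in> J" for j
    using assms that by (blast intro: determined_by_mono)
  then show ?thesis by (simp add: determined_by_def)
qed

lemma determined_by_Bex:
  assumes "\<And>j. j \<in> J \<Longrightarrow> determined_by (P j) (K j)"
  shows "determined_by (\<lambda>A. \<exists>j\<in>J. P j A) (\<Union>j\<in>J. K j)"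
  using determined_by_Not[OF determined_by_Ball[of J "\<lambda>j A. \<not> P j A"]] assms
  by (simp add: determined_by_Not)

lemma prob_random_subset_conj:
  assumes "finite I" "determined_by P K" "determined_by Q L" "K \<inter> L = {}"
  shows "measure_pmf.prob (random_subset I p) {A. P A \<and> Q A} =
    measure_pmf.prob (random_subset I p) {A. P A} * measure_pmf.prob (random_subset I p) {A. Q A}"
proof -
  let ?R = "random_subset I p"
  have P: "P (B \<inter> K \<union> (A - K)) = P B" for A B
  proof -
    have "(B \<inter> K \<union> (A - K)) \<inter> K = B \<inter> K" by blast
    then show ?thesis using assms(2) unfolding determined_by_def by metis
  qed
  have Q: "Q (B \<inter> K \<union> (A - K)) = Q A" for A B
  proof -
    have "(B \<inter> K \<union> (A - K)) \<inter> L = A \<inter> L" using assms(4) by blast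
    then show ?thesis using assms(3) unfolding determined_by_def by metis
  qed
  have "measure_pmf.prob ?R {A. P A \<and> Q A} =
      measure_pmf.expectation ?R (\<lambda>B. measure_pmf.prob ?R {A. P B \<and> Q A})"
    by (subst prob_random_subset_resample[OF assms(1), where K=K]) (simp add: P Q)
  also have "\<dots> =
      measure_pmf.expectation ?R (\<lambda>B. indicator {B. P B} B * measure_pmf.prob ?R {A. Q A})"
    by (intro Bochner_Integration.integral_cong) (auto simp: indicator_def)
  finally show ?thesis by simp
qed

lemma prob_random_subset_Ball:
  assumes "finite I" "finite J" "\<And>j. j \<in> J \<Longrightarrow> determined_by (P j) (K j)"
    and "disjoint_family_on K J"
  shows "measure_pmf.prob (random_subset I p) {A. \<forall>j\<in>J. P j A} =
    (\<Prod>j\<in>J. measure_pmf.prob (random_subset I p) {A. P j A})"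
  using assms(2,3,4)
proof (induction J rule: finite_induct)
  case (insert j J)
  have "K j \<inter> (\<Union>i\<in>J. K i) = {}"
    using insert.prems(2) insert.hyps(2) by (fastforce simp: disjoint_family_on_def)
  with insert.prems(1) have "measure_pmf.prob (random_subset I p) {A. P j A \<and> (\<forall>i\<in>J. P i A)} =
      measure_pmf.prob (random_subset I p) {A. P j A} *
      measure_pmf.prob (random_subset I p) {A. \<forall>i\<in>J. P i A}"
    by (intro prob_random_subset_conj[OF assms(1) _ determined_by_Ball]) auto
  then show ?case
    using insert by (simp add: disjoint_family_on_def)
qed simp

lemma prob_superset_random_subset:
  assumes "finite I" "F \<subseteq> I" "0 \<le> p" "p \<le> 1"
  shows "measure_pmf.prob (random_subset I p) {A. F \<subseteq> A} = p ^ card F"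
proof -
  have event: "(\<lambda>f. {x \<in> I. f x}) -` {A. F \<subseteq> A} = Pi I (\<lambda>x. if x \<in> F then {True} else UNIV)"
    using assms(2) by (auto simp: Pi_def)
  have "measure_pmf.prob (random_subset I p) {A. F \<subseteq> A} = (\<Prod>x\<in>I. if x \<in> F then p else 1)"
    unfolding random_subset_def measure_map_pmf event using assms
    by (subst measure_Pi_pmf_Pi) (auto intro!: prod.cong simp: measure_pmf_single)
  also have "\<dots> = p ^ card F"
    using assms by (subst prod.inter_restrict[symmetric]) (auto simp: Int_absorb1)
  finally show ?thesis .
qed

lemma prob_measure_pmf_Not: "measure_pmf.prob Q {x. \<not> P x} = 1 - measure_pmf.prob Q {x. P x}"
  using measure_pmf.prob_neg[where M=Q and P=P] by simp

lemma prob_no_superset_random_subset: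
  assumes "finite I" "0 \<le> p" "p \<le> 1" "finite J" "disjoint_family_on F J"
    and "\<And>j. j \<in> J \<Longrightarrow> F j \<subseteq> I" "\<And>j. j \<in> J \<Longrightarrow> card (F j) = c"
  shows "measure_pmf.prob (random_subset I p) {A. \<forall>j\<in>J. \<not> F j \<subseteq> A} = (1 - p ^ c) ^ card J"
proof -
  have "measure_pmf.prob (random_subset I p) {A. \<forall>j\<in>J. \<not> F j \<subseteq> A} =
      (\<Prod>j\<in>J. measure_pmf.prob (random_subset I p) {A. \<not> F j \<subseteq> A})"
    using assms(1,4,5)
    by (intro prob_random_subset_Ball[where K=F] determined_by_Not determined_by_subset)
  also have "\<dots> = (\<Prod>j\<in>J. 1 - p ^ c)"
    using assms by (intro prod.cong)
        (simp_all add: prob_measure_pmf_Not prob_superset_random_subset)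
  finally show ?thesis by simp
qed

lemma prob_no_transversal_random_subset:
  fixes F :: "'t \<Rightarrow> 'b \<Rightarrow> 'u \<Rightarrow> 'a set"
  assumes "finite I" "0 \<le> p" "p \<le> 1" "finite T" "finite \<B>"
    and U: "\<And>b. b \<in> \<B> \<Longrightarrow> finite (U b)" "\<And>b. b \<in> \<B> \<Longrightarrow> card (U b) = x"
    and F: "\<And>t b u. t \<in> T \<Longrightarrow> b \<in> \<B> \<Longrightarrow> u \<in> U b \<Longrightarrow> F t b u \<subseteq> I \<and> card (F t b u) = c"
    and disj: "disjoint_family_on (\<lambda>(t, b, u). F t b u) (T \<times> Sigma \<B> U)"
  shows "measure_pmf.prob (random_subset I p) {A. \<forall>t\<in>T. \<exists>b\<in>\<B>. \<forall>u\<in>U b. \<not> F t b u \<subseteq> A} =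
    (1 - (1 - (1 - p ^ c) ^ x) ^ card \<B>) ^ card T"
proof -
  let ?prob = "measure_pmf.prob (random_subset I p)"
  define K where "K t b = (\<Union>u\<in>U b. F t b u)" for t b
  have same: "t = t' \<and> b = b' \<and> u = u'"
    if "e \<in> F t b u" "e \<in> F t' b' u'" "t \<in> T" "b \<in> \<B>" "u \<in> U b" "t' \<in> T" "b' \<in> \<B>" "u' \<in> U b'"
    for e t b u t' b' u'
    using disjoint_family_onD[OF disj, of "(t, b, u)" "(t', b', u')"] that by auto
  have fail: "?prob {A. \<forall>u\<in>U b. \<not> F t b u \<subseteq> A} = (1 - p ^ c) ^ x" if "t \<in> T" "b \<in> \<B>" for t b
    using that U F same assms(1-3)
    by (subst prob_no_superset_random_subset[where c=c]) (fastforce simp: disjoint_family_on_def)+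
  have det: "determined_by (\<lambda>A. \<exists>u\<in>U b. F t b u \<subseteq> A) (K t b)" for t b
    unfolding K_def by (intro determined_by_Bex determined_by_subset)
  have "?prob {A. \<exists>b\<in>\<B>. \<forall>u\<in>U b. \<not> F t b u \<subseteq> A} = 1 - (1 - (1 - p ^ c) ^ x) ^ card \<B>"
    if "t \<in> T" for t
  proof -
    have "disjoint_family_on (K t) \<B>"
      using same that by (fastforce simp: disjoint_family_on_def K_def)
    then have "?prob {A. \<forall>b\<in>\<B>. \<exists>u\<in>U b. F t b u \<subseteq> A} = (\<Prod>b\<in>\<B>. ?prob {A. \<exists>u\<in>U b. F t b u \<subseteq> A})"
      by (intro prob_random_subset_Ball[OF assms(1,5) det])
    also have "\<dots> = (1 - (1 - p ^ c) ^ x) ^ card \<B>"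
      using fail[OF that] prob_measure_pmf_Not[of _ "\<lambda>A. \<forall>u\<in>U _. \<not> F t _ u \<subseteq> A"] by simp
    finally show ?thesis
      using prob_measure_pmf_Not[of _ "\<lambda>A. \<forall>b\<in>\<B>. \<exists>u\<in>U b. F t b u \<subseteq> A"] by simp
  qed
  moreover have "?prob {A. \<forall>t\<in>T. \<exists>b\<in>\<B>. \<forall>u\<in>U b. \<not> F t b u \<subseteq> A} =
      (\<Prod>t\<in>T. ?prob {A. \<exists>b\<in>\<B>. \<forall>u\<in>U b. \<not> F t b u \<subseteq> A})"
  proof (rule prob_random_subset_Ball[OF assms(1,4)])
    show "disjoint_family_on (\<lambda>t. \<Union>b\<in>\<B>. K t b) T"
      using same by (fastforce simp: disjoint_family_on_def K_def)
    show "determined_by (\<lambda>A. \<exists>b\<in>\<B>. \<forall>u\<in>U b. \<not> F t b u \<subseteq> A) (\<Union>b\<in>\<B>. K t b)" for t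
      using determined_by_Bex[OF determined_by_Not[OF det]] by simp
  qed
  ultimately show ?thesis by simp
qed

section \<open>Asymptotically almost sure events\<close>

definition aas :: "(nat \<Rightarrow> 'a pmf) \<Rightarrow> (nat \<Rightarrow> 'a \<Rightarrow> bool) \<Rightarrow> bool" where
  "aas Q P \<longleftrightarrow> (\<lambda>n. measure_pmf.prob (Q n) {x. \<not> P n x}) \<longlonglongrightarrow> 0"

lemma aasI:
  assumes "\<forall>\<^sub>F n in sequentially. measure_pmf.prob (Q n) {x. \<not> P n x} \<le> g n" "g \<longlonglongrightarrow> 0"
  shows "aas Q P"
  unfolding aas_def by (rule Lim_null_comparison[OF _ assms(2)]) (use assms(1) in simp)

lemma aas_ball_finite:
  assumes "finite J" "\<And>j. j \<in> J \<Longrightarrow> aas Q (P j)"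
  shows "aas Q (\<lambda>n x. \<forall>j\<in>J. P j n x)"
proof (rule aasI)
  show "(\<lambda>n. \<Sum>j\<in>J. measure_pmf.prob (Q n) {x. \<not> P j n x}) \<longlonglongrightarrow> 0"
    using assms(2) unfolding aas_def by (intro tendsto_null_sum)
  have "measure_pmf.prob (Q n) {x. \<not> (\<forall>j\<in>J. P j n x)} \<le>
      (\<Sum>j\<in>J. measure_pmf.prob (Q n) {x. \<not> P j n x})" for n
    using measure_pmf.finite_measure_subadditive_finite[OF assms(1), where A="\<lambda>j. {x. \<not> P j n x}"
        and M="Q n"]
    by (simp add: Collect_bex_eq)
  then show "\<forall>\<^sub>F n in sequentially. measure_pmf.prob (Q n) {x. \<not> (\<forall>j\<in>J. P j n x)} \<le>
      (\<Sum>j\<in>J. measure_pmf.prob (Q n) {x. \<not> P j n x})" by simp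
qed

lemma aas_conj:
  assumes "aas Q P" "aas Q R"
  shows "aas Q (\<lambda>n x. P n x \<and> R n x)"
  using aas_ball_finite[of "UNIV :: bool set" Q "case_bool P R"] assms
  by (simp add: all_bool_eq conj_commute split: bool.split)

lemma aas_mono:
  assumes "aas Q P"
    and "\<forall>\<^sub>F n in sequentially. \<forall>x\<in>set_pmf (Q n). P n x \<longrightarrow> R n x"
  shows "aas Q R"
proof (rule aasI[OF _ assms(1)[unfolded aas_def]])
  show "\<forall>\<^sub>F n in sequentially. measure_pmf.prob (Q n) {x. \<not> R n x} \<le>
      measure_pmf.prob (Q n) {x. \<not> P n x}"
    using assms(2)
    by eventually_elim (auto intro!: measure_pmf.finite_measure_mono_AE simp: AE_measure_pmf_iff)
qed

lemma aas_iff_prob_diff_tendsto_0: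
  assumes "aas Q (\<lambda>n x. P n x \<longleftrightarrow> R n x)"
  shows "(\<lambda>n. measure_pmf.prob (Q n) {x. P n x} - measure_pmf.prob (Q n) {x. R n x}) \<longlonglongrightarrow> 0"
proof (rule Lim_null_comparison[OF _ assms[unfolded aas_def]])
  have le: "measure_pmf.prob (Q n) {x. A n x} \<le>
      measure_pmf.prob (Q n) {x. B n x} + measure_pmf.prob (Q n) {x. A n x \<noteq> B n x}"
    for n and A B :: "nat \<Rightarrow> _ \<Rightarrow> bool"
    by (rule order_trans[OF measure_pmf.finite_measure_mono measure_Un_le]) auto
  have "norm (measure_pmf.prob (Q n) {x. P n x} - measure_pmf.prob (Q n) {x. R n x}) \<le>
      measure_pmf.prob (Q n) {x. P n x \<noteq> R n x}" for n
    using le[of n P R] le[of n R P] by (simp add: abs_le_iff eq_commute)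
  then show "\<forall>\<^sub>F n in sequentially.
      norm (measure_pmf.prob (Q n) {x. P n x} - measure_pmf.prob (Q n) {x. R n x}) \<le>
      measure_pmf.prob (Q n) {x. P n x \<noteq> R n x}" by simp
qed

lemma aas_iff_not_tendsto_0_or_1:
  assumes "aas Q (\<lambda>n x. P n x \<longleftrightarrow> R n x)" and "0 < c" "C < 1"
    and "\<forall>\<^sub>F n in sequentially. c \<le> measure_pmf.prob (Q n) {x. R n x}"
    and "\<forall>\<^sub>F n in sequentially. measure_pmf.prob (Q n) {x. R n x} \<le> C"
  shows "\<not> ((\<lambda>n. measure_pmf.prob (Q n) {x. P n x}) \<longlonglongrightarrow> 0 \<or>
    (\<lambda>n. measure_pmf.prob (Q n) {x. P n x}) \<longlonglongrightarrow> 1)"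
proof -
  have lim: "(\<lambda>n. measure_pmf.prob (Q n) {x. R n x}) \<longlonglongrightarrow> l"
    if "(\<lambda>n. measure_pmf.prob (Q n) {x. P n x}) \<longlonglongrightarrow> l" for l
    using tendsto_diff[OF that aas_iff_prob_diff_tendsto_0[OF assms(1)]] by simp
  have "c \<le> l \<and> l \<le> C" if "(\<lambda>n. measure_pmf.prob (Q n) {x. P n x}) \<longlonglongrightarrow> l" for l
    using tendsto_lowerbound[OF lim[OF that] assms(4)] tendsto_upperbound[OF lim[OF that] assms(5)]
    by simp
  then show ?thesis using assms(2,3) by fastforce
qed

section \<open>Copies of a pattern\<close>

abbreviation random_edges :: "nat \<Rightarrow> nat \<Rightarrow> real \<Rightarrow> nat set set pmf" where
  "random_edges s n p \<equiv> random_subset (possible_edges s n) p"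

lemma random_hypergraph_eq_random_edges:
  "random_hypergraph s n p = map_pmf (Pair {1..n}) (random_edges s n p)"
  by (simp add: random_hypergraph_def random_subset_def pmf.map_comp o_def)

lemma finite_possible_edges [simp]: "finite (possible_edges s n)"
  by (rule finite_subset[of _ "Pow {1..n}"]) (auto simp: possible_edges_def)

lemma powr_minus_le_1: "\<alpha> > 0 \<Longrightarrow> real n powr - \<alpha> \<le> 1"
  by (cases "n = 0") (auto simp: powr_minus inverse_le_1_iff ge_one_powr_ge_zero)

lemma power_times_powr_minus_power:
  assumes "n > 0"
  shows "real n ^ v * (real n powr - \<alpha>) ^ e = real n powr (real v - \<alpha> * real e)"
proof -
  have "(real n powr - \<alpha>) ^ e = real n powr - (\<alpha> * real e)"
    using assms by (simp add: powr_power mult.commute)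
  then show ?thesis using assms by (simp add: powr_diff powr_minus powr_realpow divide_inverse)
qed

definition placements :: "'v set \<Rightarrow> nat \<Rightarrow> ('v \<Rightarrow> nat) set" where
  "placements V n = {\<phi> \<in> V \<rightarrow>\<^sub>E {1..n}. inj_on \<phi> V}"

definition copies :: "'v set \<Rightarrow> 'v set set \<Rightarrow> nat \<Rightarrow> nat set set \<Rightarrow> ('v \<Rightarrow> nat) set" where
  "copies V F n E = {\<phi> \<in> placements V n. (`) \<phi> ` F \<subseteq> E}"

lemma placements_subset: "placements V n \<subseteq> V \<rightarrow>\<^sub>E {1..n}"
  by (auto simp: placements_def)

lemma finite_placements: "finite V \<Longrightarrow> finite (placements V n)"
  by (rule finite_subset[OF placements_subset]) (auto intro: finite_PiE)

lemma finite_copies: "finite V \<Longrightarrow> finite (copies V F n E)"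
  unfolding copies_def by (auto intro: finite_subset[OF _ finite_placements])

lemma card_placements_le: "finite V \<Longrightarrow> card (placements V n) \<le> n ^ card V"
  using card_mono[OF _ placements_subset, of V n] by (simp add: card_funcsetE finite_PiE)

lemma card_placements_ge:
  assumes "finite V" "card V \<le> n"
  shows "(n - card V) ^ card V \<le> card (placements V n)"
proof -
  have "(n - card V) ^ card V = (\<Prod>i\<in>{0..<card V}. n - card V)" by simp
  also have "\<dots> \<le> (\<Prod>i\<in>{0..<card V}. n - i)"
    by (rule prod_mono) auto
  also have "\<dots> = card (placements V n)"
    using card_inj_on_subset_funcset[of V "{1..n}" V] assms by (simp add: placements_def)
  finally show ?thesis .
qed

lemma sum_placements_power_hits_le:
  assumes "finite V" "finite S"
  shows "(\<Sum>\<psi>\<in>placements V n. n ^ card {v \<in> V. \<psi> v \<in> S}) \<le> (n * (card S + 1)) ^ card V"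
proof -
  let ?g = "\<lambda>x. if x \<in> S then n else 1"
  have "(\<Sum>\<psi>\<in>placements V n. n ^ card {v \<in> V. \<psi> v \<in> S}) = (\<Sum>\<psi>\<in>placements V n. \<Prod>v\<in>V. ?g (\<psi> v))"
    using assms(1) by (simp add: prod.If_cases Int_def)
  also have "\<dots> \<le> (\<Sum>\<psi>\<in>V \<rightarrow>\<^sub>E {1..n}. \<Prod>v\<in>V. ?g (\<psi> v))"
    using assms(1) by (intro sum_mono2 placements_subset) (auto intro: finite_PiE)
  also have "\<dots> = (\<Prod>v\<in>V. \<Sum>x\<in>{1..n}. ?g x)"
    using assms(1) by (subst prod_sum_PiE) auto
  also have "\<dots> \<le> (\<Prod>v\<in>V. n * (card S + 1))"
  proof (intro prod_mono conjI)
    have "(\<Sum>x\<in>{1..n}. ?g x) \<le> (\<Sum>x\<in>{1..n}. (if x \<in> S then n else 0) + 1)"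
      by (intro sum_mono) auto
    also have "\<dots> = card ({1..n} \<inter> S) * n + n"
      by (simp only: sum.distrib) (simp add: sum.If_cases)
    also have "\<dots> \<le> card S * n + n"
      using assms(2) by (intro add_mono mult_right_mono card_mono) auto
    finally show "(\<Sum>x\<in>{1..n}. ?g x) \<le> n * (card S + 1)"
      by (simp add: algebra_simps)
  qed auto
  finally show ?thesis by simp
qed

locale uniform_pattern =
  fixes s :: nat and V :: "'v set" and F :: "'v set set"
  assumes finite_vertices: "finite V"
    and edge_subset: "e \<in> F \<Longrightarrow> e \<subseteq> V"
    and card_edge: "e \<in> F \<Longrightarrow> card e = s"
begin

lemma finite_edges: "finite F"
  using finite_vertices edge_subset by (intro finite_subset[of F "Pow V"]) auto

lemma placement_edges:
  assumes "\<phi> \<in> placements V n"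
  shows placement_edges_subset: "(`) \<phi> ` F \<subseteq> possible_edges s n"
    and card_placement_edges: "card ((`) \<phi> ` F) = card F"
proof -
  have inj: "inj_on \<phi> V" and range: "\<phi> \<in> V \<rightarrow> {1..n}"
    using assms by (auto simp: placements_def)
  show "(`) \<phi> ` F \<subseteq> possible_edges s n"
    using edge_subset card_edge range inj
    by (fastforce simp: possible_edges_def card_image inj_on_subset)
  have "\<Union> F \<subseteq> V" using edge_subset by blast
  then show "card ((`) \<phi> ` F) = card F"
    by (intro card_image inj_on_image inj_on_subset[OF inj])
qed

lemma card_copies_eq_sum_indicator:
  "real (card (copies V F n E)) = (\<Sum>\<phi>\<in>placements V n. indicator {E. (`) \<phi> ` F \<subseteq> E} E)"
  using finite_placements[OF finite_vertices]
  by (simp add: copies_def indicator_def sum.If_cases Int_def)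

lemma expectation_card_copies:
  assumes "0 \<le> p" "p \<le> 1"
  shows "measure_pmf.expectation (random_edges s n p) (\<lambda>E. real (card (copies V F n E))) =
    real (card (placements V n)) * p ^ card F"
proof -
  have "measure_pmf.expectation (random_edges s n p) (\<lambda>E. real (card (copies V F n E))) =
    (\<Sum>\<phi>\<in>placements V n. measure_pmf.prob (random_edges s n p) {E. (`) \<phi> ` F \<subseteq> E})"
    unfolding card_copies_eq_sum_indicator
    by (subst Bochner_Integration.integral_sum) (auto intro: integrable_random_subset)
  also have "\<dots> = (\<Sum>\<phi>\<in>placements V n. p ^ card F)"
    using placement_edges assms by (intro sum.cong refl) (simp add: prob_superset_random_subset)
  finally show ?thesis by simp
qed

lemma prob_copies_nonempty_le:
  assumes "0 \<le> p" "p \<le> 1"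
    and "\<And>E. copies V F n E \<noteq> {} \<Longrightarrow> r \<le> card (copies V F n E)"
  shows "real r * measure_pmf.prob (random_edges s n p) {E. copies V F n E \<noteq> {}} \<le>
    real n ^ card V * p ^ card F"
proof -
  let ?R = "random_edges s n p"
  have "real r * measure_pmf.prob ?R {E. copies V F n E \<noteq> {}} =
    measure_pmf.expectation ?R (\<lambda>E. real r * indicator {E. copies V F n E \<noteq> {}} E)"
    by simp
  also have "\<dots> \<le> measure_pmf.expectation ?R (\<lambda>E. real (card (copies V F n E)))"
    using assms(3) by (intro integral_mono integrable_random_subset) (auto simp: indicator_def)
  also have "\<dots> = real (card (placements V n)) * p ^ card F"
    by (rule expectation_card_copies[OF assms(1,2)])
  also have "\<dots> \<le> real n ^ card V * p ^ card F"
    using card_placements_le[OF finite_vertices, of n] assms(1)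
    by (intro mult_right_mono) (auto simp flip: of_nat_power)
  finally show ?thesis .
qed

lemma aas_no_copies:
  fixes \<alpha> :: real
  assumes "\<alpha> > 0" "card V < \<alpha> * card F"
  shows "aas (\<lambda>n. random_edges s n (real n powr - \<alpha>)) (\<lambda>n E. copies V F n E = {})"
proof (rule aasI)
  show "(\<lambda>n. real n powr (card V - \<alpha> * card F)) \<longlonglongrightarrow> 0"
    using assms(2) by (intro tendsto_neg_powr filterlim_real_sequentially) auto
  show "\<forall>\<^sub>F n in sequentially. measure_pmf.prob (random_edges s n (real n powr - \<alpha>))
      {E. \<not> copies V F n E = {}} \<le> real n powr (card V - \<alpha> * card F)"
    using eventually_gt_at_top[of 0]
  proof eventually_elim
    case (elim n)
    then show ?case
      using prob_copies_nonempty_le[of "real n powr - \<alpha>" n 1] powr_minus_le_1[OF assms(1), of n]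
        finite_copies[OF finite_vertices]
      by (simp add: power_times_powr_minus_power Suc_le_eq card_gt_0_iff)
  qed
qed

lemma copies_comp_automorphism:
  assumes "bij_betw \<sigma> V V" "(`) ((`) \<sigma>) F \<subseteq> F" "\<phi> \<in> copies V F n E"
  shows "restrict (\<phi> \<circ> \<sigma>) V \<in> copies V F n E"
proof -
  have \<sigma>: "\<sigma> ` V = V" "inj_on \<sigma> V" using assms(1) by (auto simp: bij_betw_def)
  have \<phi>: "\<phi> \<in> V \<rightarrow>\<^sub>E {1..n}" "inj_on \<phi> V" "(`) \<phi> ` F \<subseteq> E"
    using assms(3) by (auto simp: copies_def placements_def)
  have "restrict (\<phi> \<circ> \<sigma>) V ` e = \<phi> ` \<sigma> ` e" if "e \<in> F" for e
    using edge_subset[OF that] by (force simp: image_image)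
  then have "(`) (restrict (\<phi> \<circ> \<sigma>) V) ` F = (`) \<phi> ` (`) ((`) \<sigma>) F"
    by (simp add: image_image)
  also have "\<dots> \<subseteq> (`) \<phi> ` F" by (intro image_mono assms(2))
  also note \<phi>(3)
  finally have "(`) (restrict (\<phi> \<circ> \<sigma>) V) ` F \<subseteq> E" .
  moreover have "restrict (\<phi> \<circ> \<sigma>) V \<in> V \<rightarrow>\<^sub>E {1..n}"
    using \<phi>(1) \<sigma>(1) by (simp add: PiE_iff) blast
  moreover have "inj_on (restrict (\<phi> \<circ> \<sigma>) V) V"
    using \<phi>(2) \<sigma> by (auto intro!: comp_inj_on)
  ultimately show ?thesis by (simp add: copies_def placements_def)
qed

lemma prob_copies_nonempty_le_half:
  assumes "0 \<le> p" "p \<le> 1"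
    and \<sigma>: "bij_betw \<sigma> V V" "(`) ((`) \<sigma>) F \<subseteq> F" and v: "v \<in> V" "\<sigma> v \<noteq> v"
  shows "measure_pmf.prob (random_edges s n p) {E. copies V F n E \<noteq> {}} \<le>
    real n ^ card V * p ^ card F / 2"
proof -
  have "2 \<le> card (copies V F n E)" if "copies V F n E \<noteq> {}" for E
  proof -
    from that obtain \<phi> where \<phi>: "\<phi> \<in> copies V F n E" by blast
    define \<psi> where "\<psi> = restrict (\<phi> \<circ> \<sigma>) V"
    have "\<psi> \<in> copies V F n E"
      unfolding \<psi>_def by (rule copies_comp_automorphism[OF \<sigma> \<phi>])
    moreover have "\<sigma> v \<in> V" using \<sigma>(1) v(1) by (auto simp: bij_betw_def)
    then have "\<psi> v \<noteq> \<phi> v"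
      using v \<phi> inj_onD[of \<phi> V "\<sigma> v" v] by (auto simp: \<psi>_def copies_def placements_def)
    ultimately have "card {\<phi>, \<psi>} \<le> card (copies V F n E)" "\<phi> \<noteq> \<psi>"
      using \<phi> finite_copies[OF finite_vertices] by (auto intro!: card_mono)
    then show ?thesis by simp
  qed
  from prob_copies_nonempty_le[OF assms(1,2) this] show ?thesis by simp
qed

lemma expectation_card_copies_squared:
  assumes "0 \<le> p" "p \<le> 1"
  shows "measure_pmf.expectation (random_edges s n p) (\<lambda>E. (real (card (copies V F n E)))\<^sup>2) =
    (\<Sum>\<phi>\<in>placements V n. \<Sum>\<psi>\<in>placements V n. p ^ card ((`) \<phi> ` F \<union> (`) \<psi> ` F))"
proof -
  have square: "(real (card (copies V F n E)))\<^sup>2 =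
      (\<Sum>\<phi>\<in>placements V n. \<Sum>\<psi>\<in>placements V n. indicator {E. (`) \<phi> ` F \<union> (`) \<psi> ` F \<subseteq> E} E)" for E
    unfolding card_copies_eq_sum_indicator power2_eq_square sum_product
    by (intro sum.cong refl) (auto simp: indicator_def)
  have "measure_pmf.expectation (random_edges s n p) (\<lambda>E. (real (card (copies V F n E)))\<^sup>2) =
    (\<Sum>\<phi>\<in>placements V n. \<Sum>\<psi>\<in>placements V n.
      measure_pmf.prob (random_edges s n p) {E. (`) \<phi> ` F \<union> (`) \<psi> ` F \<subseteq> E})"
    unfolding square
    by (subst Bochner_Integration.integral_sum, simp add: integrable_random_subset)+ simp
  also have "\<dots> = (\<Sum>\<phi>\<in>placements V n. \<Sum>\<psi>\<in>placements V n. p ^ card ((`) \<phi> ` F \<union> (`) \<psi> ` F))"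
    using placement_edges_subset assms by (intro sum.cong refl prob_superset_random_subset) auto
  finally show ?thesis .
qed

text \<open>The pointwise inequality \<open>[X > 0] \<ge> 2 t X - t\<^sup>2 X\<^sup>2\<close> replaces the Cauchy--Schwarz inequality.\<close>

lemma prob_copies_second_moment:
  assumes "measure_pmf.expectation (random_edges s n p) (\<lambda>E. (real (card (copies V F n E)))\<^sup>2) \<le> C"
    and "measure_pmf.expectation (random_edges s n p) (\<lambda>E. real (card (copies V F n E))) \<ge> 1 / 2"
    and "C > 0"
  shows "1 / (4 * C) \<le> measure_pmf.prob (random_edges s n p) {E. copies V F n E \<noteq> {}}"
proof -
  let ?R = "random_edges s n p" and ?X = "\<lambda>E. real (card (copies V F n E))"
  have int: "integrable ?R h" for h :: "nat set set \<Rightarrow> real"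
    by (rule integrable_random_subset) simp
  define t where "t = 1 / (2 * C)"
  have t: "t > 0" using assms(3) by (simp add: t_def)
  have "1 / (4 * C) = 2 * t * (1 / 2) - t\<^sup>2 * C"
    using assms(3) by (simp add: t_def field_simps power2_eq_square)
  also have "\<dots> \<le> 2 * t * measure_pmf.expectation ?R ?X -
      t\<^sup>2 * measure_pmf.expectation ?R (\<lambda>E. (?X E)\<^sup>2)"
    using assms(1,2) t by (intro diff_mono mult_left_mono) auto
  also have "\<dots> = measure_pmf.expectation ?R (\<lambda>E. 2 * t * ?X E - t\<^sup>2 * (?X E)\<^sup>2)"
    by (simp add: int)
  also have "\<dots> \<le> measure_pmf.expectation ?R (indicator {E. copies V F n E \<noteq> {}})"
  proof (intro integral_mono int)
    fix E
    have "2 * t * ?X E - t\<^sup>2 * (?X E)\<^sup>2 = 1 - (t * ?X E - 1)\<^sup>2"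
      by (simp add: power2_eq_square algebra_simps)
    then show "2 * t * ?X E - t\<^sup>2 * (?X E)\<^sup>2 \<le> indicator {E. copies V F n E \<noteq> {}} E"
      by (cases "copies V F n E = {}") auto
  qed
  finally show ?thesis by simp
qed

definition balanced :: "real \<Rightarrow> bool" where
  "balanced \<alpha> \<longleftrightarrow> (\<forall>J\<subseteq>V. \<alpha> * card {e \<in> F. e \<subseteq> J} \<le> card J)"

lemma placement_overlap_le:
  assumes "balanced \<alpha>" "0 < \<alpha>" "n > 0" and \<phi>: "\<phi> \<in> placements V n" and \<psi>: "\<psi> \<in> placements V n"
  shows "(real n powr - \<alpha>) ^ card ((`) \<phi> ` F \<union> (`) \<psi> ` F) \<le>
    (real n powr - \<alpha>) ^ (2 * card F) * real (n ^ card {v \<in> V. \<psi> v \<in> \<phi> ` V})"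
proof -
  define J where "J = {v \<in> V. \<psi> v \<in> \<phi> ` V}"
  have "(`) \<phi> ` F \<inter> (`) \<psi> ` F \<subseteq> (`) \<psi> ` {e \<in> F. e \<subseteq> J}"
  proof
    fix x assume "x \<in> (`) \<phi> ` F \<inter> (`) \<psi> ` F"
    then obtain e e' where e: "e \<in> F" "e' \<in> F" "x = \<psi> ` e" "x = \<phi> ` e'" by auto
    then have "e \<subseteq> J" unfolding J_def using edge_subset by blast
    with e show "x \<in> (`) \<psi> ` {e \<in> F. e \<subseteq> J}" by auto
  qed
  then have "card ((`) \<phi> ` F \<inter> (`) \<psi> ` F) \<le> card {e \<in> F. e \<subseteq> J}"
    using finite_edges by (intro order_trans[OF card_mono card_image_le]) auto
  then have "\<alpha> * card ((`) \<phi> ` F \<inter> (`) \<psi> ` F) \<le> \<alpha> * card {e \<in> F. e \<subseteq> J}"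
    using assms(2) by simp
  also have "\<dots> \<le> card J" using assms(1) by (auto simp: balanced_def J_def)
  finally have common: "\<alpha> * card ((`) \<phi> ` F \<inter> (`) \<psi> ` F) \<le> card J" .
  have "card ((`) \<phi> ` F \<union> (`) \<psi> ` F) + card ((`) \<phi> ` F \<inter> (`) \<psi> ` F) = 2 * card F"
    using card_Un_Int[of "(`) \<phi> ` F" "(`) \<psi> ` F"] finite_edges
    by (simp add: card_placement_edges[OF \<phi>] card_placement_edges[OF \<psi>])
  then have "real (card ((`) \<phi> ` F \<union> (`) \<psi> ` F)) = 2 * card F - real (card ((`) \<phi> ` F \<inter> (`) \<psi> ` F))"
    by linarith
  then have "- \<alpha> * card ((`) \<phi> ` F \<union> (`) \<psi> ` F) =
      \<alpha> * card ((`) \<phi> ` F \<inter> (`) \<psi> ` F) - \<alpha> * real (2 * card F)"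
    by (simp add: right_diff_distrib)
  then have "- \<alpha> * card ((`) \<phi> ` F \<union> (`) \<psi> ` F) \<le> card J - \<alpha> * real (2 * card F)"
    using common by linarith
  then have "(real n powr - \<alpha>) ^ card ((`) \<phi> ` F \<union> (`) \<psi> ` F) \<le>
      real n powr (card J - \<alpha> * real (2 * card F))"
    using assms(3) by (simp add: powr_power powr_mono mult.commute)
  also have "\<dots> = (real n powr - \<alpha>) ^ (2 * card F) * real (n ^ card J)"
    unfolding power_times_powr_minus_power[OF assms(3), symmetric] by (simp add: mult.commute)
  finally show ?thesis unfolding J_def .
qed

lemma critical_expectation_eq_1:
  "\<alpha> * real (card F) = card V \<Longrightarrow> n > 0 \<Longrightarrow> real n ^ card V * (real n powr - \<alpha>) ^ card F = 1"
  by (simp add: power_times_powr_minus_power)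

lemma expectation_card_copies_squared_le:
  assumes "balanced \<alpha>" "0 < \<alpha>" "\<alpha> * card F = card V" "n > 0"
  shows "measure_pmf.expectation (random_edges s n (real n powr - \<alpha>))
      (\<lambda>E. (real (card (copies V F n E)))\<^sup>2) \<le> (real (card V) + 1) ^ card V"
proof -
  let ?q = "real n powr - \<alpha>" and ?v = "card V"
  have hits: "(\<Sum>\<psi>\<in>placements V n. ?q ^ card ((`) \<phi> ` F \<union> (`) \<psi> ` F)) \<le>
      ?q ^ (2 * card F) * (real n * (real ?v + 1)) ^ ?v" if \<phi>: "\<phi> \<in> placements V n" for \<phi>
  proof -
    have "(\<Sum>\<psi>\<in>placements V n. ?q ^ card ((`) \<phi> ` F \<union> (`) \<psi> ` F)) \<le>
        ?q ^ (2 * card F) * real (\<Sum>\<psi>\<in>placements V n. n ^ card {v \<in> V. \<psi> v \<in> \<phi> ` V})"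
      unfolding of_nat_sum sum_distrib_left
      by (intro sum_mono placement_overlap_le assms(1,2,4) \<phi>)
    moreover have "(\<Sum>\<psi>\<in>placements V n. n ^ card {v \<in> V. \<psi> v \<in> \<phi> ` V}) \<le> (n * (?v + 1)) ^ ?v"
      using sum_placements_power_hits_le[OF finite_vertices, of "\<phi> ` V" n] finite_vertices \<phi>
      by (simp add: card_image placements_def)
    ultimately have "(\<Sum>\<psi>\<in>placements V n. ?q ^ card ((`) \<phi> ` F \<union> (`) \<psi> ` F)) \<le>
        ?q ^ (2 * card F) * real ((n * (?v + 1)) ^ ?v)"
      by (meson mult_left_mono of_nat_mono order_trans powr_ge_zero zero_le_power)
    then show ?thesis by (simp add: distrib_left add.commute)
  qed
  have "measure_pmf.expectation (random_edges s n ?q) (\<lambda>E. (real (card (copies V F n E)))\<^sup>2) \<le>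
      real (card (placements V n)) * (?q ^ (2 * card F) * (real n * (real ?v + 1)) ^ ?v)"
    unfolding expectation_card_copies_squared[OF powr_ge_zero powr_minus_le_1[OF assms(2)]]
    using sum_bounded_above[of "placements V n", OF hits] by simp
  also have "\<dots> \<le> real n ^ ?v * (?q ^ (2 * card F) * (real n * (real ?v + 1)) ^ ?v)"
    using card_placements_le[OF finite_vertices, of n]
    by (auto intro!: mult_right_mono simp flip: of_nat_power)
  also have "\<dots> = (real n ^ ?v * ?q ^ card F)\<^sup>2 * (real ?v + 1) ^ ?v"
    by (simp add: power_mult_distrib power2_eq_square mult_2 power_add)
  also have "\<dots> = (real ?v + 1) ^ ?v"
    unfolding critical_expectation_eq_1[OF assms(3,4)] by simp
  finally show ?thesis .
qed

lemma eventually_expectation_card_copies_ge_half: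
  fixes \<alpha> :: real
  assumes "0 < \<alpha>" "\<alpha> * card F = card V"
  shows "\<forall>\<^sub>F n in sequentially. 1 / 2 \<le>
    measure_pmf.expectation (random_edges s n (real n powr - \<alpha>)) (\<lambda>E. real (card (copies V F n E)))"
proof -
  let ?v = "card V"
  have "(\<lambda>n. ((real n - real ?v) / real n) ^ ?v) \<longlonglongrightarrow> 1 ^ ?v"
    by (intro tendsto_power) real_asymp
  then have "\<forall>\<^sub>F n in sequentially. 1 / 2 < ((real n - ?v) / real n) ^ ?v"
    by (rule order_tendstoD) auto
  then show ?thesis
    using eventually_ge_at_top[of "max 1 ?v"]
  proof eventually_elim
    case (elim n)
    let ?q = "real n powr - \<alpha>"
    have "?q ^ card F = 1 / real n ^ ?v"
      using critical_expectation_eq_1[OF assms(2), of n] elim(2) by (simp add: field_simps)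
    then have "1 / 2 \<le> real (n - ?v) ^ ?v * ?q ^ card F"
      using elim by (simp add: power_divide)
    also have "\<dots> \<le> real (card (placements V n)) * ?q ^ card F"
      using of_nat_mono[OF card_placements_ge[OF finite_vertices, of n], where 'a=real] elim
      by (intro mult_right_mono) (simp_all del: of_nat_diff)
    finally show ?case
      by (simp add: expectation_card_copies powr_minus_le_1[OF assms(1)])
  qed
qed

lemma prob_copies_nonempty_ge:
  assumes "balanced \<alpha>" "0 < \<alpha>" "\<alpha> * card F = card V"
  obtains c where "0 < c" "\<forall>\<^sub>F n in sequentially.
    c \<le> measure_pmf.prob (random_edges s n (real n powr - \<alpha>)) {E. copies V F n E \<noteq> {}}"
proof
  let ?C = "(real (card V) + 1) ^ card V"
  show "0 < 1 / (4 * ?C)" by simp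
  show "\<forall>\<^sub>F n in sequentially. 1 / (4 * ?C) \<le>
      measure_pmf.prob (random_edges s n (real n powr - \<alpha>)) {E. copies V F n E \<noteq> {}}"
    using eventually_expectation_card_copies_ge_half[OF assms(2,3)] eventually_gt_at_top[of 0]
    by eventually_elim
      (intro prob_copies_second_moment expectation_card_copies_squared_le[OF assms], auto)
qed

end

section \<open>Local sparseness\<close>

definition sparse :: "real \<Rightarrow> nat \<Rightarrow> nat \<Rightarrow> nat set set \<Rightarrow> bool" where
  "sparse \<alpha> K n E \<longleftrightarrow> (\<forall>W\<subseteq>{1..n}. card W \<le> K \<longrightarrow> \<alpha> * card {e \<in> E. e \<subseteq> W} \<le> card W)"

lemma ex_copy_of_induced_pattern:
  assumes E: "E \<subseteq> possible_edges s n" and W: "W \<subseteq> {1..n}"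
  obtains F where "uniform_pattern s {..<card W} F" "card F = card {e \<in> E. e \<subseteq> W}"
    "copies {..<card W} F n E \<noteq> {}"
proof -
  have "finite W" using W finite_subset by blast
  then obtain h where h: "bij_betw h {..<card W} W"
    using ex_bij_betw_nat_finite[of W] by (auto simp: atLeast0LessThan)
  then have inj: "inj_on h {..<card W}" and h_image: "h ` {..<card W} = W"
    by (auto simp: bij_betw_def)
  define F where "F = {e. e \<subseteq> {..<card W} \<and> h ` e \<in> E}"
  have induced: "(`) h ` F = {e \<in> E. e \<subseteq> W}"
  proof (intro equalityI subsetI)
    fix e assume "e \<in> {e \<in> E. e \<subseteq> W}"
    moreover from this obtain d where "d \<subseteq> {..<card W}" "e = h ` d"
      using h_image by (metis (no_types, lifting) mem_Collect_eq subset_image_iff)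
    ultimately show "e \<in> (`) h ` F" by (auto simp: F_def)
  qed (use h_image in \<open>auto simp: F_def\<close>)
  have card_edge: "card (h ` e) = card e" if "e \<in> F" for e
    using that inj by (auto simp: F_def intro: card_image inj_on_subset)
  show thesis
  proof
    show "uniform_pattern s {..<card W} F"
      using E card_edge by unfold_locales (auto simp: F_def possible_edges_def)
    have "\<Union> F \<subseteq> {..<card W}" by (auto simp: F_def)
    then have "inj_on ((`) h) F" using inj by (intro inj_on_image) (rule inj_on_subset)
    then show "card F = card {e \<in> E. e \<subseteq> W}"
      unfolding induced[symmetric] by (rule card_image[symmetric])
    have "restrict h {..<card W} ` e = h ` e" if "e \<in> F" for e
      using that by (intro image_cong) (auto simp: F_def)
    then have "(`) (restrict h {..<card W}) ` F \<subseteq> E" by (auto simp: F_def)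
    moreover have "restrict h {..<card W} \<in> placements {..<card W} n"
      using h_image W inj by (auto simp: placements_def)
    ultimately show "copies {..<card W} F n E \<noteq> {}"
      unfolding copies_def by blast
  qed
qed

lemma aas_sparse:
  fixes \<alpha> :: real
  assumes "\<alpha> > 0"
  shows "aas (\<lambda>n. random_edges s n (real n powr - \<alpha>)) (sparse \<alpha> K)"
proof -
  define \<P> where "\<P> = {(w, F). w \<le> K \<and> uniform_pattern s {..<w} F \<and> real w < \<alpha> * card F}"
  have "F \<subseteq> Pow {..<K}" if "w \<le> K" "uniform_pattern s {..<w} F" for w F
  proof
    fix e assume "e \<in> F"
    then have "e \<subseteq> {..<w}" by (rule uniform_pattern.edge_subset[OF that(2)])
    then show "e \<in> Pow {..<K}" using that(1) by auto
  qed
  then have "\<P> \<subseteq> {..K} \<times> Pow (Pow {..<K})" by (auto simp: \<P>_def)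
  then have "finite \<P>" by (rule finite_subset) auto
  moreover have "aas (\<lambda>n. random_edges s n (real n powr - \<alpha>)) (\<lambda>n E. copies {..<w} F n E = {})"
    if "(w, F) \<in> \<P>" for w F
    using that by (intro uniform_pattern.aas_no_copies assms) (auto simp: \<P>_def)
  ultimately have "aas (\<lambda>n. random_edges s n (real n powr - \<alpha>))
      (\<lambda>n E. \<forall>(w, F)\<in>\<P>. copies {..<w} F n E = {})"
    by (intro aas_ball_finite) auto
  then show ?thesis
  proof (rule aas_mono[OF _ always_eventually], intro allI ballI impI)
    fix n E
    assume E: "E \<in> set_pmf (random_edges s n (real n powr - \<alpha>))"
      and no_copies: "\<forall>(w, F)\<in>\<P>. copies {..<w} F n E = {}"
    show "sparse \<alpha> K n E"
      unfolding sparse_def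
    proof (intro allI impI)
      fix W assume W: "W \<subseteq> {1..n}" "card W \<le> K"
      obtain F where F: "uniform_pattern s {..<card W} F" "card F = card {e \<in> E. e \<subseteq> W}"
        "copies {..<card W} F n E \<noteq> {}"
        using ex_copy_of_induced_pattern[OF set_pmf_random_subset[OF E] W(1)] .
      then have "(card W, F) \<notin> \<P>" using no_copies by blast
      with F(1) W(2) show "\<alpha> * card {e \<in> E. e \<subseteq> W} \<le> card W"
        unfolding F(2)[symmetric] by (simp add: \<P>_def)
    qed
  qed
qed

lemma sparse_surplus_edges_le:
  assumes "sparse \<alpha> K n E" "\<alpha> > 0" "finite E"
    and V: "V \<subseteq> W" "W \<subseteq> {1..n}" "card W \<le> K"
    and F: "F \<subseteq> E" "F \<subseteq> Pow V" "\<alpha> * card F = card V"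
    and F': "F' \<subseteq> E" "F' \<subseteq> Pow W" "F \<inter> F' = {}"
  shows "\<alpha> * card F' \<le> card (W - V)"
proof -
  have "finite W" using V(2) finite_subset by blast
  then have cards: "card W = card V + card (W - V)"
    using V(1) by (metis card_Un_disjoint Diff_disjoint Diff_partition finite_Diff finite_subset)
  have "card F + card F' = card (F \<union> F')"
    using F(1) F'(1,3) assms(3) by (intro card_Un_disjoint[symmetric]) (auto intro: finite_subset)
  also have "\<dots> \<le> card {e \<in> E. e \<subseteq> W}"
    using F(1,2) F'(1,2) V(1) assms(3) by (intro card_mono) (simp, blast)
  finally have "\<alpha> * (card F + card F') \<le> \<alpha> * card {e \<in> E. e \<subseteq> W}"
    using assms(2) by (intro mult_left_mono) auto
  also have "\<dots> \<le> card W" using assms(1) V(2,3) by (simp add: sparse_def)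
  finally show ?thesis using F(3) cards by (simp add: algebra_simps)
qed

section \<open>Stars\<close>

definition star :: "nat \<Rightarrow> 'v \<Rightarrow> 'v set \<Rightarrow> 'v set set" where
  "star s u B = insert u ` {S. S \<subseteq> B \<and> card S = s - 1}"

abbreviation joined :: "nat \<Rightarrow> 'v set set \<Rightarrow> 'v \<Rightarrow> 'v set \<Rightarrow> bool" where
  "joined s E u B \<equiv> star s u B \<subseteq> E"

lemma insert_mem_star: "S \<subseteq> B \<Longrightarrow> card S = s - 1 \<Longrightarrow> insert u S \<in> star s u B"
  by (simp add: star_def)

lemma mem_star: "e \<in> star s u B \<Longrightarrow> u \<in> e"
  by (auto simp: star_def)

lemma star_subset_Pow: "star s u B \<subseteq> Pow (insert u B)"
  by (auto simp: star_def)

lemma star_mono: "B \<subseteq> B' \<Longrightarrow> star s u B \<subseteq> star s u B'"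
  by (auto simp: star_def)

lemma finite_star: "finite B \<Longrightarrow> finite (star s u B)"
  by (rule finite_subset[OF star_subset_Pow]) simp

lemma inj_on_insert_notin: "inj_on (insert u) {S. u \<notin> S}"
  by (auto simp: inj_on_def)

lemma image_star:
  assumes "inj_on \<phi> B"
  shows "(`) \<phi> ` star s u B = star s (\<phi> u) (\<phi> ` B)"
proof -
  have card: "card (\<phi> ` S) = card S" if "S \<subseteq> B" for S
    using inj_on_subset[OF assms that] by (rule card_image)
  have "{S. S \<subseteq> \<phi> ` B \<and> card S = s - 1} = (`) \<phi> ` {S. S \<subseteq> B \<and> card S = s - 1}"
  proof (intro equalityI subsetI)
    fix T assume "T \<in> {S. S \<subseteq> \<phi> ` B \<and> card S = s - 1}"
    moreover from this obtain S where "S \<subseteq> B" "T = \<phi> ` S" by (auto elim: subset_imageE)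
    ultimately show "T \<in> (`) \<phi> ` {S. S \<subseteq> B \<and> card S = s - 1}" by (simp add: card)
  qed (auto simp: card)
  then show ?thesis by (simp add: star_def image_image)
qed

lemma card_star:
  assumes "finite B" "u \<notin> B"
  shows "card (star s u B) = card B choose (s - 1)"
proof -
  have "inj_on (insert u) {S. S \<subseteq> B \<and> card S = s - 1}"
    by (rule inj_on_subset[OF inj_on_insert_notin]) (use assms(2) in auto)
  then show ?thesis using assms(1) by (simp add: star_def card_image n_subsets)
qed

lemma card_mem_star:
  assumes "finite B" "u \<notin> B" "s \<ge> 1" "e \<in> star s u B"
  shows "card e = s"
proof -
  obtain S where "S \<subseteq> B" "card S = s - 1" "e = insert u S"
    using assms(4) by (auto simp: star_def)
  moreover from this have "finite S" using assms(1) finite_subset by blast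
  ultimately show ?thesis using assms(2,3) by (subst \<open>e = _\<close>, subst card_insert_disjoint) auto
qed

lemma star_insert:
  assumes "finite B" "p \<notin> B" "s \<ge> 2"
  shows "star s u (insert p B) = star s u B \<union> insert p ` star (s - 1) u B"
proof (intro equalityI subsetI)
  fix e assume "e \<in> star s u (insert p B)"
  then obtain S where S: "S \<subseteq> insert p B" "card S = s - 1" and e: "e = insert u S"
    by (auto simp: star_def)
  show "e \<in> star s u B \<union> insert p ` star (s - 1) u B"
  proof (cases "p \<in> S")
    case True
    have "finite S" using S(1) assms(1) finite_subset by blast
    then have "S - {p} \<subseteq> B" "card (S - {p}) = s - 1 - 1"
      using S True by auto
    then have "insert u (S - {p}) \<in> star (s - 1) u B" by (rule insert_mem_star)
    moreover have "e = insert p (insert u (S - {p}))" using e True by blast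
    ultimately show ?thesis by blast
  next
    case False
    then have "S \<subseteq> B" using S(1) by blast
    with S(2) e show ?thesis by (simp add: insert_mem_star)
  qed
next
  fix e assume "e \<in> star s u B \<union> insert p ` star (s - 1) u B"
  then show "e \<in> star s u (insert p B)"
  proof
    assume "e \<in> star s u B"
    then show ?thesis using star_mono[of B "insert p B" s u] by blast
  next
    assume "e \<in> insert p ` star (s - 1) u B"
    then obtain S where S: "S \<subseteq> B" "card S = s - 2" and e: "e = insert u (insert p S)"
      by (auto simp: star_def numeral_2_eq_2)
    have "finite S" "p \<notin> S" using S(1) assms(1,2) finite_subset by auto
    then have "card (insert p S) = s - 1" using S(2) assms(3) by simp
    then show ?thesis unfolding e using S(1) by (intro insert_mem_star) auto
  qed
qed

lemma card_insert_image_star: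
  assumes "finite B" "u \<notin> B" "p \<notin> B" "p \<noteq> u"
  shows "card (insert p ` star (s - 1) u B) = card B choose (s - 2)"
proof -
  have "inj_on (insert p) (star (s - 1) u B)"
    by (rule inj_on_subset[OF inj_on_insert_notin]) (use assms(3,4) in \<open>auto simp: star_def\<close>)
  then show ?thesis using assms(1,2) by (simp add: card_image card_star numeral_2_eq_2)
qed

lemma star_subset_possible_edges:
  assumes "B \<subseteq> {1..n}" "u \<in> {1..n} - B" "s \<ge> 1"
  shows "star s u B \<subseteq> possible_edges s n"
proof
  fix e assume e: "e \<in> star s u B"
  have "finite B" using assms(1) finite_subset by blast
  then have "card e = s" using assms(2,3) e by (intro card_mem_star) auto
  moreover have "e \<subseteq> {1..n}" using e star_subset_Pow[of s u B] assms(1,2) by blast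
  ultimately show "e \<in> possible_edges s n" by (simp add: possible_edges_def)
qed

lemma insert_image_star_subset_possible_edges:
  assumes "B \<subseteq> {1..n}" "u \<in> {1..n} - B" "p \<in> {1..n} - B" "p \<noteq> u" "s \<ge> 2"
  shows "insert p ` star (s - 1) u B \<subseteq> possible_edges s n"
proof -
  have "finite B" using assms(1) finite_subset by blast
  then have "insert p ` star (s - 1) u B \<subseteq> star s u (insert p B)"
    using assms(3,5) by (subst star_insert) auto
  also have "\<dots> \<subseteq> possible_edges s n"
    using assms by (intro star_subset_possible_edges) auto
  finally show ?thesis .
qed

section \<open>The extension property\<close>

definition linked :: "nat \<Rightarrow> nat set \<Rightarrow> nat set set \<Rightarrow> nat set \<Rightarrow> nat \<Rightarrow> bool" where
  "linked s U E A p \<longleftrightarrow> (\<exists>u\<in>U. joined s E u (insert p A))"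

definition link_requests :: "nat set \<Rightarrow> nat \<Rightarrow> nat \<Rightarrow> nat \<Rightarrow> (nat set \<times> nat set set) set" where
  "link_requests U r D K =
    (SIGMA Z:{Z. Z \<subseteq> U \<and> card Z \<le> K}. {\<A>. \<A> \<subseteq> {A. A \<subseteq> Z \<and> card A = r} \<and> card \<A> \<le> D})"

definition extendable :: "nat \<Rightarrow> nat \<Rightarrow> nat \<Rightarrow> nat \<Rightarrow> nat set \<Rightarrow> nat set set \<Rightarrow> bool" where
  "extendable s r D K U E \<longleftrightarrow>
    (\<forall>(Z, \<A>)\<in>link_requests U r D K. \<exists>p\<in>U - Z. \<forall>A\<in>\<A>. linked s U E A p)"

lemma ex_disjoint_subsets:
  assumes "finite J" "finite X" "card J * c \<le> card X"
  obtains P where "disjoint_family_on P J" "\<And>j. j \<in> J \<Longrightarrow> P j \<subseteq> X" "\<And>j. j \<in> J \<Longrightarrow> card (P j) = c"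
proof -
  have "card (J \<times> {..<c}) \<le> card X" using assms(3) by (simp add: card_cartesian_product)
  then obtain g where g: "g ` (J \<times> {..<c}) \<subseteq> X" "inj_on g (J \<times> {..<c})"
    using card_le_inj[of "J \<times> {..<c}" X] assms(1,2) by auto
  show thesis
  proof
    show "disjoint_family_on (\<lambda>j. g ` ({j} \<times> {..<c})) J"
      using g(2) by (fastforce simp: disjoint_family_on_def inj_on_def)
    show "g ` ({j} \<times> {..<c}) \<subseteq> X" if "j \<in> J" for j using g(1) that by blast
    show "card (g ` ({j} \<times> {..<c})) = c" if "j \<in> J" for j
    proof -
      have "inj_on g ({j} \<times> {..<c})" using that by (intro inj_on_subset[OF g(2)]) auto
      then show ?thesis by (simp add: card_image card_cartesian_product)
    qed
  qed
qed

lemma prob_few_joined_le: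
  assumes "0 \<le> q" "q \<le> 1" "s \<ge> 1" "A \<subseteq> {1..n}" "P \<subseteq> {1..n} - A" "x * h \<le> card P"
  shows "measure_pmf.prob (random_edges s n q) {E. card {u \<in> P. joined s E u A} < x} \<le>
    real x * (1 - q ^ (card A choose (s - 1))) ^ h"
proof -
  let ?prob = "measure_pmf.prob (random_edges s n q)"
  have fin: "finite P" "finite A" using assms(4,5) by (auto intro: finite_subset)
  then obtain B where B: "disjoint_family_on B {..<x}"
    "\<And>j. j < x \<Longrightarrow> B j \<subseteq> P" "\<And>j. j < x \<Longrightarrow> card (B j) = h"
    using ex_disjoint_subsets[of "{..<x}" P h] assms(6) by auto
  have many_joined: "x \<le> card {u \<in> P. joined s E u A}" if "\<forall>j<x. \<exists>u\<in>B j. joined s E u A" for E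
  proof -
    from that obtain f where f: "\<And>j. j < x \<Longrightarrow> f j \<in> B j \<and> joined s E (f j) A" by metis
    have "inj_on f {..<x}"
    proof (rule inj_onI)
      fix i j assume "i \<in> {..<x}" "j \<in> {..<x}" "f i = f j"
      then show "i = j" using disjoint_family_onD[OF B(1), of i j] f[of i] f[of j] by auto
    qed
    moreover have "f ` {..<x} \<subseteq> {u \<in> P. joined s E u A}" using f B(2) by blast
    ultimately show ?thesis using fin(1) card_inj_on_le[of f "{..<x}"] by simp
  qed
  have "\<exists>j\<in>{..<x}. \<forall>u\<in>B j. \<not> joined s E u A" if "card {u \<in> P. joined s E u A} < x" for E
    using that many_joined[of E] by (meson lessThan_iff not_le)
  then have "{E. card {u \<in> P. joined s E u A} < x} \<subseteq> (\<Union>j\<in>{..<x}. {E. \<forall>u\<in>B j. \<not> joined s E u A})"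
    by blast
  then have "?prob {E. card {u \<in> P. joined s E u A} < x} \<le>
      ?prob (\<Union>j\<in>{..<x}. {E. \<forall>u\<in>B j. \<not> joined s E u A})"
    by (rule measure_pmf.finite_measure_mono) simp
  also have "\<dots> \<le> (\<Sum>j\<in>{..<x}. ?prob {E. \<forall>u\<in>B j. \<not> joined s E u A})"
    by (intro measure_pmf.finite_measure_subadditive_finite) auto
  also have "\<dots> = (\<Sum>j\<in>{..<x}. (1 - q ^ (card A choose (s - 1))) ^ h)"
  proof (rule sum.cong[OF refl])
    fix j assume j: "j \<in> {..<x}"
    have u: "u \<in> {1..n} - A" if "u \<in> B j" for u using that B(2) j assms(5) by blast
    have "disjoint_family_on (\<lambda>u. star s u A) (B j)"
      using u by (fastforce simp: disjoint_family_on_def star_def)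
    moreover have "finite (B j)" using fin(1) B(2) j by (meson finite_subset lessThan_iff)
    ultimately show "?prob {E. \<forall>u\<in>B j. \<not> joined s E u A} = (1 - q ^ (card A choose (s - 1))) ^ h"
      using prob_no_superset_random_subset[of "possible_edges s n" q "B j" "\<lambda>u. star s u A"
          "card A choose (s - 1)"]
        star_subset_possible_edges[OF assms(4) u assms(3)] card_star[OF fin(2)] u B(3) j assms(1,2)
      by simp
  qed
  finally show ?thesis by simp
qed

lemma prob_reservoir_unlinked:
  assumes "s \<ge> 2" "0 \<le> q" "q \<le> 1" and Z: "Z \<subseteq> {1..n}" and Q: "Q \<subseteq> {1..n} - Z"
    and \<A>: "\<A> \<subseteq> {A. A \<subseteq> Z \<and> card A = r}"
    and U: "disjoint_family_on U \<A>" "\<And>A. A \<in> \<A> \<Longrightarrow> U A \<subseteq> {1..n} - Z - Q" "\<And>A. A \<in> \<A> \<Longrightarrow> card (U A) = x"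
  shows "measure_pmf.prob (random_edges s n q)
      {E. \<forall>t\<in>Q. \<exists>A\<in>\<A>. \<forall>u\<in>U A. \<not> insert t ` star (s - 1) u A \<subseteq> E} =
    (1 - (1 - (1 - q ^ (r choose (s - 2))) ^ x) ^ card \<A>) ^ card Q"
proof (rule prob_no_transversal_random_subset[OF finite_possible_edges assms(2,3)])
  have finZ: "finite Z" using Z finite_subset by blast
  show "finite Q" using Q finite_subset by blast
  show "finite \<A>" using \<A> finZ by (auto intro: finite_subset[of _ "Pow Z"])
  show "finite (U A)" if "A \<in> \<A>" for A using U(2)[OF that] finite_subset by blast
  show "card (U A) = x" if "A \<in> \<A>" for A by (rule U(3)[OF that])
  have in_star: "u \<in> {1..n} - Z - Q" "e \<inter> Q = {t}" "e - Z - Q = {u}"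
    if "t \<in> Q" "A \<in> \<A>" "u \<in> U A" "e \<in> insert t ` star (s - 1) u A" for t A u e
    using that subsetD[OF \<A> that(2)] subsetD[OF U(2)[OF that(2)] that(3)] Q
    unfolding star_def by auto
  show "insert t ` star (s - 1) u A \<subseteq> possible_edges s n \<and>
      card (insert t ` star (s - 1) u A) = r choose (s - 2)" if "t \<in> Q" "A \<in> \<A>" "u \<in> U A" for t A u
  proof -
    have "A \<subseteq> Z" "card A = r" using \<A> that(2) by auto
    moreover from this have "A \<subseteq> {1..n}" "finite A" using Z finite_subset[OF _ finZ] by auto
    moreover from \<open>A \<subseteq> Z\<close> have "u \<in> {1..n} - A" "t \<in> {1..n} - A" "t \<noteq> u"
      using U(2)[OF that(2)] that(1,3) Q by auto
    ultimately show ?thesis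
      using assms(1) insert_image_star_subset_possible_edges[of A n u t s]
        card_insert_image_star[of A u t s]
      by simp
  qed
  show "disjoint_family_on (\<lambda>(t, A, u). insert t ` star (s - 1) u A) (Q \<times> Sigma \<A> U)"
    unfolding disjoint_family_on_def
  proof (intro ballI impI equals0I)
    fix i j e
    assume i: "i \<in> Q \<times> Sigma \<A> U" and j: "j \<in> Q \<times> Sigma \<A> U" and "i \<noteq> j"
      and e: "e \<in> (case i of (t, A, u) \<Rightarrow> insert t ` star (s - 1) u A) \<inter>
        (case j of (t, A, u) \<Rightarrow> insert t ` star (s - 1) u A)"
    obtain t A u where tAu: "i = (t, A, u)" "t \<in> Q" "A \<in> \<A>" "u \<in> U A" using i by auto
    obtain t' A' u' where tAu': "j = (t', A', u')" "t' \<in> Q" "A' \<in> \<A>" "u' \<in> U A'" using j by auto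
    have "e \<inter> Q = {t}" "e - Z - Q = {u}" "e \<inter> Q = {t'}" "e - Z - Q = {u'}"
      using in_star(2,3)[OF tAu(2-4), of e] in_star(2,3)[OF tAu'(2-4), of e] e tAu(1) tAu'(1)
      by auto
    then have "t = t'" "u = u'" by simp_all
    moreover from this have "A = A'"
      using disjoint_family_onD[OF U(1) tAu(3) tAu'(3)] tAu(4) tAu'(4) by blast
    ultimately show False using \<open>i \<noteq> j\<close> tAu(1) tAu'(1) by simp
  qed
qed

lemma linked_if_joined_in_stages:
  fixes Q :: "nat set"
  defines "K \<equiv> {e. e \<inter> Q = {}}"
  assumes "finite A" "A \<inter> Q = {}" "u \<in> U - Q" "t \<in> Q" "s \<ge> 2"
    and "joined s E\<^sub>1 u A" "insert t ` star (s - 1) u A \<subseteq> E\<^sub>2"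
  shows "linked s U (E\<^sub>1 \<inter> K \<union> (E\<^sub>2 - K)) A t"
proof -
  have "t \<notin> A" using assms(3,5) by blast
  moreover have "star s u A \<subseteq> K" using assms(3,4) by (auto simp: star_def K_def)
  moreover have "insert t ` star (s - 1) u A \<inter> K = {}" using assms(5) by (auto simp: K_def)
  ultimately have "joined s (E\<^sub>1 \<inter> K \<union> (E\<^sub>2 - K)) u (insert t A)"
    using assms(2,6-8) by (subst star_insert) blast+
  then show ?thesis using assms(4) unfolding linked_def by blast
qed

lemma prob_not_linked_exposed_le:
  fixes E\<^sub>1 :: "nat set set" and Q :: "nat set"
  defines "K \<equiv> {e. e \<inter> Q = {}}"
  assumes s: "s \<ge> 2" and q: "0 \<le> q" "q \<le> 1" and Z: "Z \<subseteq> {1..n}" and Q: "Q \<subseteq> {1..n} - Z"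
    and \<A>: "\<A> \<subseteq> {A. A \<subseteq> Z \<and> card A = r}" "card \<A> \<le> D"
    and P: "disjoint_family_on P \<A>" "\<And>A. A \<in> \<A> \<Longrightarrow> P A \<subseteq> {1..n} - Z - Q"
    and rich: "\<And>A. A \<in> \<A> \<Longrightarrow> x \<le> card {u \<in> P A. joined s E\<^sub>1 u A}"
  shows "measure_pmf.prob (random_edges s n q)
      {E. \<not> (\<exists>p\<in>{1..n} - Z. \<forall>A\<in>\<A>. linked s {1..n} (E\<^sub>1 \<inter> K \<union> (E - K)) A p)} \<le>
    (1 - (1 - (1 - q ^ (r choose (s - 2))) ^ x) ^ D) ^ card Q"
    (is "?prob {E. \<not> ?linked E} \<le> _")
proof -
  have "\<forall>A\<in>\<A>. \<exists>U. U \<subseteq> {u \<in> P A. joined s E\<^sub>1 u A} \<and> card U = x"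
  proof
    fix A assume "A \<in> \<A>"
    then show "\<exists>U. U \<subseteq> {u \<in> P A. joined s E\<^sub>1 u A} \<and> card U = x"
      using obtain_subset_with_card_n[OF rich] by blast
  qed
  then have "\<exists>U. \<forall>A\<in>\<A>. U A \<subseteq> {u \<in> P A. joined s E\<^sub>1 u A} \<and> card (U A) = x"
    by (rule bchoice)
  then obtain U where U: "\<And>A. A \<in> \<A> \<Longrightarrow> U A \<subseteq> {u \<in> P A. joined s E\<^sub>1 u A}"
    "\<And>A. A \<in> \<A> \<Longrightarrow> card (U A) = x"
    by blast
  have U_range: "U A \<subseteq> {1..n} - Z - Q" if "A \<in> \<A>" for A using U(1)[OF that] P(2)[OF that] by blast
  have "{E. \<not> ?linked E} \<subseteq> {E. \<forall>t\<in>Q. \<exists>A\<in>\<A>. \<forall>u\<in>U A. \<not> insert t ` star (s - 1) u A \<subseteq> E}"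
  proof (intro subsetI CollectI ballI, rule ccontr)
    fix E t
    assume E: "E \<in> {E. \<not> ?linked E}" and t: "t \<in> Q"
      and works: "\<not> (\<exists>A\<in>\<A>. \<forall>u\<in>U A. \<not> insert t ` star (s - 1) u A \<subseteq> E)"
    have "linked s {1..n} (E\<^sub>1 \<inter> K \<union> (E - K)) A t" if A: "A \<in> \<A>" for A
    proof -
      obtain u where u: "u \<in> U A" "insert t ` star (s - 1) u A \<subseteq> E" using works A by blast
      then have "u \<in> {1..n} - Q" "joined s E\<^sub>1 u A" using U(1)[OF A] U_range[OF A] by auto
      moreover have "A \<subseteq> Z" using A \<A>(1) by blast
      then have "A \<subseteq> {1..n}" "A \<inter> Q = {}" using Q Z by auto
      moreover from this have "finite A" using finite_subset by blast
      ultimately show ?thesis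
        unfolding K_def using u(2) t s by (intro linked_if_joined_in_stages)
    qed
    then show False using E t Q by blast
  qed
  then have "?prob {E. \<not> ?linked E} \<le>
      ?prob {E. \<forall>t\<in>Q. \<exists>A\<in>\<A>. \<forall>u\<in>U A. \<not> insert t ` star (s - 1) u A \<subseteq> E}"
    by (rule measure_pmf.finite_measure_mono) simp
  also have "\<dots> = (1 - (1 - (1 - q ^ (r choose (s - 2))) ^ x) ^ card \<A>) ^ card Q"
  proof (rule prob_reservoir_unlinked[OF s q Z Q \<A>(1) _ U_range U(2)])
    show "disjoint_family_on U \<A>"
      using P(1) U(1) unfolding disjoint_family_on_def by blast
  qed
  also have "\<dots> \<le> (1 - (1 - (1 - q ^ (r choose (s - 2))) ^ x) ^ D) ^ card Q"
    using q \<A>(2) by (intro power_mono diff_mono power_decreasing) (auto simp: power_le_one)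
  finally show ?thesis .
qed

text \<open>
  The edges avoiding a reservoir \<open>Q\<close> of candidates for \<open>p\<close> are exposed first; they provide, for
  each \<open>A\<close>, many vertices joined to \<open>A\<close>. Given these, the events that the various \<open>p \<in> Q\<close> work are
  independent.
\<close>

lemma prob_not_linked_le:
  assumes s: "s \<ge> 2" and q: "0 \<le> q" "q \<le> 1" and Z: "Z \<subseteq> {1..n}"
    and \<A>: "\<A> \<subseteq> {A. A \<subseteq> Z \<and> card A = r}" "card \<A> \<le> D"
    and size: "D * (x * h) + y \<le> n - card Z"
  shows "measure_pmf.prob (random_edges s n q) {E. \<not> (\<exists>p\<in>{1..n} - Z. \<forall>A\<in>\<A>. linked s {1..n} E A p)} \<le>
    real D * (real x * (1 - q ^ (r choose (s - 1))) ^ h) +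
    (1 - (1 - (1 - q ^ (r choose (s - 2))) ^ x) ^ D) ^ y"
    (is "?prob {E. \<not> ?linked E} \<le> real D * ?a + ?c")
proof -
  have finZ: "finite Z" using Z finite_subset by blast
  have fin\<A>: "finite \<A>" using \<A>(1) finZ by (auto intro: finite_subset[of _ "Pow Z"])
  have cardZ: "card ({1..n} - Z) = n - card Z" using Z finZ by (simp add: card_Diff_subset)
  obtain Q where Q: "Q \<subseteq> {1..n} - Z" "card Q = y"
    using obtain_subset_with_card_n[of y "{1..n} - Z"] size cardZ by auto
  have "card \<A> * (x * h) \<le> D * (x * h)" using \<A>(2) by simp
  also have "\<dots> \<le> card ({1..n} - Z - Q)"
    using size Q cardZ finite_subset[OF Q(1)] by (simp add: card_Diff_subset)
  finally obtain P where P: "disjoint_family_on P \<A>" "\<And>A. A \<in> \<A> \<Longrightarrow> P A \<subseteq> {1..n} - Z - Q"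
    "\<And>A. A \<in> \<A> \<Longrightarrow> card (P A) = x * h"
    using ex_disjoint_subsets[OF fin\<A>] by (metis finite_Diff finite_atLeastAtMost)
  define rich where "rich E \<longleftrightarrow> (\<forall>A\<in>\<A>. x \<le> card {u \<in> P A. joined s E u A})" for E
  have "{E. \<not> rich E} = (\<Union>A\<in>\<A>. {E. card {u \<in> P A. joined s E u A} < x})"
    by (auto simp: rich_def not_le)
  then have "?prob {E. \<not> rich E} \<le> (\<Sum>A\<in>\<A>. ?prob {E. card {u \<in> P A. joined s E u A} < x})"
    using fin\<A> by (simp add: measure_pmf.finite_measure_subadditive_finite)
  also have "\<dots> \<le> (\<Sum>A\<in>\<A>. ?a)"
  proof (rule sum_mono)
    fix A assume A: "A \<in> \<A>"
    then have "card A = r" "A \<subseteq> Z" using \<A>(1) by auto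
    moreover from this have "P A \<subseteq> {1..n} - A" "A \<subseteq> {1..n}" using P(2)[OF A] Z by auto
    ultimately show "?prob {E. card {u \<in> P A. joined s E u A} < x} \<le> ?a"
      using prob_few_joined_le[of q s A n "P A" x h] P(3)[OF A] q s by simp
  qed
  also have "\<dots> \<le> real D * ?a"
    using \<A>(2) q by (auto intro!: mult_right_mono simp: power_le_one)
  finally have not_rich: "?prob {E. \<not> rich E} \<le> real D * ?a" .
  have "?prob {E. \<not> ?linked E} \<le> ?prob {E. \<not> rich E} + ?c"
  proof (rule prob_random_subset_two_stage[OF finite_possible_edges])
    show "0 \<le> ?c" using q by (auto simp: power_le_one)
    show "?prob {E. \<not> ?linked (E\<^sub>1 \<inter> {e. e \<inter> Q = {}} \<union> (E - {e. e \<inter> Q = {}}))} \<le> ?c"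
      if "rich E\<^sub>1" for E\<^sub>1
      unfolding Q(2)[symmetric]
      by (rule prob_not_linked_exposed_le[OF s q Z Q(1) \<A> P(1,2)])
          (use that in \<open>auto simp: rich_def\<close>)
  qed
  with not_rich show ?thesis by linarith
qed

lemma card_bounded_subsets_le:
  assumes "n \<ge> 1"
  shows "card {Z. Z \<subseteq> {1..n} \<and> card Z \<le> K} \<le> (K + 1) * n ^ K"
proof -
  have "{Z. Z \<subseteq> {1..n} \<and> card Z \<le> K} = (\<Union>k\<le>K. {Z. Z \<subseteq> {1..n} \<and> card Z = k})" by auto
  then have "card {Z. Z \<subseteq> {1..n} \<and> card Z \<le> K} \<le> (\<Sum>k\<le>K. n choose k)"
    using card_UN_le[of "{..K}" "\<lambda>k. {Z. Z \<subseteq> {1..n} \<and> card Z = k}"] by (simp add: n_subsets)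
  also have "\<dots> \<le> (\<Sum>k\<le>K. n ^ K)"
  proof (rule sum_mono)
    fix k assume "k \<in> {..K}"
    then have "n ^ k \<le> n ^ K" using assms by (intro power_increasing) auto
    then show "n choose k \<le> n ^ K"
      by (cases "k \<le> n") (auto simp: binomial_eq_0 intro: order_trans[OF binomial_le_pow])
  qed
  finally show ?thesis by simp
qed

lemma link_requests_bounds:
  assumes "n \<ge> 1"
  shows finite_link_requests: "finite (link_requests {1..n} r D K)"
    and card_link_requests_le: "card (link_requests {1..n} r D K) \<le> (K + 1) * n ^ K * 2 ^ 2 ^ K"
proof -
  define \<Z> where "\<Z> = {Z. Z \<subseteq> {1..n} \<and> card Z \<le> K}"
  define families where "families = (\<lambda>Z :: nat set. {\<A>. \<A> \<subseteq> {A. A \<subseteq> Z \<and> card A = r} \<and> card \<A> \<le> D})"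
  have requests: "link_requests {1..n} r D K = Sigma \<Z> families"
    unfolding link_requests_def \<Z>_def families_def ..
  have "finite \<Z>" by (simp add: \<Z>_def)
  have families: "finite (families Z) \<and> card (families Z) \<le> 2 ^ 2 ^ K" if "Z \<in> \<Z>" for Z
  proof -
    have Z: "finite Z" "card Z \<le> K" using that by (auto simp: \<Z>_def intro: finite_subset)
    have sub: "families Z \<subseteq> Pow (Pow Z)" by (auto simp: families_def)
    have "card (families Z) \<le> card (Pow (Pow Z))" using Z(1) by (intro card_mono sub) simp
    also have "\<dots> = 2 ^ 2 ^ card Z" using Z(1) by (simp add: card_Pow)
    also have "\<dots> \<le> 2 ^ 2 ^ K" using Z(2) by (intro power_increasing) auto
    finally show ?thesis using finite_subset[OF sub] Z(1) by simp
  qed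
  then show "finite (link_requests {1..n} r D K)"
    unfolding requests using \<open>finite \<Z>\<close> by (intro finite_SigmaI) auto
  have "card (link_requests {1..n} r D K) = (\<Sum>Z\<in>\<Z>. card (families Z))"
    unfolding requests using \<open>finite \<Z>\<close> families by (intro card_SigmaI) auto
  also have "\<dots> \<le> card \<Z> * 2 ^ 2 ^ K"
    using families sum_bounded_above[of \<Z> "\<lambda>Z. card (families Z)"] by simp
  also have "\<dots> \<le> (K + 1) * n ^ K * 2 ^ 2 ^ K"
    using card_bounded_subsets_le[OF assms, of K] unfolding \<Z>_def by (rule mult_right_mono) simp
  finally show "card (link_requests {1..n} r D K) \<le> (K + 1) * n ^ K * 2 ^ 2 ^ K" .
qed

lemma prob_not_extendable_le:
  assumes "s \<ge> 2" "0 \<le> q" "q \<le> 1" "n \<ge> 1" "D * (x * h) + y \<le> n - K"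
  shows "measure_pmf.prob (random_edges s n q) {E. \<not> extendable s r D K {1..n} E} \<le>
    real ((K + 1) * n ^ K * 2 ^ 2 ^ K) *
    (real D * (real x * (1 - q ^ (r choose (s - 1))) ^ h) +
      (1 - (1 - (1 - q ^ (r choose (s - 2))) ^ x) ^ D) ^ y)"
    (is "_ \<le> _ * ?b")
proof -
  let ?prob = "measure_pmf.prob (random_edges s n q)" and ?I = "link_requests {1..n} r D K"
  let ?bad = "\<lambda>(Z, \<A>). {E. \<not> (\<exists>p\<in>{1..n} - Z. \<forall>A\<in>\<A>. linked s {1..n} E A p)}"
  have "{E. \<not> extendable s r D K {1..n} E} = (\<Union>i\<in>?I. ?bad i)"
    unfolding extendable_def by fast
  then have "?prob {E. \<not> extendable s r D K {1..n} E} \<le> (\<Sum>i\<in>?I. ?prob (?bad i))"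
    using finite_link_requests[OF assms(4)]
    by (simp add: measure_pmf.finite_measure_subadditive_finite)
  also have "\<dots> \<le> (\<Sum>i\<in>?I. ?b)"
  proof (intro sum_mono, clarify)
    fix Z \<A> assume "(Z, \<A>) \<in> ?I"
    then have "Z \<subseteq> {1..n}" "card Z \<le> K" "\<A> \<subseteq> {A. A \<subseteq> Z \<and> card A = r}" "card \<A> \<le> D"
      by (auto simp: link_requests_def)
    moreover from this have "D * (x * h) + y \<le> n - card Z" using assms(5) by linarith
    ultimately show "?prob {E. \<not> (\<exists>p\<in>{1..n} - Z. \<forall>A\<in>\<A>. linked s {1..n} E A p)} \<le> ?b"
      using assms(1-3) by (intro prob_not_linked_le)
  qed
  also have "\<dots> \<le> real ((K + 1) * n ^ K * 2 ^ 2 ^ K) * ?b"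
    using of_nat_mono[OF card_link_requests_le[OF assms(4)], where 'a=real] assms(2,3)
    by (auto simp only: sum_constant intro!: mult_right_mono) (auto simp: power_le_one)
  finally show ?thesis .
qed

lemma power_mult_exp_minus_powr_tendsto_0:
  assumes "c > 0" "a > 0"
  shows "(\<lambda>n. real n ^ k * exp (- (c * real n powr a))) \<longlonglongrightarrow> 0"
  using assms by real_asymp

lemma exp_minus_le_linear: "exp (- t) \<le> 1 - t / 2" if "0 \<le> t" "t \<le> 1" for t :: real
proof -
  have "1 \<le> (1 - t / 2) * (1 + t)"
    using that mult_left_mono[of t 1 t] by (simp add: algebra_simps)
  also have "\<dots> \<le> (1 - t / 2) * exp t"
    using that exp_ge_add_one_self[of t] by (intro mult_left_mono) auto
  finally show ?thesis by (simp add: exp_minus field_simps)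
qed

lemma power_one_minus_le_exp: "0 \<le> t \<Longrightarrow> t \<le> 1 \<Longrightarrow> (1 - t) ^ h \<le> exp (- (t * real h))" for t :: real
  using power_mono[of "1 - t" "exp (- t)" h] exp_ge_add_one_self[of "- t"]
  by (simp add: exp_of_nat_mult[symmetric] mult.commute)

lemma prob_not_extendable_exp_le:
  assumes "s \<ge> 2" "0 \<le> q" "q \<le> 1" "n \<ge> 1" "D * (x * h) + y \<le> n - K"
    and hits: "q ^ (r choose (s - 2)) * real x \<le> 1"
  shows "measure_pmf.prob (random_edges s n q) {E. \<not> extendable s r D K {1..n} E} \<le>
    real ((K + 1) * n ^ K * 2 ^ 2 ^ K) *
      (real D * (real x * exp (- (q ^ (r choose (s - 1)) * real h))) +
      exp (- ((q ^ (r choose (s - 2)) * real x / 2) ^ D * real y)))"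
proof -
  let ?\<rho> = "q ^ (r choose (s - 2))"
  have unit: "0 \<le> q ^ j" "q ^ j \<le> 1" for j using assms(2,3) by (auto simp: power_le_one)
  have "(1 - ?\<rho>) ^ x \<le> exp (- (?\<rho> * real x))"
    by (intro power_one_minus_le_exp unit)
  also have "\<dots> \<le> 1 - ?\<rho> * real x / 2"
    using hits unit by (intro exp_minus_le_linear) auto
  finally have "(?\<rho> * real x / 2) ^ D \<le> (1 - (1 - ?\<rho>) ^ x) ^ D"
    using unit by (intro power_mono) auto
  then have "(1 - (1 - (1 - ?\<rho>) ^ x) ^ D) ^ y \<le> (1 - (?\<rho> * real x / 2) ^ D) ^ y"
    using unit by (intro power_mono) (auto simp: power_le_one)
  also have "\<dots> \<le> exp (- ((?\<rho> * real x / 2) ^ D * real y))"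
    using hits unit by (intro power_one_minus_le_exp) (auto simp: power_le_one)
  finally have second: "(1 - (1 - (1 - ?\<rho>) ^ x) ^ D) ^ y \<le>
      exp (- ((?\<rho> * real x / 2) ^ D * real y))" .
  have first: "(1 - q ^ (r choose (s - 1))) ^ h \<le> exp (- (q ^ (r choose (s - 1)) * real h))"
    by (intro power_one_minus_le_exp unit)
  show ?thesis
    by (rule order_trans[OF prob_not_extendable_le[OF assms(1-5)]])
      (intro mult_left_mono add_mono first second; simp)
qed

lemma eventually_link_pools_fit:
  assumes "0 \<le> \<xi>" "0 \<le> \<eta>" "\<xi> + \<eta> < 1"
  shows "\<forall>\<^sub>F n in sequentially. D * (nat \<lfloor>real n powr \<xi>\<rfloor> * nat \<lceil>real n powr \<eta>\<rceil>) + n div 3 \<le> n - K"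
proof -
  have "(\<lambda>n. 2 * real D * real n powr (\<xi> + \<eta> - 1)) \<longlonglongrightarrow> 2 * real D * 0"
    using assms(3)
    by (intro tendsto_mult tendsto_const tendsto_neg_powr filterlim_real_sequentially) auto
  then have "\<forall>\<^sub>F n in sequentially. 2 * real D * real n powr (\<xi> + \<eta> - 1) < 1 / 3"
    by (rule order_tendstoD) simp
  then show ?thesis
    using eventually_ge_at_top[of "max 1 (3 * K)"]
  proof eventually_elim
    case (elim n)
    then have n: "1 \<le> real n" "3 * real K \<le> real n" by auto
    have "1 \<le> real n powr \<eta>" using n(1) assms(2) by (simp add: ge_one_powr_ge_zero)
    then have "real (nat \<lceil>real n powr \<eta>\<rceil>) \<le> 2 * real n powr \<eta>"
      using of_int_ceiling_le_add_one[of "real n powr \<eta>"] by linarith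
    then have "real (D * (nat \<lfloor>real n powr \<xi>\<rfloor> * nat \<lceil>real n powr \<eta>\<rceil>)) \<le>
        real D * (real n powr \<xi> * (2 * real n powr \<eta>))"
      unfolding of_nat_mult by (intro mult_left_mono mult_mono) (use \<open>1 \<le> real n powr \<eta>\<close> in auto)
    also have "\<dots> = 2 * real D * real n powr (\<xi> + \<eta> - 1) * real n"
      using n(1) by (simp add: powr_add powr_diff)
    also have "\<dots> \<le> 1 / 3 * real n" using elim(1) by (intro mult_right_mono) auto
    finally have "real (D * (nat \<lfloor>real n powr \<xi>\<rfloor> * nat \<lceil>real n powr \<eta>\<rceil>) + n div 3 + K) \<le> real n"
      using n(2) by simp
    then show ?case by linarith
  qed
qed

lemma half_powr_le_nat_floor_powr:
  assumes "1 \<le> real n" "0 \<le> \<xi>"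
  shows "real n powr \<xi> / 2 \<le> real (nat \<lfloor>real n powr \<xi>\<rfloor>)"
proof -
  have "1 \<le> real n powr \<xi>" using assms by (simp add: ge_one_powr_ge_zero)
  then have "1 \<le> \<lfloor>real n powr \<xi>\<rfloor>" by simp
  then show ?thesis by linarith
qed

lemma second_stage_exponent_ge:
  assumes n: "12 \<le> n" and x: "real n powr \<xi> / 2 \<le> x"
  shows "(1 / 4) ^ (D + 1) * real n powr (1 - real D * (a - \<xi>)) \<le>
      (real n powr - a * x / 2) ^ D * real (n div 3)"
proof -
  have "0 \<le> x" using x powr_ge_zero[of "real n" \<xi>] by linarith
  have "0 < real n" using n by simp
  then have "real n powr (1 - real D * (a - \<xi>)) = real n powr (D * (\<xi> - a)) * real n"
    using powr_add[of "real n" "D * (\<xi> - a)" 1] by (simp add: algebra_simps)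
  then have "(1 / 4) ^ (D + 1) * real n powr (1 - real D * (a - \<xi>)) =
      (real n powr (\<xi> - a) / 4) ^ D * (real n / 4)"
    using \<open>0 < real n\<close> by (simp add: power_divide powr_power mult.commute)
  also have "\<dots> \<le> (real n powr - a * x / 2) ^ D * real (n div 3)"
  proof (intro mult_mono power_mono)
    have "real n powr (\<xi> - a) = real n powr - a * real n powr \<xi>"
      by (simp add: powr_add[symmetric])
    then show "real n powr (\<xi> - a) / 4 \<le> real n powr - a * x / 2"
      using mult_left_mono[OF x, of "real n powr - a"] by (simp add: mult.commute)
    show "real n / 4 \<le> real (n div 3)" using n by linarith
  qed (use \<open>0 \<le> x\<close> in auto)
  finally show ?thesis .
qed

lemma prob_not_extendable_powr_le:
  fixes \<alpha> :: real and r s D K :: nat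
  defines "\<beta> \<equiv> real (r choose (s - 1))" and "\<gamma> \<equiv> real (r choose (s - 2))"
  assumes "s \<ge> 2" "\<alpha> > 0" "0 \<le> \<xi>" "\<xi> \<le> 1" "\<xi> \<le> \<alpha> * \<gamma>" and n: "12 \<le> n"
    and fit: "D * (nat \<lfloor>real n powr \<xi>\<rfloor> * nat \<lceil>real n powr \<eta>\<rceil>) + n div 3 \<le> n - K"
  shows "measure_pmf.prob (random_edges s n (real n powr - \<alpha>)) {E. \<not> extendable s r D K {1..n} E} \<le>
    real ((K + 1) * n ^ K * 2 ^ 2 ^ K) * (real D * (real n * exp (- (real n powr (\<eta> - \<alpha> * \<beta>)))) +
      exp (- ((1 / 4) ^ (D + 1) * real n powr (1 - D * (\<alpha> * \<gamma> - \<xi>)))))"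
proof -
  define q where "q = real n powr - \<alpha>"
  define x h where "x = nat \<lfloor>real n powr \<xi>\<rfloor>" and "h = nat \<lceil>real n powr \<eta>\<rceil>"
  have n1: "1 \<le> real n" using n by simp
  have q_power: "q ^ (r choose (s - 1)) = real n powr - (\<alpha> * \<beta>)"
    "q ^ (r choose (s - 2)) = real n powr - (\<alpha> * \<gamma>)"
    using n1 by (simp_all add: q_def powr_power \<beta>_def \<gamma>_def mult.commute)
  have x_le: "real x \<le> real n powr \<xi>" by (simp add: x_def)
  also have "\<dots> \<le> real n powr 1" using n1 \<open>\<xi> \<le> 1\<close> by (rule powr_mono[rotated])
  finally have "real x \<le> real n" by simp
  have "real n powr - (\<alpha> * \<gamma>) * real x \<le> real n powr (\<xi> - \<alpha> * \<gamma>)"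
    using mult_left_mono[OF x_le, of "real n powr - (\<alpha> * \<gamma>)"] by (simp add: powr_add[symmetric])
  also have "\<dots> \<le> 1" using n1 \<open>\<xi> \<le> \<alpha> * \<gamma>\<close> powr_mono[of "\<xi> - \<alpha> * \<gamma>" 0 "real n"] by simp
  finally have hits: "q ^ (r choose (s - 2)) * real x \<le> 1" unfolding q_power .
  have "real n powr (\<eta> - \<alpha> * \<beta>) = real n powr - (\<alpha> * \<beta>) * real n powr \<eta>"
    by (simp add: powr_add[symmetric])
  also have "\<dots> \<le> q ^ (r choose (s - 1)) * real h"
    unfolding q_power by (intro mult_left_mono) (auto simp: h_def)
  finally have first: "real n powr (\<eta> - \<alpha> * \<beta>) \<le> q ^ (r choose (s - 1)) * real h" .
  have second: "(1 / 4) ^ (D + 1) * real n powr (1 - D * (\<alpha> * \<gamma> - \<xi>)) \<le>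
      (q ^ (r choose (s - 2)) * real x / 2) ^ D * real (n div 3)"
    unfolding q_power x_def
    by (rule second_stage_exponent_ge[OF n half_powr_le_nat_floor_powr[OF n1 \<open>0 \<le> \<xi>\<close>]])
  have "measure_pmf.prob (random_edges s n q) {E. \<not> extendable s r D K {1..n} E} \<le>
      real ((K + 1) * n ^ K * 2 ^ 2 ^ K) *
      (real D * (real x * exp (- (q ^ (r choose (s - 1)) * real h))) +
        exp (- ((q ^ (r choose (s - 2)) * real x / 2) ^ D * real (n div 3))))"
    using fit hits n powr_minus_le_1[OF \<open>\<alpha> > 0\<close>]
    by (intro prob_not_extendable_exp_le \<open>s \<ge> 2\<close>) (auto simp: q_def x_def h_def)
  also have "\<dots> \<le> real ((K + 1) * n ^ K * 2 ^ 2 ^ K) *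
      (real D * (real n * exp (- (real n powr (\<eta> - \<alpha> * \<beta>)))) +
      exp (- ((1 / 4) ^ (D + 1) * real n powr (1 - D * (\<alpha> * \<gamma> - \<xi>)))))"
    using first second \<open>real x \<le> real n\<close> by (intro mult_left_mono add_mono mult_mono) auto
  finally show ?thesis unfolding q_def .
qed

lemma aas_extendable_of_exponents:
  fixes \<alpha> :: real and r s D K :: nat
  defines "\<beta> \<equiv> real (r choose (s - 1))" and "\<gamma> \<equiv> real (r choose (s - 2))"
  assumes "s \<ge> 2" "\<alpha> > 0" and \<xi>: "0 \<le> \<xi>" "\<xi> \<le> \<alpha> * \<gamma>" and \<eta>: "\<alpha> * \<beta> < \<eta>" "\<xi> + \<eta> < 1"
    and D: "D * (\<alpha> * \<gamma> - \<xi>) < 1"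
  shows "aas (\<lambda>n. random_edges s n (real n powr - \<alpha>)) (\<lambda>n. extendable s r D K {1..n})"
proof (rule aasI)
  have "0 \<le> \<alpha> * \<beta>" using \<open>\<alpha> > 0\<close> by (simp add: \<beta>_def)
  then have "0 \<le> \<eta>" "\<xi> \<le> 1" using \<eta> by auto
  show "\<forall>\<^sub>F n in sequentially. measure_pmf.prob (random_edges s n (real n powr - \<alpha>))
      {E. \<not> extendable s r D K {1..n} E} \<le>
      real ((K + 1) * n ^ K * 2 ^ 2 ^ K) * (real D * (real n * exp (- (real n powr (\<eta> - \<alpha> * \<beta>)))) +
        exp (- ((1 / 4) ^ (D + 1) * real n powr (1 - D * (\<alpha> * \<gamma> - \<xi>)))))"
    using eventually_link_pools_fit[OF \<xi>(1) \<open>0 \<le> \<eta>\<close> \<eta>(2), of D K] eventually_ge_at_top[of 12]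
  proof eventually_elim
    case (elim n)
    show ?case
      unfolding \<beta>_def \<gamma>_def
      by (rule prob_not_extendable_powr_le[OF assms(3,4) \<xi>(1) \<open>\<xi> \<le> 1\<close> \<xi>(2)[unfolded \<gamma>_def] elim(2,1)])
  qed
  have "(\<lambda>n. real ((K + 1) * 2 ^ 2 ^ K) *
      (real D * (real n ^ (K + 1) * exp (- (1 * real n powr (\<eta> - \<alpha> * \<beta>)))) +
      real n ^ K * exp (- ((1 / 4) ^ (D + 1) * real n powr (1 - D * (\<alpha> * \<gamma> - \<xi>)))))) \<longlonglongrightarrow>
      real ((K + 1) * 2 ^ 2 ^ K) * (real D * 0 + 0)"
    using \<eta>(1) D
    by (intro tendsto_mult tendsto_add tendsto_const power_mult_exp_minus_powr_tendsto_0) auto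
  then show "(\<lambda>n. real ((K + 1) * n ^ K * 2 ^ 2 ^ K) *
      (real D * (real n * exp (- (real n powr (\<eta> - \<alpha> * \<beta>)))) +
      exp (- ((1 / 4) ^ (D + 1) * real n powr (1 - D * (\<alpha> * \<gamma> - \<xi>)))))) \<longlonglongrightarrow> 0"
    by (simp add: algebra_simps)
qed

lemma aas_extendable:
  fixes \<alpha> :: real and r s D K :: nat
  defines "\<beta> \<equiv> real (r choose (s - 1))" and "\<gamma> \<equiv> real (r choose (s - 2))"
  assumes "s \<ge> 2" "\<alpha> > 0" "\<alpha> * \<beta> < 1" "1 \<le> \<alpha> * (\<beta> + \<gamma>)" "D * (\<alpha> * (\<beta> + \<gamma>) - 1) < 1"
  shows "aas (\<lambda>n. random_edges s n (real n powr - \<alpha>)) (\<lambda>n. extendable s r D K {1..n})"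
proof -
  define \<delta> where "\<delta> = min ((1 - \<alpha> * \<beta>) / 2) ((1 - D * (\<alpha> * (\<beta> + \<gamma>) - 1)) / (2 * (2 * D + 1)))"
  have "\<delta> > 0" using assms(5,7) by (simp add: \<delta>_def)
  have "\<delta> \<le> (1 - \<alpha> * \<beta>) / 2" unfolding \<delta>_def by (rule min.cobounded1)
  then have "2 * \<delta> \<le> 1 - \<alpha> * \<beta>" by simp
  have "\<delta> \<le> (1 - D * (\<alpha> * (\<beta> + \<gamma>) - 1)) / (2 * (2 * D + 1))"
    unfolding \<delta>_def by (rule min.cobounded2)
  then have "2 * D * \<delta> + D * (\<alpha> * (\<beta> + \<gamma>) - 1) < 1"
    using \<open>\<delta> > 0\<close> assms(7) by (simp add: pos_le_divide_eq algebra_simps)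
  then have "D * (\<alpha> * \<gamma> - (1 - \<alpha> * \<beta> - 2 * \<delta>)) < 1" by (simp add: algebra_simps)
  then show ?thesis
    using assms(3,4,6) \<open>\<delta> > 0\<close> \<open>2 * \<delta> \<le> 1 - \<alpha> * \<beta>\<close>
    unfolding \<beta>_def \<gamma>_def
    by (intro aas_extendable_of_exponents[where \<xi>="1 - \<alpha> * \<beta> - 2 * \<delta>" and \<eta>="\<alpha> * \<beta> + \<delta>"])
      (auto simp: \<beta>_def algebra_simps)
qed

section \<open>The sentence\<close>

text \<open>\<open>Equal 0 0\<close> serves as a quantifier-free constant for truth.\<close>

definition conjs :: "fo_formula list \<Rightarrow> fo_formula" where
  "conjs \<phi>s = foldr Conj \<phi>s (Equal 0 0)"

lemma sat_conjs [simp]: "sat H v (conjs \<phi>s) \<longleftrightarrow> (\<forall>\<phi>\<in>set \<phi>s. sat H v \<phi>)"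
  unfolding conjs_def by (induction \<phi>s) auto

lemma has_arity_conjs [simp]: "has_arity s (conjs \<phi>s) \<longleftrightarrow> (\<forall>\<phi>\<in>set \<phi>s. has_arity s \<phi>)"
  unfolding conjs_def by (induction \<phi>s) auto

lemma free_vars_conjs [simp]: "free_vars (conjs \<phi>s) = insert 0 (\<Union>\<phi>\<in>set \<phi>s. free_vars \<phi>)"
  unfolding conjs_def by (induction \<phi>s) auto

lemma quantifier_depth_conjs_le:
  "quantifier_depth (conjs \<phi>s) \<le> k \<longleftrightarrow> (\<forall>\<phi>\<in>set \<phi>s. quantifier_depth \<phi> \<le> k)"
  unfolding conjs_def by (induction \<phi>s) auto

lemma quantifier_depth_conjs_eq_0 [simp]:
  "quantifier_depth (conjs \<phi>s) = 0 \<longleftrightarrow> (\<forall>\<phi>\<in>set \<phi>s. quantifier_depth \<phi> = 0)"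
  using quantifier_depth_conjs_le[of \<phi>s 0] by simp

lemma sat_foldr_Exists:
  "sat H v (foldr Exists xs \<phi>) \<longleftrightarrow>
    (\<exists>w. (\<forall>x\<in>set xs. w x \<in> fst H) \<and> (\<forall>x. x \<notin> set xs \<longrightarrow> w x = v x) \<and> sat H w \<phi>)"
proof (induction xs arbitrary: v)
  case Nil
  have "w = v" if "\<forall>x. w x = v x" for w using that by auto
  then show ?case by auto
next
  case (Cons x xs)
  show ?case
  proof
    assume "sat H v (foldr Exists (x # xs) \<phi>)"
    then obtain a where a: "a \<in> fst H" "sat H (v(x := a)) (foldr Exists xs \<phi>)" by auto
    then obtain w where "\<forall>x\<in>set xs. w x \<in> fst H" "\<forall>y. y \<notin> set xs \<longrightarrow> w y = (v(x := a)) y" "sat H w \<phi>"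
      using Cons.IH by blast
    then show "\<exists>w. (\<forall>x\<in>set (x # xs). w x \<in> fst H) \<and> (\<forall>y. y \<notin> set (x # xs) \<longrightarrow> w y = v y) \<and> sat H w \<phi>"
      using a(1)
      by (intro exI[of _ w]) (metis fun_upd_apply set_ConsD list.set_intros(2) list.set_intros(1))
  next
    assume "\<exists>w. (\<forall>x\<in>set (x # xs). w x \<in> fst H) \<and> (\<forall>y. y \<notin> set (x # xs) \<longrightarrow> w y = v y) \<and> sat H w \<phi>"
    then obtain w where w: "\<forall>x\<in>set (x # xs). w x \<in> fst H"
      "\<forall>y. y \<notin> set (x # xs) \<longrightarrow> w y = v y" "sat H w \<phi>"
      by blast
    then have "sat H (v(x := w x)) (foldr Exists xs \<phi>)"
      unfolding Cons.IH by (intro exI[of _ w]) auto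
    then show "sat H v (foldr Exists (x # xs) \<phi>)" using w(1) by auto
  qed
qed

lemma has_arity_foldr_Exists [simp]: "has_arity s (foldr Exists xs \<phi>) = has_arity s \<phi>"
  by (induction xs) auto

lemma free_vars_foldr_Exists [simp]: "free_vars (foldr Exists xs \<phi>) = free_vars \<phi> - set xs"
  by (induction xs) auto

lemma quantifier_depth_foldr_Exists [simp]:
  "quantifier_depth (foldr Exists xs \<phi>) = length xs + quantifier_depth \<phi>"
  by (induction xs) auto

definition notin_fm :: "nat \<Rightarrow> nat list \<Rightarrow> fo_formula" where
  "notin_fm x ys = conjs (map (\<lambda>y. Neg (Equal x y)) ys)"

lemma sat_notin_fm [simp]: "sat H v (notin_fm x ys) \<longleftrightarrow> v x \<notin> v ` set ys"
  by (auto simp: notin_fm_def)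

definition joined_fm :: "nat \<Rightarrow> nat \<Rightarrow> nat list \<Rightarrow> fo_formula" where
  "joined_fm s u xs =
    conjs (map (\<lambda>ys. Edge (u # ys)) (filter (\<lambda>ys. length ys = s - 1) (List.subseqs xs)))"

lemma star_set_eq_image_subseqs:
  assumes "distinct xs"
  shows "star s u (set xs) = (\<lambda>ys. set (u # ys)) ` {ys \<in> set (List.subseqs xs). length ys = s - 1}"
proof -
  have "{S. S \<subseteq> set xs \<and> card S = s - 1} = {S \<in> set ` set (List.subseqs xs). card S = s - 1}"
    unfolding subseqs_powset by (simp add: Pow_def)
  also have "\<dots> = set ` {ys \<in> set (List.subseqs xs). card (set ys) = s - 1}" by blast
  also have "{ys \<in> set (List.subseqs xs). card (set ys) = s - 1} =
      {ys \<in> set (List.subseqs xs). length ys = s - 1}"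
    using subseqs_distinctD[OF _ assms] by (auto simp: distinct_card)
  finally show ?thesis by (simp add: star_def image_image)
qed

lemma sat_joined_fm:
  assumes "distinct xs" "inj_on v (set xs)"
  shows "sat H v (joined_fm s u xs) \<longleftrightarrow> joined s (snd H) (v u) (v ` set xs)"
  unfolding image_star[OF assms(2), symmetric] star_set_eq_image_subseqs[OF assms(1)]
  by (auto simp: joined_fm_def image_subset_iff)

text \<open>The last conjunct makes the clusters of different indices disjoint.\<close>

definition cluster :: "nat \<Rightarrow> nat \<Rightarrow> nat set set \<Rightarrow> (nat \<Rightarrow> nat) \<Rightarrow> nat \<Rightarrow> nat set" where
  "cluster s m E a i = {y. y \<noteq> a i \<and> joined s E y (a ` ({..m} - {i})) \<and>
     (\<forall>j\<in>{..m} - {i}. \<not> joined s E y (a ` ({..m} - {j})))}"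

definition covered :: "nat \<Rightarrow> nat \<Rightarrow> nat set \<Rightarrow> nat set set \<Rightarrow> (nat \<Rightarrow> nat) \<Rightarrow> nat set \<Rightarrow> bool" where
  "covered s m U E a Y \<longleftrightarrow>
    (\<exists>p\<in>U - a ` {..m}. \<forall>y\<in>U \<inter> Y. y \<noteq> p \<and> linked s U E (insert y (a ` {3..m})) p)"

definition uncoverable :: "nat \<Rightarrow> nat \<Rightarrow> nat set \<Rightarrow> nat set set \<Rightarrow> bool" where
  "uncoverable s m U E \<longleftrightarrow> (\<exists>a b. inj_on a {..m} \<and> a ` {..m} \<subseteq> U \<and> b \<in> U \<inter> cluster s m E a 0 \<and>
     (\<forall>i\<le>m. \<not> covered s m U E a (insert b (cluster s m E a i))))"

text \<open>Variable \<open>i \<le> m\<close> stands for \<open>a\<^sub>i\<close>; the variables \<open>m + 1\<close> to \<open>m + 4\<close> stand for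
  \<open>b\<close>, \<open>p\<close>, \<open>y\<close>, \<open>u\<close>.\<close>

definition others :: "nat \<Rightarrow> nat \<Rightarrow> nat list" where
  "others m i = filter (\<lambda>j. j \<noteq> i) [0..<Suc m]"

definition cluster_fm :: "nat \<Rightarrow> nat \<Rightarrow> nat \<Rightarrow> nat \<Rightarrow> fo_formula" where
  "cluster_fm s m i y = conjs (Neg (Equal y i) # joined_fm s y (others m i) #
     map (\<lambda>j. Neg (joined_fm s y (others m j))) (others m i))"

definition linked_fm :: "nat \<Rightarrow> nat \<Rightarrow> fo_formula" where
  "linked_fm s m = Exists (m + 4) (joined_fm s (m + 4) ((m + 2) # (m + 3) # [3..<Suc m]))"

definition covered_fm :: "nat \<Rightarrow> nat \<Rightarrow> nat \<Rightarrow> fo_formula" where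
  "covered_fm s m i = Exists (m + 2) (Conj (notin_fm (m + 2) [0..<Suc m])
     (Forall (m + 3) (Impl (Disj (cluster_fm s m i (m + 3)) (Equal (m + 3) (m + 1)))
       (Conj (Neg (Equal (m + 3) (m + 2))) (linked_fm s m)))))"

definition uncoverable_fm :: "nat \<Rightarrow> nat \<Rightarrow> fo_formula" where
  "uncoverable_fm s m = foldr Exists [0..<m + 2]
     (conjs (map (\<lambda>i. notin_fm i (others m i)) [0..<Suc m] @
       cluster_fm s m 0 (m + 1) # map (\<lambda>i. Neg (covered_fm s m i)) [0..<Suc m]))"

lemma set_others [simp]: "set (others m i) = {..m} - {i}"
  by (auto simp: others_def)

lemma distinct_others [simp]: "distinct (others m i)"
  by (simp add: others_def)

lemma joined_notin:
  assumes "joined s E u B" "finite B" "s - 1 \<le> card B" "s \<ge> 2" "\<forall>e\<in>E. card e = s"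
  shows "u \<notin> B"
proof
  assume u: "u \<in> B"
  have "s - 2 \<le> card (B - {u})" using assms(2,3) u by simp
  then obtain S where S: "S \<subseteq> B - {u}" "card S = s - 2" "finite S"
    by (rule obtain_subset_with_card_n)
  then have card: "card (insert u S) = s - 1"
    using assms(4) by (subst card_insert_disjoint) auto
  then have "insert u (insert u S) \<in> star s u B"
    using S(1) u by (intro insert_mem_star) auto
  then have "card (insert u S) = s" using assms(1,5) by auto
  with card assms(4) show False by simp
qed

lemma card_image_atMost_minus: "inj_on a {..m} \<Longrightarrow> i \<le> m \<Longrightarrow> card (a ` ({..m} - {i})) = m"
  for a :: "nat \<Rightarrow> 'a"
  by (subst card_image) (auto intro: inj_on_subset)

lemma cluster_notin:
  assumes "y \<in> cluster s m E a i" "inj_on a {..m}" "i \<le> m" "s - 1 \<le> m" "s \<ge> 2"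
    "\<forall>e\<in>E. card e = s"
  shows "y \<notin> a ` {..m}"
proof -
  have "y \<notin> a ` ({..m} - {i})"
    using assms by (intro joined_notin[of s _ _ E]) (auto simp: cluster_def card_image_atMost_minus)
  moreover have "y \<noteq> a i" using assms(1) by (simp add: cluster_def)
  ultimately show ?thesis by auto
qed

lemma cluster_disjoint:
  "i \<le> m \<Longrightarrow> i' \<le> m \<Longrightarrow> i \<noteq> i' \<Longrightarrow> cluster s m E a i \<inter> cluster s m E a i' = {}"
  by (auto simp: cluster_def)

lemma cluster_cong:
  assumes "\<And>j. j \<le> m \<Longrightarrow> a j = a' j" "i \<le> m"
  shows "cluster s m E a i = cluster s m E a' i"
proof -
  have "a ` ({..m} - {j}) = a' ` ({..m} - {j})" for j using assms(1) by (intro image_cong) auto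
  then show ?thesis using assms by (simp add: cluster_def)
qed

lemma covered_cong:
  assumes "\<And>j. j \<le> m \<Longrightarrow> a j = a' j"
  shows "covered s m U E a Y = covered s m U E a' Y"
proof -
  have "a ` J = a' ` J" if "J \<subseteq> {..m}" for J using assms that by (intro image_cong) auto
  from this[of "{..m}"] this[of "{3..m}"] show ?thesis by (simp add: covered_def)
qed

lemma sat_cluster_fm:
  assumes "inj_on v {..m}"
  shows "sat H v (cluster_fm s m i y) \<longleftrightarrow> v y \<in> cluster s m (snd H) v i"
proof -
  have "sat H v (joined_fm s y (others m j)) \<longleftrightarrow> joined s (snd H) (v y) (v ` ({..m} - {j}))" for j
    using assms by (subst sat_joined_fm) (auto intro: inj_on_subset)
  then show ?thesis by (auto simp: cluster_fm_def cluster_def)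
qed

lemma sat_linked_fm:
  assumes "inj_on v {..m}" "p \<notin> v ` {..m}" "y \<notin> v ` {..m}" "y \<noteq> p"
  shows "sat (U, E) (v(m + 2 := p, m + 3 := y)) (linked_fm s m) \<longleftrightarrow>
    linked s U E (insert y (v ` {3..m})) p"
proof -
  define xs where "xs = (m + 2) # (m + 3) # [3..<Suc m]"
  define w where "w u = v(m + 2 := p, m + 3 := y, m + 4 := u)" for u
  have w: "w u j = v j" if "j \<in> {3..m}" for u j using that by (auto simp: w_def)
  have image: "w u ` {3..m} = v ` {3..m}" for u by (intro image_cong refl w)
  have set_xs: "set xs = insert (m + 2) (insert (m + 3) {3..m})" by (auto simp: xs_def)
  have "inj_on v {3..m}" by (rule inj_on_subset[OF assms(1)]) auto
  then have "inj_on (w u) {3..m}" for u using w by (simp add: inj_on_def)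
  moreover have "v ` {3..m} \<subseteq> v ` {..m}" by auto
  ultimately have "inj_on (w u) (set xs)" for u
    unfolding set_xs using assms(2-4) image by (auto simp: w_def)
  moreover have "w u ` set xs = insert p (insert y (v ` {3..m}))" for u
    unfolding set_xs image_insert image by (simp add: w_def)
  moreover have "distinct xs" by (auto simp: xs_def)
  ultimately have "sat (U, E) (w u) (joined_fm s (m + 4) xs) \<longleftrightarrow>
      joined s E u (insert p (insert y (v ` {3..m})))" for u
    by (subst sat_joined_fm) (auto simp: w_def)
  then show ?thesis
    unfolding linked_fm_def linked_def xs_def[symmetric] sat.simps fst_conv w_def[symmetric] by simp
qed

lemma sat_covered_fm:
  assumes v: "inj_on v {..m}" and b: "v (m + 1) \<in> cluster s m E v 0" and i: "i \<le> m"
    and "s - 1 \<le> m" "s \<ge> 2" "\<forall>e\<in>E. card e = s"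
  shows "sat (U, E) v (covered_fm s m i) \<longleftrightarrow>
    covered s m U E v (insert (v (m + 1)) (cluster s m E v i))"
proof -
  let ?w = "\<lambda>p y. v(m + 2 := p, m + 3 := y)" and ?Y = "insert (v (m + 1)) (cluster s m E v i)"
  have cluster: "sat (U, E) (?w p y) (cluster_fm s m i (m + 3)) \<longleftrightarrow> y \<in> cluster s m E v i" for p y
  proof -
    have "inj_on (?w p y) {..m}" using v by (auto simp: inj_on_def)
    moreover have "cluster s m E (?w p y) i = cluster s m E v i"
      using i by (intro cluster_cong) auto
    ultimately show ?thesis by (subst sat_cluster_fm) auto
  qed
  have "y \<notin> v ` {..m}" if "y \<in> ?Y" for y
    using that cluster_notin[OF b v le0 assms(4-6)] cluster_notin[OF _ v i assms(4-6)]
    by (metis insertE)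
  then have link: "y \<noteq> p \<and> sat (U, E) (?w p y) (linked_fm s m) \<longleftrightarrow>
      y \<noteq> p \<and> linked s U E (insert y (v ` {3..m})) p"
    if "p \<notin> v ` {..m}" "y \<in> ?Y" for p y
    using sat_linked_fm[OF v that(1), of y U E s] that(2) by blast
  have "sat (U, E) v (covered_fm s m i) \<longleftrightarrow> (\<exists>p\<in>U - v ` {..m}. \<forall>y\<in>U \<inter> ?Y.
      y \<noteq> p \<and> sat (U, E) (?w p y) (linked_fm s m))"
    using cluster
    by (auto simp: covered_fm_def atLeast0LessThan lessThan_Suc_atMost simp del: upt_Suc)
  also have "\<dots> \<longleftrightarrow> covered s m U E v ?Y"
    unfolding covered_def using link by (intro bex_cong refl ball_cong) auto
  finally show ?thesis .
qed

lemma models_uncoverable_fm: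
  assumes "s - 1 \<le> m" "s \<ge> 2" "\<forall>e\<in>E. card e = s" "U \<noteq> {}"
  shows "models (U, E) (uncoverable_fm s m) \<longleftrightarrow> uncoverable s m U E"
proof -
  define \<mu> where "\<mu> = conjs (map (\<lambda>i. notin_fm i (others m i)) [0..<Suc m] @
      cluster_fm s m 0 (m + 1) # map (\<lambda>i. Neg (covered_fm s m i)) [0..<Suc m])"
  have \<mu>: "sat (U, E) w \<mu> \<longleftrightarrow> inj_on w {..m} \<and> w (m + 1) \<in> cluster s m E w 0 \<and>
      (\<forall>i\<le>m. \<not> covered s m U E w (insert (w (m + 1)) (cluster s m E w i)))" for w
  proof -
    have "sat (U, E) w \<mu> \<longleftrightarrow> inj_on w {..m} \<and> sat (U, E) w (cluster_fm s m 0 (m + 1)) \<and>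
        (\<forall>i\<le>m. \<not> sat (U, E) w (covered_fm s m i))"
      by (auto simp: \<mu>_def ball_Un inj_on_def less_Suc_eq_le simp del: upt_Suc)
    then show ?thesis
      using sat_cluster_fm[of w m "(U, E)" s 0 "m + 1"] sat_covered_fm[OF _ _ _ assms(1-3), of w]
      by auto
  qed
  have sat: "sat (U, E) v (uncoverable_fm s m) \<longleftrightarrow> uncoverable s m U E" for v
  proof
    assume "sat (U, E) v (uncoverable_fm s m)"
    then obtain w where "\<forall>x\<in>{0..<m + 2}. w x \<in> U" "sat (U, E) w \<mu>"
      unfolding uncoverable_fm_def sat_foldr_Exists fst_conv set_upt \<mu>_def by blast
    then show "uncoverable s m U E"
      unfolding uncoverable_def \<mu> by (intro exI[of _ w] exI[of _ "w (m + 1)"]) auto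
  next
    assume "uncoverable s m U E"
    then obtain a b where a: "inj_on a {..m}" "a ` {..m} \<subseteq> U" and b: "b \<in> U \<inter> cluster s m E a 0"
      and uncovered: "\<forall>i\<le>m. \<not> covered s m U E a (insert b (cluster s m E a i))"
      unfolding uncoverable_def by blast
    define w where "w x = (if x \<le> m then a x else if x = m + 1 then b else v x)" for x
    have w: "w j = a j" if "j \<le> m" for j using that by (simp add: w_def)
    have "inj_on w {..m}" using a(1) by (auto simp: inj_on_def w)
    moreover have "w (m + 1) = b" by (simp add: w_def)
    ultimately have "sat (U, E) w \<mu>"
      unfolding \<mu> using b uncovered cluster_cong[of m w a] covered_cong[of m w a] w by auto
    moreover have "\<forall>x\<in>set [0..<m + 2]. w x \<in> U" "\<forall>x. x \<notin> set [0..<m + 2] \<longrightarrow> w x = v x"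
      using a(2) b by (auto simp: w_def image_subset_iff)
    ultimately show "sat (U, E) v (uncoverable_fm s m)"
      unfolding uncoverable_fm_def sat_foldr_Exists fst_conv \<mu>_def by blast
  qed
  obtain x where "x \<in> U" using assms(4) by blast
  then have "range (\<lambda>_. x) \<subseteq> fst (U, E)" by auto
  then show ?thesis unfolding models_def sat by blast
qed

lemma has_arity_uncoverable_fm:
  assumes "s \<ge> 1"
  shows "has_arity s (uncoverable_fm s m)"
proof -
  have joined: "has_arity s (joined_fm s u xs)" for u xs
    using assms by (auto simp: joined_fm_def)
  have notin: "has_arity s (notin_fm x ys)" for x ys
    by (auto simp: notin_fm_def)
  have cluster: "has_arity s (cluster_fm s m i y)" for i y
    by (auto simp: cluster_fm_def joined)
  have "has_arity s (covered_fm s m i)" for i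
    by (simp add: covered_fm_def linked_fm_def cluster joined notin)
  then show ?thesis
    by (auto simp: uncoverable_fm_def cluster notin)
qed

lemma free_vars_joined_fm: "free_vars (joined_fm s u xs) \<subseteq> insert 0 (insert u (set xs))"
  using subseqs_powset[of xs] by (auto simp: joined_fm_def)

lemma free_vars_cluster_fm:
  assumes "i \<le> m"
  shows "free_vars (cluster_fm s m i y) \<subseteq> insert y {..m}"
proof -
  have "free_vars (joined_fm s y (others m j)) \<subseteq> insert y {..m}" for j
    using free_vars_joined_fm[of s y "others m j"] by auto
  then show ?thesis using assms by (fastforce simp: cluster_fm_def)
qed

lemma free_vars_covered_fm:
  assumes "i \<le> m"
  shows "free_vars (covered_fm s m i) \<subseteq> {..m + 1}"
proof -
  have "free_vars (linked_fm s m) \<subseteq> {..m + 3}"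
    using free_vars_joined_fm[of s "m + 4" "(m + 2) # (m + 3) # [3..<Suc m]"]
    by (fastforce simp: linked_fm_def simp del: upt_Suc)
  then show ?thesis
    using free_vars_cluster_fm[OF assms, of s "m + 3"]
    by (fastforce simp: covered_fm_def notin_fm_def simp del: upt_Suc)
qed

lemma free_vars_uncoverable_fm: "free_vars (uncoverable_fm s m) = {}"
proof -
  have "free_vars (cluster_fm s m 0 (m + 1)) \<subseteq> {0..<m + 2}"
    using free_vars_cluster_fm[of 0 m s "m + 1"] by auto
  moreover have "free_vars (covered_fm s m i) \<subseteq> {0..<m + 2}" if "i \<in> {0..<Suc m}" for i
    using free_vars_covered_fm[of i m s] that by auto
  moreover have "free_vars (notin_fm i (others m i)) \<subseteq> {0..<m + 2}" if "i \<in> {0..<Suc m}" for i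
    using that by (auto simp: notin_fm_def)
  ultimately show ?thesis
    unfolding uncoverable_fm_def free_vars_foldr_Exists free_vars_conjs Diff_eq_empty_iff
    by (simp add: UN_subset_iff del: upt_Suc)
qed

lemma quantifier_depth_uncoverable_fm: "quantifier_depth (uncoverable_fm s m) \<le> m + 5"
proof -
  have joined: "quantifier_depth (joined_fm s u xs) = 0" for u xs
    by (auto simp: joined_fm_def)
  have notin: "quantifier_depth (notin_fm x ys) = 0" for x ys
    by (auto simp: notin_fm_def)
  have cluster: "quantifier_depth (cluster_fm s m i y) = 0" for i y
    by (auto simp: cluster_fm_def joined)
  have "quantifier_depth (covered_fm s m i) = 3" for i
    by (simp add: covered_fm_def linked_fm_def cluster joined notin del: upt_Suc)
  then have "quantifier_depth (uncoverable_fm s m) \<le> (m + 2) + 3"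
    unfolding uncoverable_fm_def quantifier_depth_foldr_Exists
    by (intro add_mono) (auto simp: quantifier_depth_conjs_le cluster notin simp del: upt_Suc)
  then show ?thesis by simp
qed

lemma uncoverable_fm_in_fo_properties:
  assumes "s \<ge> 1" "k \<ge> m + 5"
  shows "{H. models H (uncoverable_fm s m)} \<in> fo_properties s k"
  using has_arity_uncoverable_fm[OF assms(1)] free_vars_uncoverable_fm
    order_trans[OF quantifier_depth_uncoverable_fm assms(2)]
  unfolding fo_properties_def by blast

section \<open>The critical pattern\<close>

lemma star_within: "{e \<in> star s u B. e \<subseteq> J} = (if u \<in> J then star s u (B \<inter> J) else {})"
  by (auto simp: star_def)

lemma card_UN_star:
  assumes "finite X" "inj_on c X" "\<And>x. x \<in> X \<Longrightarrow> finite (B x)"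
    and c: "\<And>x y. x \<in> X \<Longrightarrow> y \<in> X \<Longrightarrow> c x \<notin> B y"
  shows "card (\<Union>x\<in>X. star s (c x) (B x)) = (\<Sum>x\<in>X. card (B x) choose (s - 1))"
proof -
  have "star s (c x) (B x) \<inter> star s (c y) (B y) = {}" if "x \<in> X" "y \<in> X" "x \<noteq> y" for x y
  proof (intro equals0I)
    fix e assume "e \<in> star s (c x) (B x) \<inter> star s (c y) (B y)"
    then have "c x \<in> e" "e \<subseteq> insert (c y) (B y)"
      using mem_star[of e s "c x"] star_subset_Pow[of s "c y" "B y"] by auto
    then have "c x \<in> insert (c y) (B y)" by blast
    then show False using c that assms(2) by (auto simp: inj_on_def)
  qed
  then have "card (\<Union>x\<in>X. star s (c x) (B x)) = (\<Sum>x\<in>X. card (star s (c x) (B x)))"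
    using assms(1,3) by (intro card_UN_disjoint) (auto simp: finite_star)
  also have "\<dots> = (\<Sum>x\<in>X. card (B x) choose (s - 1))"
    using assms(3) c by (intro sum.cong card_star) auto
  finally show ?thesis .
qed

definition cluster_size :: "nat \<Rightarrow> nat \<Rightarrow> nat" where
  "cluster_size d i = (if i = 0 then d + 1 else d)"

definition cluster_index :: "nat \<Rightarrow> nat \<Rightarrow> (nat \<times> nat) set" where
  "cluster_index m d = (SIGMA i:{..m}. {..<cluster_size d i})"

definition pattern_vertices :: "nat \<Rightarrow> nat \<Rightarrow> (nat + nat \<times> nat) set" where
  "pattern_vertices m d = Inl ` {..m} \<union> Inr ` cluster_index m d"

definition pattern_edges :: "nat \<Rightarrow> nat \<Rightarrow> nat \<Rightarrow> (nat + nat \<times> nat) set set" where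
  "pattern_edges s m d = (\<Union>x\<in>cluster_index m d. star s (Inr x) (Inl ` ({..m} - {fst x})))"

lemma finite_cluster_index [simp]: "finite (cluster_index m d)"
  by (simp add: cluster_index_def)

lemma card_cluster_index: "card (cluster_index m d) = (m + 1) * d + 1"
proof -
  have "card (cluster_index m d) = (\<Sum>i\<in>{..m}. d + (if i = 0 then 1 else 0))"
    unfolding cluster_index_def cluster_size_def by (subst card_SigmaI) (auto intro: sum.cong)
  also have "\<dots> = (m + 1) * d + 1"
    by (subst sum.distrib) simp
  finally show ?thesis .
qed

lemma finite_pattern_vertices: "finite (pattern_vertices m d)"
  by (simp add: pattern_vertices_def)

lemma card_subset_pattern_vertices:
  assumes "J \<subseteq> pattern_vertices m d"
  shows "card J = card {k. Inl k \<in> J} + card {x. Inr x \<in> J}"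
proof -
  have "J = Inl ` {k. Inl k \<in> J} \<union> Inr ` {x. Inr x \<in> J}"
    using assms by (auto simp: pattern_vertices_def)
  moreover have "{k. Inl k \<in> J} \<subseteq> {..m}" "{x. Inr x \<in> J} \<subseteq> cluster_index m d"
    using assms by (auto simp: pattern_vertices_def)
  then have "finite {k. Inl k \<in> J}" "finite {x. Inr x \<in> J}"
    by (meson finite_atMost finite_subset, meson finite_cluster_index finite_subset)
  then have "card (Inl ` {k. Inl k \<in> J} \<union> Inr ` {x. Inr x \<in> J}) =
      card {k. Inl k \<in> J} + card {x. Inr x \<in> J}"
    by (subst card_Un_disjoint) (auto simp: card_image)
  ultimately show ?thesis by simp
qed

lemma card_pattern_vertices: "card (pattern_vertices m d) = (m + 1) + ((m + 1) * d + 1)"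
proof -
  have "{k. Inl k \<in> pattern_vertices m d} = {..m}"
    "{x. Inr x \<in> pattern_vertices m d} = cluster_index m d"
    by (auto simp: pattern_vertices_def)
  then show ?thesis
    using card_subset_pattern_vertices[OF subset_refl, of m d] by (simp add: card_cluster_index)
qed

lemma card_pattern_edges_within:
  assumes "J \<subseteq> pattern_vertices m d"
  shows "card {e \<in> pattern_edges s m d. e \<subseteq> J} =
    (\<Sum>x\<in>{x. Inr x \<in> J}. card ({k. Inl k \<in> J} - {fst x}) choose (s - 1))"
proof -
  let ?X = "{x. Inr x \<in> J}" and ?A = "{k. Inl k \<in> J}"
  have X: "?X \<subseteq> cluster_index m d" and A: "?A \<subseteq> {..m}"
    using assms by (auto simp: pattern_vertices_def)
  have "Inl ` ({..m} - {i}) \<inter> J = Inl ` (?A - {i})" for i using A by auto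
  then have "{e \<in> star s (Inr x) (Inl ` ({..m} - {fst x})). e \<subseteq> J} =
      (if x \<in> ?X then star s (Inr x) (Inl ` (?A - {fst x})) else {})" for x
    by (simp add: star_within)
  moreover have "{e \<in> pattern_edges s m d. e \<subseteq> J} =
      (\<Union>x\<in>cluster_index m d. {e \<in> star s (Inr x) (Inl ` ({..m} - {fst x})). e \<subseteq> J})"
    by (auto simp: pattern_edges_def)
  ultimately have "{e \<in> pattern_edges s m d. e \<subseteq> J} =
      (\<Union>x\<in>?X. star s (Inr x) (Inl ` (?A - {fst x})))"
    using X by auto
  moreover have "finite ?X" "finite ?A"
    using X A by (meson finite_cluster_index finite_subset, meson finite_atMost finite_subset)
  ultimately have "card {e \<in> pattern_edges s m d. e \<subseteq> J} =
      (\<Sum>x\<in>?X. card (Inl ` (?A - {fst x}) :: (nat + nat \<times> nat) set) choose (s - 1))"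
    by (simp only:) (rule card_UN_star, auto)
  then show ?thesis by (simp add: card_image)
qed

lemma pattern_edges_subset: "e \<in> pattern_edges s m d \<Longrightarrow> e \<subseteq> pattern_vertices m d"
  by (auto simp: pattern_edges_def pattern_vertices_def star_def)

lemma uniform_pattern_pattern_edges:
  assumes "s \<ge> 1"
  shows "uniform_pattern s (pattern_vertices m d) (pattern_edges s m d)"
proof
  fix e assume "e \<in> pattern_edges s m d"
  then obtain x where "e \<in> star s (Inr x) (Inl ` ({..m} - {fst x}))"
    by (auto simp: pattern_edges_def)
  then show "card e = s" using assms by (intro card_mem_star) auto
qed (auto simp: finite_pattern_vertices dest: pattern_edges_subset)

lemma card_pattern_edges: "card (pattern_edges s m d) = ((m + 1) * d + 1) * (m choose (s - 1))"
proof -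
  have "{e \<in> pattern_edges s m d. e \<subseteq> pattern_vertices m d} = pattern_edges s m d"
    using pattern_edges_subset by blast
  moreover have "{k. Inl k \<in> pattern_vertices m d} = {..m}"
    "{x. Inr x \<in> pattern_vertices m d} = cluster_index m d"
    by (auto simp: pattern_vertices_def)
  ultimately have "card (pattern_edges s m d) =
      (\<Sum>x\<in>cluster_index m d. card ({..m} - {fst x}) choose (s - 1))"
    using card_pattern_edges_within[OF subset_refl, of s m d] by simp
  also have "\<dots> = (\<Sum>x\<in>cluster_index m d. m choose (s - 1))"
    by (intro sum.cong) (auto simp: cluster_index_def)
  finally show ?thesis by (simp add: card_cluster_index)
qed

lemma image_pattern_edges:
  assumes "inj_on \<phi> (pattern_vertices m d)"
  shows "(`) \<phi> ` pattern_edges s m d =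
    (\<Union>x\<in>cluster_index m d. star s (\<phi> (Inr x)) ((\<phi> \<circ> Inl) ` ({..m} - {fst x})))"
proof -
  have "(`) \<phi> ` star s (Inr x) (Inl ` ({..m} - {fst x})) =
      star s (\<phi> (Inr x)) ((\<phi> \<circ> Inl) ` ({..m} - {fst x}))"
    for x :: "nat \<times> nat"
  proof -
    have "inj_on \<phi> (Inl ` ({..m} - {fst x}))"
      using assms by (rule inj_on_subset) (auto simp: pattern_vertices_def)
    then show ?thesis by (simp add: image_star image_comp)
  qed
  then show ?thesis by (simp add: pattern_edges_def image_UN)
qed

lemma pattern_swap_automorphism:
  fixes m d :: nat
  assumes "d \<ge> 1"
  defines "\<sigma> \<equiv> Transposition.transpose (Inr (0, 0)) (Inr (0, 1) :: nat + nat \<times> nat)"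
  shows "bij_betw \<sigma> (pattern_vertices m d) (pattern_vertices m d)"
    and "(`) ((`) \<sigma>) (pattern_edges s m d) \<subseteq> pattern_edges s m d"
proof -
  have index: "(0, 0) \<in> cluster_index m d" "(0, 1) \<in> cluster_index m d"
    using assms(1) by (auto simp: cluster_index_def cluster_size_def)
  then have "Inr (0, 0) \<in> pattern_vertices m d" "Inr (0, 1) \<in> pattern_vertices m d"
    by (auto simp: pattern_vertices_def)
  then show "bij_betw \<sigma> (pattern_vertices m d) (pattern_vertices m d)"
    unfolding \<sigma>_def bij_betw_def by simp
  have "(`) \<sigma> ` star s (Inr x) (Inl ` ({..m} - {fst x})) \<subseteq> pattern_edges s m d"
    if x: "x \<in> cluster_index m d" for x
  proof -
    have "\<sigma> ` Inl ` ({..m} - {fst x}) = Inl ` ({..m} - {fst x})"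
      by (force simp: \<sigma>_def Transposition.transpose_def)
    then have "(`) \<sigma> ` star s (Inr x) (Inl ` ({..m} - {fst x})) =
        star s (\<sigma> (Inr x)) (Inl ` ({..m} - {fst x}))"
      by (simp add: image_star \<sigma>_def)
    moreover define y where "y = Transposition.transpose (0, 0) (0, 1) x"
    have "\<sigma> (Inr x) = Inr y" "fst y = fst x" "y \<in> cluster_index m d"
      using x index by (auto simp: \<sigma>_def y_def Transposition.transpose_def)
    ultimately have "(`) \<sigma> ` star s (Inr x) (Inl ` ({..m} - {fst x})) =
        star s (Inr y) (Inl ` ({..m} - {fst y}))"
      by simp
    then show ?thesis unfolding pattern_edges_def using \<open>y \<in> cluster_index m d\<close> by blast
  qed
  then show "(`) ((`) \<sigma>) (pattern_edges s m d) \<subseteq> pattern_edges s m d"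
    unfolding pattern_edges_def[of s m d] image_UN by (simp add: UN_least pattern_edges_def)
qed

definition excess :: "nat \<Rightarrow> nat \<Rightarrow> real" where
  "excess m d = real (m + 1) / real (card (cluster_index m d))"

text \<open>At this exponent the expected number of copies of the pattern tends to \<open>1\<close>.\<close>

definition critical_exponent :: "nat \<Rightarrow> nat \<Rightarrow> nat \<Rightarrow> real" where
  "critical_exponent s m d = (1 + excess m d) / real (m choose (s - 1))"

lemma card_cluster_index_pos: "0 < real (card (cluster_index m d))"
  unfolding of_nat_0_less_iff card_cluster_index by simp

lemma excess_pos: "excess m d > 0"
  unfolding excess_def by (intro divide_pos_pos card_cluster_index_pos) simp

lemma excess_times_card_cluster_index: "excess m d * card (cluster_index m d) = real (m + 1)"
  unfolding excess_def
  by (rule nonzero_eq_divide_eq[THEN iffD1, OF less_imp_neq[OF card_cluster_index_pos, symmetric] refl])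

locale critical_parameters =
  fixes s m d :: nat
  assumes s_ge_2: "s \<ge> 2" and m_ge: "m \<ge> s + 1" and d_ge: "d \<ge> (m - 1) choose (s - 1)"
begin

abbreviation "\<alpha> \<equiv> critical_exponent s m d"
abbreviation "\<epsilon> \<equiv> excess m d"
abbreviation "\<beta> \<equiv> (m - 1) choose (s - 1)"
abbreviation "\<gamma> \<equiv> (m - 1) choose (s - 2)"
abbreviation "V \<equiv> pattern_vertices m d"
abbreviation "F \<equiv> pattern_edges s m d"

sublocale uniform_pattern s V F
  using s_ge_2 by (intro uniform_pattern_pattern_edges) simp

lemma choose_pos: "0 < \<beta>" "0 < \<gamma>"
  using m_ge by auto

lemma choose_eq_add: "m choose (s - 1) = \<beta> + \<gamma>"
  using choose_reduce_nat[of m "s - 1"] s_ge_2 m_ge by (simp add: numeral_2_eq_2)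

lemma choose_sum_pos: "0 < real (\<beta> + \<gamma>)"
  unfolding of_nat_0_less_iff using choose_pos(1) by (rule trans_less_add1)

lemma d_ge_1: "d \<ge> 1"
  using choose_pos(1) d_ge by linarith

lemma critical_exponent_times_choose: "\<alpha> * real (\<beta> + \<gamma>) = 1 + \<epsilon>"
  unfolding critical_exponent_def choose_eq_add
  by (rule nonzero_eq_divide_eq[THEN iffD1, OF less_imp_neq[OF choose_sum_pos, symmetric] refl])

lemma critical_exponent_pos: "\<alpha> > 0"
  unfolding critical_exponent_def choose_eq_add
  by (intro divide_pos_pos choose_sum_pos add_pos_pos excess_pos) simp

lemma critical_exponent_times_edges: "\<alpha> * card F = card V"
proof -
  have "\<alpha> * card F = (\<alpha> * real (\<beta> + \<gamma>)) * card (cluster_index m d)"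
    unfolding card_pattern_edges choose_eq_add card_cluster_index of_nat_mult
    by (simp only: mult_ac)
  also have "\<dots> = card (cluster_index m d) + real (m + 1)"
    unfolding critical_exponent_times_choose distrib_right excess_times_card_cluster_index by simp
  finally show ?thesis by (simp add: card_pattern_vertices card_cluster_index)
qed

lemma d_times_excess_less_1: "d * \<epsilon> < 1"
proof -
  have "real (d * (m + 1)) < real (card (cluster_index m d))"
    unfolding of_nat_less_iff card_cluster_index by simp
  then show ?thesis
    unfolding excess_def times_divide_eq_right of_nat_mult[symmetric]
    using card_cluster_index_pos by (simp only: divide_less_eq_1_pos)
qed

lemma Suc_d_times_excess_greater_1: "1 < real (d + 1) * \<epsilon>"
proof -
  have "real (card (cluster_index m d)) < real ((d + 1) * (m + 1))"
    unfolding of_nat_less_iff card_cluster_index using m_ge by simp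
  then show ?thesis
    unfolding excess_def times_divide_eq_right of_nat_mult[symmetric]
    using card_cluster_index_pos by (simp only: less_divide_eq_1_pos)
qed

lemma excess_less_1: "\<epsilon> < 1"
proof -
  have "1 * \<epsilon> \<le> d * \<epsilon>" using d_ge_1 excess_pos[of m d] by (intro mult_right_mono) auto
  then show ?thesis using d_times_excess_less_1 by simp
qed

lemma critical_exponent_times_lower_choose: "\<alpha> * \<beta> < 1"
proof -
  have "\<beta> * \<epsilon> \<le> d * \<epsilon>" using d_ge excess_pos[of m d] by (intro mult_right_mono) auto
  also have "\<dots> < \<gamma>" using d_times_excess_less_1 choose_pos(2) by linarith
  finally have "(1 + \<epsilon>) * \<beta> < real (\<beta> + \<gamma>)" by (simp add: algebra_simps)
  then have "(\<alpha> * \<beta>) * real (\<beta> + \<gamma>) < 1 * real (\<beta> + \<gamma>)"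
    unfolding critical_exponent_times_choose[symmetric] by (simp add: mult_ac)
  then show ?thesis using choose_pos(1) by (simp only: mult_less_cancel_right_pos)
qed

lemma critical_exponent_less_1: "\<alpha> < 1"
proof -
  have "2 \<le> \<beta> + \<gamma>" using choose_pos by linarith
  then have "real 2 \<le> real (\<beta> + \<gamma>)" by (rule of_nat_mono)
  then have "\<alpha> * real 2 \<le> \<alpha> * real (\<beta> + \<gamma>)"
    using critical_exponent_pos by (intro mult_left_mono) auto
  then show ?thesis unfolding critical_exponent_times_choose using excess_less_1 by simp
qed

lemma excess_times_full_vertices_le:
  assumes X: "X \<subseteq> cluster_index m d" and A: "A \<subseteq> {..m}"
  shows "\<epsilon> * card {x \<in> X. card (A - {fst x}) = m} \<le> card A"
proof -
  define full where "full = {x \<in> X. card (A - {fst x}) = m}"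
  have finA: "finite A" using A finite_subset by blast
  show ?thesis
  proof (cases "A = {..m} \<or> full = {}")
    case True
    moreover have "\<epsilon> * card full \<le> \<epsilon> * card (cluster_index m d)"
      using X excess_pos[of m d]
      by (intro mult_left_mono of_nat_mono card_mono) (auto simp: full_def)
    ultimately show ?thesis
      unfolding excess_times_card_cluster_index full_def[symmetric] by auto
  next
    case False
    then have "card A < card {..m}" using A by (intro psubset_card_mono) auto
    moreover obtain x\<^sub>0 where "x\<^sub>0 \<in> full" using False by blast
    then have "card (A - {fst x\<^sub>0}) = m" by (simp add: full_def)
    then have "m \<le> card A" using finA card_Diff1_le[of A "fst x\<^sub>0"] by simp
    ultimately have cardA: "card A = m" by simp
    then have "card ({..m} - A) = 1" using A finA by (simp add: card_Diff_subset)
    then obtain i\<^sub>0 where i\<^sub>0: "{..m} - A = {i\<^sub>0}" by (rule card_1_singletonE)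
    have "full \<subseteq> {i\<^sub>0} \<times> {..<d + 1}"
    proof
      fix x assume x: "x \<in> full"
      then have "fst x \<notin> A" using cardA finA m_ge by (auto simp: full_def)
      moreover have "fst x \<in> {..m}" "snd x < d + 1"
        using x X by (auto simp: full_def cluster_index_def cluster_size_def split: if_splits)
      ultimately have "fst x \<in> {..m} - A" by blast
      then show "x \<in> {i\<^sub>0} \<times> {..<d + 1}" using \<open>snd x < d + 1\<close> unfolding i\<^sub>0 by (cases x) auto
    qed
    then have "card full \<le> d + 1" using card_mono[of "{i\<^sub>0} \<times> {..<d + 1}" full] by simp
    then have "\<epsilon> * card full \<le> \<epsilon> * real (d + 1)"
      using excess_pos[of m d] by (intro mult_left_mono of_nat_mono) auto
    also have "\<dots> \<le> 2" using d_times_excess_less_1 excess_less_1 by (simp add: algebra_simps)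
    also have "\<dots> \<le> card A" using cardA m_ge s_ge_2 by simp
    finally show ?thesis unfolding full_def .
  qed
qed

lemma balanced_critical_exponent: "balanced \<alpha>"
  unfolding balanced_def
proof (intro allI impI)
  fix J assume J: "J \<subseteq> V"
  define A X where "A = {k. Inl k \<in> J}" and "X = {x. Inr x \<in> J}"
  have A: "A \<subseteq> {..m}" and X: "X \<subseteq> cluster_index m d"
    using J by (auto simp: pattern_vertices_def A_def X_def)
  then have finX: "finite X" by (meson finite_cluster_index finite_subset)
  have degree: "\<alpha> * real (card (A - {i}) choose (s - 1)) \<le>
      1 + (if card (A - {i}) = m then \<epsilon> else 0)"
    if "i \<le> m" for i
  proof (cases "card (A - {i}) = m")
    case True
    then show ?thesis
      using critical_exponent_times_choose unfolding choose_eq_add[symmetric] by simp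
  next
    case False
    have "card (A - {i}) \<le> card ({..m} - {i})" using A by (intro card_mono) auto
    then have "card (A - {i}) choose (s - 1) \<le> \<beta>"
      using False that by (intro binomial_right_mono) simp
    then have "\<alpha> * real (card (A - {i}) choose (s - 1)) \<le> \<alpha> * \<beta>"
      using critical_exponent_pos by simp
    then show ?thesis using critical_exponent_times_lower_choose False by simp
  qed
  have "\<alpha> * card {e \<in> F. e \<subseteq> J} = (\<Sum>x\<in>X. \<alpha> * real (card (A - {fst x}) choose (s - 1)))"
    unfolding card_pattern_edges_within[OF J] A_def[symmetric] X_def[symmetric]
      of_nat_sum sum_distrib_left
    by (intro sum.cong) auto
  also have "\<dots> \<le> (\<Sum>x\<in>X. 1 + (if card (A - {fst x}) = m then \<epsilon> else 0))"
  proof (rule sum_mono)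
    fix x assume "x \<in> X"
    then have "fst x \<le> m" using X by (auto simp: cluster_index_def)
    then show "\<alpha> * real (card (A - {fst x}) choose (s - 1)) \<le>
        1 + (if card (A - {fst x}) = m then \<epsilon> else 0)"
      by (rule degree)
  qed
  also have "\<dots> = card X + \<epsilon> * card {x \<in> X. card (A - {fst x}) = m}"
    using finX by (simp add: sum.distrib sum.If_cases Int_def)
  also have "\<dots> \<le> card X + card A"
    using excess_times_full_vertices_le[OF X A] by simp
  also have "\<dots> = card J"
    using card_subset_pattern_vertices[OF J] by (simp add: A_def X_def)
  finally show "\<alpha> * card {e \<in> F. e \<subseteq> J} \<le> card J" .
qed

end

section \<open>Uncoverability and copies of the pattern\<close>

lemma card_image_atLeast3_atMost: "inj_on a {..m} \<Longrightarrow> card (a ` {3..m}) = m - 2" for a :: "nat \<Rightarrow> 'a"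
  using inj_on_subset[of a "{..m}" "{3..m}"] by (simp add: card_image)

lemma covered_if_extendable:
  assumes "extendable s (m - 1) d (m + 1 + d) U E" "m \<ge> 2"
    and a: "inj_on a {..m}" "a ` {..m} \<subseteq> U" and Y: "finite Y" "Y \<subseteq> U - a ` {..m}" "card Y \<le> d"
  shows "covered s m U E a Y"
proof -
  define Z where "Z = a ` {..m} \<union> Y"
  define \<A> where "\<A> = (\<lambda>y. insert y (a ` {3..m})) ` Y"
  have core: "a ` {3..m} \<subseteq> a ` {..m}" by auto
  have "card Z \<le> m + 1 + d"
    using card_Un_le[of "a ` {..m}" Y] card_image_le[of "{..m}" a] Y(3) by (simp add: Z_def)
  moreover have "\<A> \<subseteq> {A. A \<subseteq> Z \<and> card A = m - 1}"
  proof
    fix A assume "A \<in> \<A>"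
    then obtain y where y: "y \<in> Y" "A = insert y (a ` {3..m})" by (auto simp: \<A>_def)
    then have "y \<notin> a ` {3..m}" using Y(2) core by blast
    then have "card A = m - 1" using y(2) card_image_atLeast3_atMost[OF a(1)] \<open>m \<ge> 2\<close> by simp
    moreover have "A \<subseteq> Z" using y core by (auto simp: Z_def)
    ultimately show "A \<in> {A. A \<subseteq> Z \<and> card A = m - 1}" by simp
  qed
  moreover have "card \<A> \<le> d"
    unfolding \<A>_def by (rule order_trans[OF card_image_le[OF Y(1)] Y(3)])
  moreover have "Z \<subseteq> U" using a(2) Y(2) by (auto simp: Z_def)
  ultimately have "(Z, \<A>) \<in> link_requests U (m - 1) d (m + 1 + d)"
    by (simp add: link_requests_def)
  then obtain p where "p \<in> U - Z" "\<forall>A\<in>\<A>. linked s U E A p"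
    using assms(1) unfolding extendable_def by blast
  then show ?thesis
    unfolding covered_def by (intro bexI[of _ p]) (auto simp: Z_def \<A>_def)
qed

lemma clusters_large_if_uncoverable:
  assumes "s \<ge> 2" "m \<ge> 2" "s - 1 \<le> m" "\<forall>e\<in>E. card e = s" and U: "finite U"
    and "uncoverable s m U E" "extendable s (m - 1) d (m + 1 + d) U E"
  obtains a where "inj_on a {..m}" "a ` {..m} \<subseteq> U"
    "\<And>i. i \<le> m \<Longrightarrow> cluster_size d i \<le> card (U \<inter> cluster s m E a i)"
proof -
  obtain a b where a: "inj_on a {..m}" "a ` {..m} \<subseteq> U" and b: "b \<in> U \<inter> cluster s m E a 0"
    and uncovered: "\<forall>i\<le>m. \<not> covered s m U E a (insert b (cluster s m E a i))"
    using assms(6) unfolding uncoverable_def by blast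
  define Y where "Y i = U \<inter> cluster s m E a i" for i
  have Y: "Y i \<subseteq> U - a ` {..m}" "finite (Y i)" if "i \<le> m" for i
    using cluster_notin[OF _ a(1) that assms(3,1,4)] U by (auto simp: Y_def)
  have large: "d + 1 \<le> card (insert b (Y i))" if i: "i \<le> m" for i
  proof (rule ccontr)
    assume "\<not> d + 1 \<le> card (insert b (Y i))"
    moreover have "b \<in> Y 0" using b by (simp add: Y_def)
    then have "b \<in> U - a ` {..m}" using Y(1)[of 0] by blast
    ultimately have "covered s m U E a (insert b (Y i))"
      using Y[OF i] by (intro covered_if_extendable[OF assms(7,2) a]) auto
    moreover have "U \<inter> insert b (Y i) = U \<inter> insert b (cluster s m E a i)" by (auto simp: Y_def)
    ultimately have "covered s m U E a (insert b (cluster s m E a i))" by (simp add: covered_def)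
    with uncovered i show False by blast
  qed
  have "cluster_size d i \<le> card (Y i)" if i: "i \<le> m" for i
  proof (cases "i = 0")
    case True
    then have "insert b (Y i) = Y i" using b by (auto simp: Y_def)
    then show ?thesis using large[OF i] True by (simp add: cluster_size_def)
  next
    case False
    have "card (insert b (Y i)) \<le> Suc (card (Y i))" by (rule card_insert_le_m1) auto
    then show ?thesis using large[OF i] False by (simp add: cluster_size_def)
  qed
  with a show thesis using that[of a] by (simp add: Y_def)
qed

lemma inj_on_case_sum:
  assumes "inj_on f A" "inj_on g B" "f ` A \<inter> g ` B = {}"
  shows "inj_on (case_sum f g) (Inl ` A \<union> Inr ` B)"
proof -
  have "inj_on (case_sum f g) (Inl ` A)" "inj_on (case_sum f g) (Inr ` B)"
    using assms(1,2) by (auto simp: inj_on_def)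
  moreover have "case_sum f g ` Inl ` A \<inter> case_sum f g ` Inr ` B = {}"
    using assms(3) by (simp add: image_image)
  ultimately show ?thesis by (auto simp: inj_on_Un)
qed

lemma copies_pattern_nonempty:
  assumes a: "inj_on a {..m}" "a ` {..m} \<subseteq> {1..n}"
    and h: "inj_on h (cluster_index m d)" "h ` cluster_index m d \<subseteq> {1..n}"
    and disjoint: "a ` {..m} \<inter> h ` cluster_index m d = {}"
    and joined: "\<And>x. x \<in> cluster_index m d \<Longrightarrow> joined s E (h x) (a ` ({..m} - {fst x}))"
  shows "copies (pattern_vertices m d) (pattern_edges s m d) n E \<noteq> {}"
proof -
  define \<phi> where "\<phi> = restrict (case_sum a h) (pattern_vertices m d)"
  have \<phi>: "\<phi> (Inl i) = a i" "\<phi> (Inr x) = h x" if "i \<le> m" "x \<in> cluster_index m d" for i x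
    using that by (auto simp: \<phi>_def pattern_vertices_def)
  have "inj_on (case_sum a h) (pattern_vertices m d)"
    unfolding pattern_vertices_def by (rule inj_on_case_sum[OF a(1) h(1) disjoint])
  then have inj: "inj_on \<phi> (pattern_vertices m d)" by (simp add: \<phi>_def)
  moreover have "\<phi> \<in> pattern_vertices m d \<rightarrow>\<^sub>E {1..n}"
    using a(2) h(2) by (auto simp: \<phi>_def pattern_vertices_def)
  moreover have "(`) \<phi> ` pattern_edges s m d \<subseteq> E"
    unfolding image_pattern_edges[OF inj]
  proof (rule UN_least)
    fix x assume x: "x \<in> cluster_index m d"
    then have "(\<phi> \<circ> Inl) ` ({..m} - {fst x}) = a ` ({..m} - {fst x})"
      using \<phi>(1) by (intro image_cong) auto
    then show "joined s E (\<phi> (Inr x)) ((\<phi> \<circ> Inl) ` ({..m} - {fst x}))"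
      using joined[OF x] \<phi>(2)[OF le0 x] by simp
  qed
  ultimately show ?thesis unfolding copies_def placements_def by blast
qed

lemma ex_cluster_enumeration:
  assumes "finite U" and large: "\<And>i. i \<le> m \<Longrightarrow> cluster_size d i \<le> card (U \<inter> cluster s m E a i)"
  obtains h where "inj_on h (cluster_index m d)"
    "\<And>x. x \<in> cluster_index m d \<Longrightarrow> h x \<in> U \<inter> cluster s m E a (fst x)"
proof -
  have "\<forall>i\<in>{..m}. \<exists>g. g ` {..<cluster_size d i} \<subseteq> U \<inter> cluster s m E a i \<and>
      inj_on g {..<cluster_size d i}"
  proof
    fix i assume "i \<in> {..m}"
    then show "\<exists>g. g ` {..<cluster_size d i} \<subseteq> U \<inter> cluster s m E a i \<and>
        inj_on g {..<cluster_size d i}"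
      using assms by (intro card_le_inj) auto
  qed
  then obtain g where g: "\<And>i. i \<le> m \<Longrightarrow> g i ` {..<cluster_size d i} \<subseteq> U \<inter> cluster s m E a i"
    "\<And>i. i \<le> m \<Longrightarrow> inj_on (g i) {..<cluster_size d i}"
    by (metis atMost_iff)
  define h where "h x = g (fst x) (snd x)" for x
  have index: "fst x \<le> m" "snd x \<in> {..<cluster_size d (fst x)}" if "x \<in> cluster_index m d" for x
    using that by (auto simp: cluster_index_def)
  have h: "h x \<in> U \<inter> cluster s m E a (fst x)" if "x \<in> cluster_index m d" for x
    using g(1) index[OF that] unfolding h_def by blast
  moreover have "inj_on h (cluster_index m d)"
  proof (rule inj_onI)
    fix x y assume xy: "x \<in> cluster_index m d" "y \<in> cluster_index m d" and eq: "h x = h y"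
    have same: "fst x = fst y"
      using cluster_disjoint[OF index(1)[OF xy(1)] index(1)[OF xy(2)], of s E a]
        h[OF xy(1)] h[OF xy(2)] eq by auto
    moreover have "snd x = snd y"
      using inj_onD[OF g(2)[OF index(1)[OF xy(1)]], of "snd x" "snd y"] eq same
        index(2)[OF xy(1)] index(2)[OF xy(2)]
      by (simp add: h_def)
    ultimately show "x = y" by (rule prod_eqI)
  qed
  ultimately show thesis using that by blast
qed

lemma copies_nonempty_if_clusters_large:
  assumes "s \<ge> 2" "s - 1 \<le> m" "\<forall>e\<in>E. card e = s" and a: "inj_on a {..m}" "a ` {..m} \<subseteq> {1..n}"
    and large: "\<And>i. i \<le> m \<Longrightarrow> cluster_size d i \<le> card ({1..n} \<inter> cluster s m E a i)"
  shows "copies (pattern_vertices m d) (pattern_edges s m d) n E \<noteq> {}"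
proof -
  obtain h where inj: "inj_on h (cluster_index m d)"
    and h: "\<And>x. x \<in> cluster_index m d \<Longrightarrow> h x \<in> {1..n} \<inter> cluster s m E a (fst x)"
    using ex_cluster_enumeration[OF finite_atLeastAtMost large] by blast
  have "h x \<notin> a ` {..m}" if x: "x \<in> cluster_index m d" for x
  proof -
    have "fst x \<le> m" using x by (auto simp: cluster_index_def)
    then show ?thesis using cluster_notin[OF _ a(1) _ assms(2,1,3)] h[OF x] by blast
  qed
  then have "h ` cluster_index m d \<subseteq> - (a ` {..m})" by (intro image_subsetI) simp
  then have "a ` {..m} \<inter> h ` cluster_index m d = {}" by blast
  moreover have "joined s E (h x) (a ` ({..m} - {fst x}))" if "x \<in> cluster_index m d" for x
    using h[OF that] by (simp add: cluster_def)
  ultimately show ?thesis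
    using h by (intro copies_pattern_nonempty[OF a inj]) auto
qed

lemma card_linking_edges:
  assumes "finite Y" "finite B" "Y \<inter> B = {}" "s \<ge> 2" and u: "\<And>y. y \<in> Y \<Longrightarrow> u y \<notin> B \<union> Y"
  shows "card (\<Union>y\<in>Y. star s (u y) (insert y B)) =
    card (u ` Y) * (card B choose (s - 1)) + card Y * (card B choose (s - 2))"
proof -
  define F\<^sub>1 where "F\<^sub>1 = (\<Union>v\<in>u ` Y. star s v B)"
  define F\<^sub>2 where "F\<^sub>2 = (\<Union>y\<in>Y. insert y ` star (s - 1) (u y) B)"
  have "star s (u y) (insert y B) = star s (u y) B \<union> insert y ` star (s - 1) (u y) B"
    if "y \<in> Y" for y
    using assms(2-4) that by (intro star_insert) auto
  then have split: "(\<Union>y\<in>Y. star s (u y) (insert y B)) = F\<^sub>1 \<union> F\<^sub>2"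
    by (auto simp: F\<^sub>1_def F\<^sub>2_def)
  have trace: "e \<inter> Y = {y}" if "y \<in> Y" "e \<in> insert y ` star (s - 1) (u y) B" for y e
    using that u assms(3) by (auto simp: star_def)
  have "e \<inter> Y = {}" if "e \<in> F\<^sub>1" for e
    using that u assms(3) by (auto simp: F\<^sub>1_def star_def)
  moreover have "e \<inter> Y \<noteq> {}" if "e \<in> F\<^sub>2" for e
    using that trace unfolding F\<^sub>2_def by blast
  ultimately have "F\<^sub>1 \<inter> F\<^sub>2 = {}" by blast
  moreover have "finite F\<^sub>1" "finite F\<^sub>2"
    using assms(1,2) by (auto simp: F\<^sub>1_def F\<^sub>2_def finite_star)
  ultimately have "card (\<Union>y\<in>Y. star s (u y) (insert y B)) = card F\<^sub>1 + card F\<^sub>2"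
    unfolding split by (rule card_Un_disjoint[rotated 2])
  moreover have "card F\<^sub>1 = card (u ` Y) * (card B choose (s - 1))"
    unfolding F\<^sub>1_def using assms(1,2) u by (subst card_UN_star) auto
  moreover have "card F\<^sub>2 = (\<Sum>y\<in>Y. card (insert y ` star (s - 1) (u y) B))"
    unfolding F\<^sub>2_def
  proof (rule card_UN_disjoint)
    show "\<forall>y\<in>Y. \<forall>z\<in>Y. y \<noteq> z \<longrightarrow>
        insert y ` star (s - 1) (u y) B \<inter> insert z ` star (s - 1) (u z) B = {}"
      using trace by blast
  qed (use assms(1,2) in \<open>auto simp: finite_star\<close>)
  moreover have "card (insert y ` star (s - 1) (u y) B) = card B choose (s - 2)" if "y \<in> Y" for y
    using that u[OF that] assms(2,3) by (intro card_insert_image_star) auto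
  ultimately show ?thesis by simp
qed

locale tight_copy = critical_parameters +
  fixes n :: nat and E :: "nat set set" and \<phi> :: "nat + nat \<times> nat \<Rightarrow> nat"
  assumes edges: "E \<subseteq> possible_edges s n"
    and copy: "\<phi> \<in> copies V F n E"
    and sparse: "sparse \<alpha> (card V + d + 2) n E"
begin

definition copy_vertices :: "nat set" where
  "copy_vertices = \<phi> ` V"

definition core :: "nat \<Rightarrow> nat" where
  "core i = \<phi> (Inl i)"

definition attached :: "nat \<Rightarrow> nat set" where
  "attached i = (\<lambda>j. \<phi> (Inr (i, j))) ` {..<cluster_size d i}"

lemma inj_on_V: "inj_on \<phi> V"
  using copy by (simp add: copies_def placements_def)

lemma copy_vertices_subset: "copy_vertices \<subseteq> {1..n}"
  using copy by (auto simp: copy_vertices_def copies_def placements_def)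

lemma finite_copy_vertices: "finite copy_vertices"
  using copy_vertices_subset finite_subset by blast

lemma card_copy_vertices: "card copy_vertices = card V"
  unfolding copy_vertices_def by (rule card_image[OF inj_on_V])

lemma finite_E: "finite E"
  using edges by (rule finite_subset) simp

lemma uniform: "\<forall>e\<in>E. card e = s"
  using edges by (auto simp: possible_edges_def)

lemma inj_on_core: "inj_on core {..m}"
  using inj_on_V by (auto simp: core_def inj_on_def pattern_vertices_def)

lemma core_subset: "core ` {..m} \<subseteq> copy_vertices"
  by (auto simp: core_def copy_vertices_def pattern_vertices_def)

lemma attached_subset:
  assumes "i \<le> m"
  shows "attached i \<subseteq> copy_vertices - core ` {..m}"
proof -
  have "Inr (i, j) \<in> V" if "j < cluster_size d i" for j
    using that assms by (simp add: pattern_vertices_def cluster_index_def)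
  moreover have "Inl k \<in> V" if "k \<le> m" for k using that by (simp add: pattern_vertices_def)
  ultimately show ?thesis
    using inj_onD[OF inj_on_V] unfolding attached_def core_def copy_vertices_def by fastforce
qed

lemma attached_eqD:
  assumes "y \<in> attached i" "y \<in> attached i'" "i \<le> m" "i' \<le> m"
  shows "i = i'"
proof -
  obtain j where "y = \<phi> (Inr (i, j))" "j < cluster_size d i"
    using assms(1) by (auto simp: attached_def)
  moreover obtain j' where "y = \<phi> (Inr (i', j'))" "j' < cluster_size d i'"
    using assms(2) by (auto simp: attached_def)
  ultimately show ?thesis
    using inj_onD[OF inj_on_V, of "Inr (i, j)" "Inr (i', j')"] assms(3,4)
    by (auto simp: pattern_vertices_def cluster_index_def)
qed

lemma card_attached:
  assumes "i \<le> m"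
  shows "card (attached i) = cluster_size d i"
proof -
  have "inj_on (\<lambda>j. \<phi> (Inr (i, j))) {..<cluster_size d i}"
    using inj_on_V assms by (auto simp: inj_on_def pattern_vertices_def cluster_index_def)
  then show ?thesis by (simp add: attached_def card_image)
qed

lemma image_F: "(`) \<phi> ` F = (\<Union>i\<in>{..m}. \<Union>y\<in>attached i. star s y (core ` ({..m} - {i})))"
proof -
  have "\<phi> \<circ> Inl = core" by (auto simp: core_def)
  then show ?thesis
    unfolding image_pattern_edges[OF inj_on_V] by (fastforce simp: cluster_index_def attached_def)
qed

lemma joined_attached: "y \<in> attached i \<Longrightarrow> i \<le> m \<Longrightarrow> joined s E y (core ` ({..m} - {i}))"
proof -
  assume "y \<in> attached i" "i \<le> m"
  then have "star s y (core ` ({..m} - {i})) \<subseteq> (`) \<phi> ` F" unfolding image_F by blast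
  also have "\<dots> \<subseteq> E" using copy by (simp add: copies_def)
  finally show ?thesis .
qed

lemma surplus_edges_le:
  assumes "copy_vertices \<subseteq> W" "W \<subseteq> {1..n}" "card W \<le> card V + d + 2"
    and "F' \<subseteq> E" "F' \<subseteq> Pow W" "F' \<inter> (`) \<phi> ` F = {}"
  shows "\<alpha> * card F' \<le> card (W - copy_vertices)"
proof (rule sparse_surplus_edges_le[OF sparse critical_exponent_pos finite_E
      assms(1-3) _ _ _ assms(4,5)])
  show "(`) \<phi> ` F \<subseteq> E" using copy by (simp add: copies_def)
  show "(`) \<phi> ` F \<subseteq> Pow copy_vertices"
    using edge_subset by (auto simp: copy_vertices_def)
  have "card ((`) \<phi> ` F) = card F"
    using copy by (intro card_placement_edges[of \<phi> n]) (simp add: copies_def)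
  then show "\<alpha> * card ((`) \<phi> ` F) = card copy_vertices"
    using critical_exponent_times_edges by (simp add: card_copy_vertices)
qed (use assms(6) in blast)

lemma induced_edge_in_copy:
  assumes "e \<in> E" "e \<subseteq> copy_vertices"
  shows "e \<in> (`) \<phi> ` F"
proof (rule ccontr)
  assume "e \<notin> (`) \<phi> ` F"
  then have "\<alpha> * card {e} \<le> card (copy_vertices - copy_vertices)"
    using assms copy_vertices_subset by (intro surplus_edges_le) (auto simp: card_copy_vertices)
  then show False using critical_exponent_pos by simp
qed

lemma induced_edge_not_within_core:
  assumes "e \<in> E" "e \<subseteq> copy_vertices"
  shows "\<not> e \<subseteq> core ` {..m}"
proof -
  obtain i y where "i \<le> m" "y \<in> attached i" "e \<in> star s y (core ` ({..m} - {i}))"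
    using induced_edge_in_copy[OF assms] unfolding image_F by blast
  then have "y \<in> e" "y \<notin> core ` {..m}" using mem_star[of e s y] attached_subset[of i] by auto
  then show ?thesis by blast
qed

lemma induced_edge_attached:
  assumes "e \<in> E" "e \<subseteq> copy_vertices" "y \<in> e" "y \<notin> core ` {..m}"
  shows induced_edge_within_insert_core: "e \<subseteq> insert y (core ` {..m})"
    and core_notin_induced_edge: "i \<le> m \<Longrightarrow> y \<in> attached i \<Longrightarrow> core i \<notin> e"
proof -
  obtain j z where j: "j \<le> m" "z \<in> attached j" and "e \<in> star s z (core ` ({..m} - {j}))"
    using induced_edge_in_copy[OF assms(1,2)] unfolding image_F by blast
  then have e: "e \<subseteq> insert z (core ` ({..m} - {j}))"
    using star_subset_Pow[of s z "core ` ({..m} - {j})"] by auto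
  with assms(3,4) have "y = z" by blast
  with e show "e \<subseteq> insert y (core ` {..m})" by blast
  assume "i \<le> m" "y \<in> attached i"
  then have "i = j" using attached_eqD j \<open>y = z\<close> by blast
  moreover have "core j \<notin> core ` ({..m} - {j})" using inj_on_core j(1) by (auto simp: inj_on_def)
  moreover have "core j \<noteq> y" using assms(4) j(1) by blast
  ultimately show "core i \<notin> e" using e \<open>y = z\<close> by blast
qed

lemma not_joined_attached:
  assumes "y \<in> attached i" "i \<le> m" "j \<le> m" "i \<noteq> j"
  shows "\<not> joined s E y (core ` ({..m} - {j}))"
proof
  assume joined: "joined s E y (core ` ({..m} - {j}))"
  have "\<exists>S. {core i} \<subseteq> S \<and> S \<subseteq> core ` ({..m} - {j}) \<and> card S = s - 1"
    using card_image_atMost_minus[OF inj_on_core assms(3)] assms(2,4) s_ge_2 m_ge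
    by (intro exists_subset_between) auto
  then obtain S where S: "{core i} \<subseteq> S" "S \<subseteq> core ` ({..m} - {j})" "card S = s - 1"
    by blast
  then have "insert y S \<in> E" using joined insert_mem_star[OF S(2,3), of y] by blast
  moreover have "S \<subseteq> core ` {..m}" using S(2) by blast
  then have "insert y S \<subseteq> copy_vertices" using core_subset attached_subset assms(1,2) by blast
  moreover have "y \<notin> core ` {..m}" using attached_subset assms(1,2) by blast
  ultimately have "core i \<notin> insert y S"
    using core_notin_induced_edge[of "insert y S" y i] assms(1,2) by blast
  with S(1) show False by blast
qed

lemma attached_subset_cluster:
  assumes "i \<le> m"
  shows "attached i \<subseteq> cluster s m E core i"
proof
  fix y assume y: "y \<in> attached i"
  then have "y \<noteq> core i" using attached_subset[OF assms] assms by blast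
  then show "y \<in> cluster s m E core i"
    using joined_attached[OF y assms] not_joined_attached[OF y assms] by (auto simp: cluster_def)
qed

lemma linking_vertex_notin_copy:
  assumes "y \<in> copy_vertices - core ` {..m}" "v \<noteq> y"
    and joined: "joined s E v (insert y (core ` {3..m}))"
  shows "v \<notin> copy_vertices"
proof
  assume v: "v \<in> copy_vertices"
  have core: "core ` {3..m} \<subseteq> core ` {..m}" by auto
  have within: "insert v S \<subseteq> copy_vertices" if "S \<subseteq> insert y (core ` {3..m})" for S
    using that v assms(1) core core_subset by blast
  have "y \<notin> core ` {3..m}" using assms(1) core by blast
  have "s - 1 \<le> card (core ` {3..m})"
    using card_image_atLeast3_atMost[OF inj_on_core] m_ge by simp
  then obtain S where S: "S \<subseteq> core ` {3..m}" "card S = s - 1"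
    by (rule obtain_subset_with_card_n)
  then have "insert v S \<in> E"
    using joined insert_mem_star[of S "insert y (core ` {3..m})" s v] by blast
  then have "v \<notin> core ` {..m}"
    using induced_edge_not_within_core[of "insert v S"] within[of S] S(1) core by blast
  moreover have "\<exists>T. {y} \<subseteq> T \<and> T \<subseteq> insert y (core ` {3..m}) \<and> card T = s - 1"
    using card_image_atLeast3_atMost[OF inj_on_core] \<open>y \<notin> core ` {3..m}\<close> s_ge_2 m_ge
    by (intro exists_subset_between) auto
  then obtain T where T: "{y} \<subseteq> T" "T \<subseteq> insert y (core ` {3..m})" "card T = s - 1"
    by blast
  then have "insert v T \<in> E" using joined insert_mem_star[OF T(2,3), of v] by blast
  then have "insert v T \<subseteq> insert y (core ` {..m})"
    using induced_edge_within_insert_core[of "insert v T" y] within[OF T(2)] T(1) assms(1) by blast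
  ultimately show False using assms(2) by blast
qed

lemma linking_vertices:
  assumes Y: "Y \<subseteq> copy_vertices - core ` {..m}" and "covered s m {1..n} E core Y"
  obtains p u where "p \<in> {1..n} - core ` {..m}" "p \<notin> Y"
    "\<And>y. y \<in> Y \<Longrightarrow> u y \<in> {1..n} - copy_vertices - insert y (insert p (core ` {3..m}))"
    "\<And>y. y \<in> Y \<Longrightarrow> joined s E (u y) (insert y (insert p (core ` {3..m})))"
proof -
  obtain p where p: "p \<in> {1..n} - core ` {..m}"
    and linked: "\<forall>y\<in>{1..n} \<inter> Y. y \<noteq> p \<and> linked s {1..n} E (insert y (core ` {3..m})) p"
    using assms(2) unfolding covered_def by blast
  define B where "B = insert p (core ` {3..m})"
  have core: "core ` {3..m} \<subseteq> core ` {..m}" by auto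
  have "\<forall>y\<in>Y. y \<noteq> p \<and> (\<exists>u\<in>{1..n}. joined s E u (insert y B))"
    using linked Y copy_vertices_subset unfolding linked_def B_def by (auto simp: insert_commute)
  then obtain u where "p \<notin> Y" and u: "\<And>y. y \<in> Y \<Longrightarrow> u y \<in> {1..n}"
    "\<And>y. y \<in> Y \<Longrightarrow> joined s E (u y) (insert y B)"
    by metis
  have "u y \<in> {1..n} - copy_vertices - insert y B" if y: "y \<in> Y" for y
  proof -
    have "y \<notin> core ` {3..m}" "p \<notin> core ` {3..m}" "y \<noteq> p"
      using y Y p core \<open>p \<notin> Y\<close> by auto
    then have "card (insert y B) = m"
      using card_image_atLeast3_atMost[OF inj_on_core] s_ge_2 m_ge by (simp add: B_def)
    then have notin: "u y \<notin> insert y B"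
      using u(2)[OF y] m_ge s_ge_2 uniform by (intro joined_notin) (auto simp: B_def)
    moreover have "joined s E (u y) (insert y (core ` {3..m}))"
      using u(2)[OF y] star_mono[of "insert y (core ` {3..m})" "insert y B" s "u y"]
      by (auto simp: B_def)
    then have "u y \<notin> copy_vertices"
      using Y y notin by (intro linking_vertex_notin_copy[of y]) auto
    ultimately show ?thesis using u(1)[OF y] by blast
  qed
  with p \<open>p \<notin> Y\<close> u(2) show thesis by (intro that[of p u]) (simp_all add: B_def)
qed

lemma linking_edges_le:
  fixes u :: "nat \<Rightarrow> nat" and p :: nat
  defines "B \<equiv> insert p (core ` {3..m})"
  assumes Y: "Y \<subseteq> copy_vertices - core ` {..m}" "card Y = d + 1"
    and p: "p \<in> {1..n}"
    and u: "\<And>y. y \<in> Y \<Longrightarrow> u y \<in> {1..n} - copy_vertices"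
    and joined: "\<And>y. y \<in> Y \<Longrightarrow> joined s E (u y) (insert y B)"
  shows "\<alpha> * card (\<Union>y\<in>Y. star s (u y) (insert y B)) \<le> 1 + card (u ` Y)"
proof -
  define W where "W = copy_vertices \<union> insert p (u ` Y)"
  have finY: "finite Y" using Y(1) finite_copy_vertices finite_subset by blast
  have "card (W - copy_vertices) \<le> card (insert p (u ` Y))"
    using finY by (intro card_mono) (auto simp: W_def)
  also have "\<dots> \<le> 1 + card (u ` Y)" using finY by (simp add: card_insert_if)
  finally have cardW: "card (W - copy_vertices) \<le> 1 + card (u ` Y)" .
  have "\<alpha> * card (\<Union>y\<in>Y. star s (u y) (insert y B)) \<le> card (W - copy_vertices)"
  proof (rule surplus_edges_le)
    show "copy_vertices \<subseteq> W" by (auto simp: W_def)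
    then have "card W = card V + card (W - copy_vertices)"
      unfolding card_copy_vertices[symmetric] using finite_copy_vertices finY
      by (subst card_Un_disjoint[symmetric]) (auto simp: W_def intro!: arg_cong[where f=card])
    then show "card W \<le> card V + d + 2"
      using cardW card_image_le[OF finY, of u] Y(2) by simp
    show "W \<subseteq> {1..n}" using copy_vertices_subset p u by (auto simp: W_def)
    show "(\<Union>y\<in>Y. star s (u y) (insert y B)) \<subseteq> E" using joined by blast
    have "B \<subseteq> W" using core_subset by (auto simp: B_def W_def)
    then have within: "insert (u y) (insert y B) \<subseteq> W" if "y \<in> Y" for y
      using that Y(1) by (auto simp: W_def)
    show "(\<Union>y\<in>Y. star s (u y) (insert y B)) \<subseteq> Pow W"
      by (intro UN_least order_trans[OF star_subset_Pow Pow_mono] within)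
    have "\<not> e \<subseteq> copy_vertices" if "y \<in> Y" "e \<in> star s (u y) (insert y B)" for y e
      using u[OF that(1)] mem_star[OF that(2)] by blast
    moreover have "(`) \<phi> ` F \<subseteq> Pow copy_vertices"
      using edge_subset by (auto simp: copy_vertices_def)
    ultimately show "(\<Union>y\<in>Y. star s (u y) (insert y B)) \<inter> (`) \<phi> ` F = {}" by blast
  qed
  also have "\<dots> \<le> real (1 + card (u ` Y))" using cardW by (rule of_nat_mono)
  finally show ?thesis by simp
qed

lemma not_covered_if_large:
  assumes Y: "Y \<subseteq> copy_vertices - core ` {..m}" "card Y = d + 1"
  shows "\<not> covered s m {1..n} E core Y"
proof
  assume "covered s m {1..n} E core Y"
  then obtain p u where p: "p \<in> {1..n} - core ` {..m}" "p \<notin> Y"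
    and u: "\<And>y. y \<in> Y \<Longrightarrow> u y \<in> {1..n} - copy_vertices - insert y (insert p (core ` {3..m}))"
    and joined: "\<And>y. y \<in> Y \<Longrightarrow> joined s E (u y) (insert y (insert p (core ` {3..m})))"
    using linking_vertices[OF Y(1)] by blast
  define B where "B = insert p (core ` {3..m})"
  have core: "core ` {3..m} \<subseteq> core ` {..m}" by auto
  have finY: "finite Y" using Y(1) finite_copy_vertices finite_subset by blast
  have "p \<notin> core ` {3..m}" using p(1) core by blast
  then have "card B = m - 1"
    using card_image_atLeast3_atMost[OF inj_on_core] m_ge s_ge_2 by (simp add: B_def)
  moreover have "Y \<inter> B = {}" using Y(1) p(2) core by (auto simp: B_def)
  moreover have "u y \<notin> B \<union> Y" if "y \<in> Y" for y using u[OF that] Y(1) by (auto simp: B_def)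
  ultimately have "card (\<Union>y\<in>Y. star s (u y) (insert y B)) = card (u ` Y) * \<beta> + (d + 1) * \<gamma>"
    using card_linking_edges[OF finY _ _ s_ge_2, of B u] Y(2) by (simp add: B_def)
  moreover have "\<alpha> * card (\<Union>y\<in>Y. star s (u y) (insert y B)) \<le> 1 + card (u ` Y)"
    unfolding B_def using p(1) u joined by (intro linking_edges_le[OF Y]) auto
  ultimately have "\<alpha> * (card (u ` Y) * \<beta> + (d + 1) * \<gamma>) \<le> 1 + card (u ` Y)" by simp
  moreover have "card (u ` Y) \<le> d + 1" using card_image_le[OF finY, of u] Y(2) by simp
  then have "card (u ` Y) * (1 - \<alpha> * \<beta>) \<le> (d + 1) * (1 - \<alpha> * \<beta>)"
    using critical_exponent_times_lower_choose by (intro mult_right_mono of_nat_mono) auto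
  ultimately have "(d + 1) * (\<alpha> * real (\<beta> + \<gamma>) - 1) \<le> 1" by (simp add: algebra_simps)
  then show False
    unfolding critical_exponent_times_choose using Suc_d_times_excess_greater_1 by simp
qed

lemma uncoverable_of_copy: "uncoverable s m {1..n} E"
proof -
  define b where "b = \<phi> (Inr (0, 0))"
  have b: "b \<in> attached 0" by (auto simp: b_def attached_def cluster_size_def)
  have "\<not> covered s m {1..n} E core (insert b (cluster s m E core i))" if i: "i \<le> m" for i
  proof
    assume covered: "covered s m {1..n} E core (insert b (cluster s m E core i))"
    have "insert b (attached i) \<subseteq> insert b (cluster s m E core i)"
      using attached_subset_cluster[OF i] by blast
    with covered have "covered s m {1..n} E core (insert b (attached i))"
      unfolding covered_def by blast
    moreover have "insert b (attached i) \<subseteq> copy_vertices - core ` {..m}"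
      using attached_subset[OF i] attached_subset[of 0] b by blast
    moreover have "card (insert b (attached i)) = d + 1"
    proof (cases "i = 0")
      case True
      then show ?thesis using b card_attached[OF i] by (simp add: insert_absorb cluster_size_def)
    next
      case False
      then have "b \<notin> attached i" using attached_eqD[OF b] i by blast
      moreover have "finite (attached i)" by (simp add: attached_def)
      ultimately show ?thesis using card_attached[OF i] False by (simp add: cluster_size_def)
    qed
    ultimately show False using not_covered_if_large by blast
  qed
  moreover have "b \<in> {1..n} \<inter> cluster s m E core 0"
    using b attached_subset_cluster[of 0] attached_subset[of 0] copy_vertices_subset by blast
  moreover have "core ` {..m} \<subseteq> {1..n}" using core_subset copy_vertices_subset by blast
  ultimately show ?thesis unfolding uncoverable_def using inj_on_core by blast
qed

end

section \<open>The spectrum\<close>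

context critical_parameters
begin

lemma uncoverable_iff_copies_nonempty:
  assumes E: "E \<subseteq> possible_edges s n" and "sparse \<alpha> (card V + d + 2) n E"
    and "extendable s (m - 1) d (m + 1 + d) {1..n} E"
  shows "uncoverable s m {1..n} E \<longleftrightarrow> copies V F n E \<noteq> {}"
proof
  have uniform: "\<forall>e\<in>E. card e = s" using E by (auto simp: possible_edges_def)
  have m_bounds: "m \<ge> 2" "s - 1 \<le> m" using m_ge s_ge_2 by auto
  assume uncoverable: "uncoverable s m {1..n} E"
  obtain a where "inj_on a {..m}" "a ` {..m} \<subseteq> {1..n}"
    "\<And>i. i \<le> m \<Longrightarrow> cluster_size d i \<le> card ({1..n} \<inter> cluster s m E a i)"
    using clusters_large_if_uncoverable[OF s_ge_2 m_bounds uniform finite_atLeastAtMost uncoverable assms(3)] by blast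
  then show "copies V F n E \<noteq> {}"
    by (rule copies_nonempty_if_clusters_large[OF s_ge_2 m_bounds(2) uniform])
next
  assume "copies V F n E \<noteq> {}"
  then obtain \<phi> where "\<phi> \<in> copies V F n E" by blast
  then interpret tight_copy s m d n E \<phi>
    using assms(1,2) by unfold_locales
  show "uncoverable s m {1..n} E" by (rule uncoverable_of_copy)
qed

lemma aas_models_iff_copies_nonempty:
  "aas (\<lambda>n. random_edges s n (real n powr - \<alpha>))
    (\<lambda>n E. models ({1..n}, E) (uncoverable_fm s m) \<longleftrightarrow> copies V F n E \<noteq> {})"
proof (rule aas_mono)
  have "aas (\<lambda>n. random_edges s n (real n powr - \<alpha>))
      (\<lambda>n. extendable s (m - 1) d (m + 1 + d) {1..n})"
  proof (rule aas_extendable[OF s_ge_2 critical_exponent_pos])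
    show "\<alpha> * real \<beta> < 1" by (rule critical_exponent_times_lower_choose)
    have "\<alpha> * (real \<beta> + real \<gamma>) = 1 + \<epsilon>"
      using critical_exponent_times_choose unfolding of_nat_add .
    then show "1 \<le> \<alpha> * (real \<beta> + real \<gamma>)" "real d * (\<alpha> * (real \<beta> + real \<gamma>) - 1) < 1"
      using excess_pos[of m d] d_times_excess_less_1 by simp_all
  qed
  then show "aas (\<lambda>n. random_edges s n (real n powr - \<alpha>))
      (\<lambda>n E. sparse \<alpha> (card V + d + 2) n E \<and> extendable s (m - 1) d (m + 1 + d) {1..n} E)"
    by (intro aas_conj aas_sparse critical_exponent_pos)
  show "\<forall>\<^sub>F n in sequentially. \<forall>E\<in>set_pmf (random_edges s n (real n powr - \<alpha>)).
      sparse \<alpha> (card V + d + 2) n E \<and> extendable s (m - 1) d (m + 1 + d) {1..n} E \<longrightarrow>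
      (models ({1..n}, E) (uncoverable_fm s m) \<longleftrightarrow> copies V F n E \<noteq> {})"
    using eventually_ge_at_top[of 1]
  proof eventually_elim
    case (elim n)
    show ?case
    proof (intro ballI impI)
      fix E assume "E \<in> set_pmf (random_edges s n (real n powr - \<alpha>))"
        and "sparse \<alpha> (card V + d + 2) n E \<and> extendable s (m - 1) d (m + 1 + d) {1..n} E"
      moreover from this have E: "E \<subseteq> possible_edges s n" by (intro set_pmf_random_subset)
      ultimately have "uncoverable s m {1..n} E \<longleftrightarrow> copies V F n E \<noteq> {}"
        by (intro uncoverable_iff_copies_nonempty) auto
      moreover have "models ({1..n}, E) (uncoverable_fm s m) \<longleftrightarrow> uncoverable s m {1..n} E"
        using E elim m_ge by (intro models_uncoverable_fm s_ge_2) (auto simp: possible_edges_def)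
      ultimately show "models ({1..n}, E) (uncoverable_fm s m) \<longleftrightarrow> copies V F n E \<noteq> {}" by simp
    qed
  qed
qed

lemma prob_copies_nonempty_le_half_critical:
  assumes "n > 0"
  shows "measure_pmf.prob (random_edges s n (real n powr - \<alpha>)) {E. copies V F n E \<noteq> {}} \<le> 1 / 2"
proof -
  let ?\<sigma> = "Transposition.transpose (Inr (0, 0)) (Inr (0, 1) :: nat + nat \<times> nat)"
  have "measure_pmf.prob (random_edges s n (real n powr - \<alpha>)) {E. copies V F n E \<noteq> {}} \<le>
      real n ^ card V * (real n powr - \<alpha>) ^ card F / 2"
  proof (rule prob_copies_nonempty_le_half)
    show "bij_betw ?\<sigma> V V" "(`) ((`) ?\<sigma>) F \<subseteq> F"
      by (rule pattern_swap_automorphism[OF d_ge_1])+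
    show "Inr (0, 0) \<in> V"
      by (auto simp: pattern_vertices_def cluster_index_def cluster_size_def)
  qed (auto intro: powr_minus_le_1 critical_exponent_pos)
  then show ?thesis
    by (simp only: critical_expectation_eq_1[OF critical_exponent_times_edges assms])
qed

lemma critical_exponent_in_spectrum_upto:
  assumes "k \<ge> m + 5"
  shows "\<alpha> \<in> spectrum_upto s k"
proof -
  obtain c where "0 < c" "\<forall>\<^sub>F n in sequentially.
      c \<le> measure_pmf.prob (random_edges s n (real n powr - \<alpha>)) {E. copies V F n E \<noteq> {}}"
    using prob_copies_nonempty_ge[OF balanced_critical_exponent critical_exponent_pos critical_exponent_times_edges] .
  moreover have "\<forall>\<^sub>F n in sequentially.
      measure_pmf.prob (random_edges s n (real n powr - \<alpha>)) {E. copies V F n E \<noteq> {}} \<le> 1 / 2"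
    using eventually_gt_at_top[of 0] by eventually_elim (rule prob_copies_nonempty_le_half_critical)
  ultimately have "\<not> ((\<lambda>n. measure_pmf.prob (random_edges s n (real n powr - \<alpha>))
        {E. models ({1..n}, E) (uncoverable_fm s m)}) \<longlonglongrightarrow> 0 \<or>
      (\<lambda>n. measure_pmf.prob (random_edges s n (real n powr - \<alpha>))
        {E. models ({1..n}, E) (uncoverable_fm s m)}) \<longlonglongrightarrow> 1)"
    by (intro aas_iff_not_tendsto_0_or_1[OF aas_models_iff_copies_nonempty, where C="1 / 2"])
        simp_all
  then have "\<alpha> \<in> spectrum s {H. models H (uncoverable_fm s m)}"
    using critical_exponent_pos critical_exponent_less_1 s_ge_2
    by (simp add: spectrum_def random_hypergraph_eq_random_edges vimage_def)
  moreover have "{H. models H (uncoverable_fm s m)} \<in> fo_properties s k"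
    using s_ge_2 assms by (intro uncoverable_fm_in_fo_properties) auto
  ultimately show ?thesis by (auto simp: spectrum_upto_def)
qed

end

lemma excess_tendsto_0: "excess m \<longlonglongrightarrow> 0"
proof (rule Lim_null_comparison)
  show "(\<lambda>d. 1 / real d) \<longlonglongrightarrow> 0" by real_asymp
  show "\<forall>\<^sub>F d in sequentially. norm (excess m d) \<le> 1 / real d"
    using eventually_gt_at_top[of 0]
  proof eventually_elim
    case (elim d)
    have "0 < (m + 1) * d" using elim by simp
    then have "0 < real ((m + 1) * d)" by (simp only: of_nat_0_less_iff)
    moreover have "real ((m + 1) * d) \<le> card (cluster_index m d)"
      unfolding card_cluster_index by (intro of_nat_mono) simp
    ultimately have "excess m d \<le> real (m + 1) / real ((m + 1) * d)"
      unfolding excess_def by (intro divide_left_mono mult_pos_pos card_cluster_index_pos) auto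
    also have "\<dots> = 1 / real d" unfolding of_nat_mult by simp
    finally show ?case using excess_pos[of m d] by simp
  qed
qed

lemma inverse_choose_limit_point:
  assumes "s \<ge> 2" "m \<ge> s + 1" "k \<ge> m + 5"
  shows "1 / real (m choose (s - 1)) \<in> limit_points (spectrum_upto s k)"
proof -
  define b where "b = (m - 1) choose (s - 1)"
  have choose: "real (m choose (s - 1)) > 0" using assms(2) by simp
  have "critical_exponent s m (i + b) \<in> spectrum_upto s k - {1 / real (m choose (s - 1))}" for i
  proof -
    interpret critical_parameters s m "i + b"
      by unfold_locales (use assms(1,2) in \<open>auto simp: b_def\<close>)
    have "critical_exponent s m (i + b) \<noteq> 1 / real (m choose (s - 1))"
      using choose excess_pos[of m "i + b"] by (simp add: critical_exponent_def)
    then show ?thesis using critical_exponent_in_spectrum_upto[OF assms(3)] by simp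
  qed
  moreover have "(\<lambda>i. critical_exponent s m (i + b)) \<longlonglongrightarrow> (1 + 0) / real (m choose (s - 1))"
    unfolding critical_exponent_def using choose
    by (intro tendsto_intros LIMSEQ_ignore_initial_segment[OF excess_tendsto_0]) simp
  ultimately show ?thesis
    unfolding limit_points_def islimpt_sequential
    by (intro CollectI exI[of _ "\<lambda>i. critical_exponent s m (i + b)"]) auto
qed

lemma ex_least_limit_point:
  fixes A :: "real set"
  assumes "A \<subseteq> {b..}" "x \<in> limit_points A"
  shows "\<exists>m\<in>limit_points A. (\<forall>y\<in>limit_points A. m \<le> y) \<and> m \<le> x"
proof (intro bexI conjI ballI)
  have "limit_points A \<subseteq> {b..}"
    using assms(1) islimpt_subset closed_limpt[of "{b..}"] unfolding limit_points_def by blast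
  then have "bdd_below (limit_points A)" by (meson bdd_below.I atLeast_iff subsetD)
  then show "Inf (limit_points A) \<le> y" if "y \<in> limit_points A" for y
    using that by (intro cInf_lower)
  then show "Inf (limit_points A) \<le> x" using assms(2) .
  have "closed (limit_points A)" unfolding limit_points_def by (rule closed_limpts)
  then show "Inf (limit_points A) \<in> limit_points A"
    using assms(2) \<open>bdd_below (limit_points A)\<close> by (intro closed_contains_Inf) auto
qed

theorem theorem10:
  fixes s :: nat
  assumes "s \<ge> 2"
  shows "\<exists>C::nat. \<forall>k\<ge>s + C.
           \<exists>m\<in>limit_points (spectrum_upto s k).
             (\<forall>x\<in>limit_points (spectrum_upto s k). m \<le> x) \<and>
             m \<le> 1 / real ((k - 11) choose (s - 1))"
proof (intro exI allI impI)
  fix k assume k: "s + 12 \<le> k"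
  have "spectrum_upto s k \<subseteq> {0..}"
    by (auto simp: spectrum_upto_def spectrum_def)
  moreover have "1 / real ((k - 11) choose (s - 1)) \<in> limit_points (spectrum_upto s k)"
    using assms k by (intro inverse_choose_limit_point) auto
  ultimately show "\<exists>m\<in>limit_points (spectrum_upto s k).
      (\<forall>x\<in>limit_points (spectrum_upto s k). m \<le> x) \<and>
      m \<le> 1 / real ((k - 11) choose (s - 1))"
    by (rule ex_least_limit_point)
qed

end
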